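(* Let $p\ge0$. For $l\in\{0,1,2\}$ let $V^l_{+,p}\subset V^l_p$ be subspaces with $\mathrm{tr}^l(V^l_p)=\mathrm{tr}^l(V^l_0)\oplus\mathrm{tr}^l(V^l_{+,p})$ (for $p=0$, $V^l_{+,p}=\{0\}$), and set $V^l_{\mathrm{tr},0}:=\{u\in V^l:\mathrm{tr}^l(u)\in\mathrm{tr}^l(V^l_0)\}$ and $V^l_{\mathrm{tr},+}:=\{u\in V^l:\mathrm{tr}^l(u)\in\mathrm{tr}^l(V^l_{+,p})\}$. Let $P_0^l:V^l\to V^l_0$ and $P_+^l:V^l\to V^l_{+,p}$, $l\in\{0,1,2\}$, be linear operators such that: (1) $\mathrm{tr}^l(P_0^l(u))=\mathrm{tr}^l(u)$ for all $u\in V^l_{\mathrm{tr},0}$, $l\in\{0,1,2\}$; (2) $\mathrm{tr}^l(P_+^l(u))=\mathrm{tr}^l(u)$ and $\mathrm{tr}^l(P_0^l(u))=0$ for all $u\in V^l_{\mathrm{tr},+}$, $l\in\{0,1,2\}$; (3) for each of $P=P_0$ and $P=P_+$: $\mathrm{tr}^{l+1}(P^{l+1}(d^lu))=\mathrm{tr}^{l+1}(d^lP^l(u))$ for all $u\in V^l$, $l\in\{0,1\}$; (4) for each of $P=P_0$ and $P=P_+$: $P^l(u)|_\tau=0$ for all $u\in V^l$, $l\in\{0,1,2\}$, $\tau\in\mathring{\mathcal T}_h^l$; (5) for each of $P=P_0$ and $P=P_+$: $\|P^l(u)\|_{L^2(\tau)}\lesssim\|u\|_{L^2(\mathrm{es}^{1,l,\partial}(\tau))}+h_\tau\|d^lu\|_{L^2(\mathrm{es}^{1,l,\partial}(\tau))}$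 for all $u\in V^l$, $l\in\{0,1,2\}$, $\tau\in\mathcal T_h^{l,\partial}$. Define $\Pi_\partial^l:=P_0^l+P_+^l(I-P_0^l)$ for $l\in\{0,1,2\}$. Then: (a) $\mathrm{tr}^l(\Pi_\partial^l(u))=\mathrm{tr}^l(u)$ for all $u\in V^l_{\mathrm{tr},p}$, $l\in\{0,1,2\}$; (b) $\mathrm{tr}^{l+1}(d^l\Pi_\partial^l(u))=\mathrm{tr}^{l+1}(\Pi_\partial^{l+1}(d^lu))$ for all $u\in V^l$, $l\in\{0,1\}$; (c) $\Pi_\partial^l(u)|_\tau=0$ for all $u\in V^l$, $l\in\{0,1,2\}$, $\tau\in\mathring{\mathcal T}_h^l$; (d) $\|\Pi_\partial^l(u)\|_{L^2(\tau)}\lesssim\|u\|_{L^2(\mathrm{es}^{2,l,\partial}(\tau))}+h_\tau\|d^lu\|_{L^2(\mathrm{es}^{2,l,\partial}(\tau))}$ for all $u\in V^l$, $l\in\{0,1,2\}$, $\tau\in\mathcal T_h^{l,\partial}$.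
   Context: $\Omega\subset\mathbb R^3$ is a Lipschitz, polyhedral, open, bounded, connected set, $\Gamma:=\partial\Omega$, $\mathbf n$ its unit outward normal. $d^0:=\mathrm{grad}$, $d^1:=\mathrm{curl}$, $d^2:=\mathrm{div}$. $V^0:=H^1(\Omega)$, $V^1:=\mathbf H(\mathrm{curl},\Omega)$, $V^2:=\mathbf H(\mathrm{div},\Omega)$. Traces (in the usual weak sense): $\mathrm{tr}^0(u):=u|_\Gamma$, $\mathrm{tr}^1(\mathbf u):=(\mathbf n\times\mathbf u|_\Gamma)\times\mathbf n$, $\mathrm{tr}^2(\mathbf u):=\mathbf u|_\Gamma\cdot\mathbf n$. Mesh: $\mathcal T_h$ is a simplicial triangulation of $\Omega$ (closed tetrahedra), $h_\tau:=\mathrm{diam}(\tau)$; $\rho_{\mathcal T_h}:=\max_\tau h_\tau/\theta_\tau$, $\theta_\tau$ the diameter of the largest ball inscribed in $\tau$. Discrete spaces (for any degree $p\ge0$; $V^l_0$ is the case $p=0$): $V^0_p:=\{u\in V^0:u|_\tau\in\mathbb P_{p+1}(\tau)\ \forall\tau\in\mathcal T_h\}$; $V^1_p:=\{\mathbf u\in V^1:\mathbf u|_\tau\in\mathbf N_p(\tau)\ \forall\tau\}$ with $\mathbf N_p(\tau):=\{\mathbf a(\mathbf x)+\mathbf x\times\mathbf b(\mathbf x):\mathbf a,\mathbf b\in\mathbb P_p(\tau;\mathbb R^3)\}$; $V^2_p:=\{\mathbf u\in V^2:\mathbf u|_\tau\in\mathbf{RT}_p(\tau)\ \forall\tau\}$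 with $\mathbf{RT}_p(\tau):=\{\mathbf a(\mathbf x)+b(\mathbf x)\mathbf x:\mathbf a\in\mathbb P_p(\tau;\mathbb R^3),b\in\mathbb P_p(\tau)\}$. $V^l_{\mathrm{tr},p}:=\{u\in V^l:\mathrm{tr}^l(u)\in\mathrm{tr}^l(V^l_p)\}$. Patches: for $\tau\in\mathcal T_h$, $\mathrm{es}^1(\tau)$ is the interior of the union of all $\tau'\in\mathcal T_h$ with $\tau'\cap\tau\ne\emptyset$; $\mathrm{es}^2(\tau)$ is the interior of the union of all $\tau'\in\mathcal T_h$ meeting the closure of $\mathrm{es}^1(\tau)$. For $l\in\{0,1,2\}$, $\mathcal T_h^{l,\partial}$ is the set of $\tau\in\mathcal T_h$ having at least one $l$-dimensional subsimplex contained in $\Gamma$; $\mathring{\mathcal T}_h^l:=\mathcal T_h\setminus\mathcal T_h^{l,\partial}$; $\Omega^{l,\partial}$ is the interior of the union of the cells of $\mathcal T_h^{l,\partial}$; $\mathrm{es}^{k,l,\partial}(\tau):=\mathrm{es}^k(\tau)\cap\Omega^{l,\partial}$. $a\lesssim b$ means $a\le Cb$ with $C$ depending only on $\rho_{\mathcal T_h}$ and $p$ (in the conclusion, $C$ may depend on the constants in the hypotheses, which themselves depend only on $\rho_{\mathcal T_h}$ and $p$). *)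

theory Defs
  imports "HOL-Analysis.Analysis"
begin

type_synonym R3 = "real ^ 3"
type_synonym scalar_field = "real ^ 3 \<Rightarrow> real"
type_synonym vector_field = "real ^ 3 \<Rightarrow> real ^ 3"


section \<open>Classical differential operators and smooth test fields\<close>

definition pd :: "3 \<Rightarrow> scalar_field \<Rightarrow> scalar_field" where
  "pd i f x = frechet_derivative f (at x) (axis i 1)"

primrec C_k :: "nat \<Rightarrow> scalar_field \<Rightarrow> bool" where
  "C_k 0 f \<longleftrightarrow> continuous_on UNIV f"
| "C_k (Suc k) f \<longleftrightarrow> f differentiable_on UNIV \<and> (\<forall>i. C_k k (pd i f))"

definition smooth :: "scalar_field \<Rightarrow> bool" where
  "smooth f \<longleftrightarrow> (\<forall>k. C_k k f)"

definition smooth_vec :: "vector_field \<Rightarrow> bool" where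
  "smooth_vec \<psi> \<longleftrightarrow> (\<forall>i. smooth (\<lambda>x. \<psi> x $ i))"

definition supported_in :: "R3 set \<Rightarrow> (R3 \<Rightarrow> 'a::zero) \<Rightarrow> bool" where
  "supported_in \<Omega> \<phi> \<longleftrightarrow>
     compact (closure {x. \<phi> x \<noteq> 0}) \<and> closure {x. \<phi> x \<noteq> 0} \<subseteq> \<Omega>"

definition grad :: "scalar_field \<Rightarrow> vector_field" where
  "grad \<phi> x = (\<chi> i. pd i \<phi> x)"

definition curl :: "vector_field \<Rightarrow> vector_field" where
  "curl \<psi> x = vector
     [pd 2 (\<lambda>y. \<psi> y $ 3) x - pd 3 (\<lambda>y. \<psi> y $ 2) x,
      pd 3 (\<lambda>y. \<psi> y $ 1) x - pd 1 (\<lambda>y. \<psi> y $ 3) x,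
      pd 1 (\<lambda>y. \<psi> y $ 2) x - pd 2 (\<lambda>y. \<psi> y $ 1) x]"

definition dive :: "vector_field \<Rightarrow> scalar_field" where
  "dive \<psi> x = (\<Sum>i\<in>UNIV. pd i (\<lambda>y. \<psi> y $ i) x)"


section \<open>Square-integrable fields\<close>

text \<open>An element of a Lebesgue or Sobolev space over \<open>\<Omega>\<close> is represented by any function on the
  whole space that belongs, restricted to \<open>\<Omega>\<close>, to the corresponding equivalence class.  All sets
  of fields below are therefore closed under equality almost everywhere in \<open>\<Omega>\<close>, and operators
  between such spaces respect this equality.\<close>

definition ae_eq :: "R3 set \<Rightarrow> (R3 \<Rightarrow> 'a) \<Rightarrow> (R3 \<Rightarrow> 'a) \<Rightarrow> bool" where
  "ae_eq S u v \<longleftrightarrow> (AE x in lebesgue_on S. u x = v x)"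

definition L2 :: "R3 set \<Rightarrow> (R3 \<Rightarrow> 'a::euclidean_space) set" where
  "L2 S = {u. u \<in> borel_measurable (lebesgue_on S) \<and>
              integrable (lebesgue_on S) (\<lambda>x. (norm (u x))\<^sup>2)}"

definition L2_norm :: "R3 set \<Rightarrow> (R3 \<Rightarrow> 'a::euclidean_space) \<Rightarrow> real" where
  "L2_norm S u = sqrt (integral\<^sup>L (lebesgue_on S) (\<lambda>x. (norm (u x))\<^sup>2))"

definition ae_subspace :: "R3 set \<Rightarrow> (R3 \<Rightarrow> 'a::euclidean_space) set \<Rightarrow> bool" where
  "ae_subspace \<Omega> W \<longleftrightarrow>
     (\<lambda>x. 0) \<in> W \<and>
     (\<forall>u\<in>W. \<forall>v\<in>W. (\<lambda>x. u x + v x) \<in> W) \<and>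
     (\<forall>c. \<forall>u\<in>W. (\<lambda>x. c *\<^sub>R u x) \<in> W) \<and>
     (\<forall>u\<in>W. \<forall>v. ae_eq \<Omega> u v \<longrightarrow> v \<in> W)"

definition ae_linear_operator ::
  "R3 set \<Rightarrow> (R3 \<Rightarrow> 'a::euclidean_space) set \<Rightarrow> (R3 \<Rightarrow> 'a) set \<Rightarrow>
   ((R3 \<Rightarrow> 'a) \<Rightarrow> (R3 \<Rightarrow> 'a)) \<Rightarrow> bool" where
  "ae_linear_operator \<Omega> V W P \<longleftrightarrow>
     (\<forall>u\<in>V. P u \<in> W) \<and>
     (\<forall>u\<in>V. \<forall>v\<in>V. ae_eq \<Omega> u v \<longrightarrow> ae_eq \<Omega> (P u) (P v)) \<and>
     (\<forall>u\<in>V. \<forall>v\<in>V. ae_eq \<Omega> (P (\<lambda>x. u x + v x)) (\<lambda>x. P u x + P v x)) \<and>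
     (\<forall>c. \<forall>u\<in>V. ae_eq \<Omega> (P (\<lambda>x. c *\<^sub>R u x)) (\<lambda>x. c *\<^sub>R P u x))"


section \<open>Weak derivatives and the spaces of the de Rham complex\<close>

definition is_weak_grad :: "R3 set \<Rightarrow> scalar_field \<Rightarrow> vector_field \<Rightarrow> bool" where
  "is_weak_grad \<Omega> u g \<longleftrightarrow>
     (\<forall>\<psi>. smooth_vec \<psi> \<and> supported_in \<Omega> \<psi> \<longrightarrow>
        integral\<^sup>L (lebesgue_on \<Omega>) (\<lambda>x. u x * dive \<psi> x) =
        - integral\<^sup>L (lebesgue_on \<Omega>) (\<lambda>x. g x \<bullet> \<psi> x))"

definition is_weak_curl :: "R3 set \<Rightarrow> vector_field \<Rightarrow> vector_field \<Rightarrow> bool" where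
  "is_weak_curl \<Omega> u g \<longleftrightarrow>
     (\<forall>\<psi>. smooth_vec \<psi> \<and> supported_in \<Omega> \<psi> \<longrightarrow>
        integral\<^sup>L (lebesgue_on \<Omega>) (\<lambda>x. u x \<bullet> curl \<psi> x) =
        integral\<^sup>L (lebesgue_on \<Omega>) (\<lambda>x. g x \<bullet> \<psi> x))"

definition is_weak_div :: "R3 set \<Rightarrow> vector_field \<Rightarrow> scalar_field \<Rightarrow> bool" where
  "is_weak_div \<Omega> u g \<longleftrightarrow>
     (\<forall>\<phi>. smooth \<phi> \<and> supported_in \<Omega> \<phi> \<longrightarrow>
        integral\<^sup>L (lebesgue_on \<Omega>) (\<lambda>x. u x \<bullet> grad \<phi> x) =
        - integral\<^sup>L (lebesgue_on \<Omega>) (\<lambda>x. g x * \<phi> x))"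

definition H1 :: "R3 set \<Rightarrow> scalar_field set" where
  "H1 \<Omega> = {u \<in> L2 \<Omega>. \<exists>g \<in> L2 \<Omega>. is_weak_grad \<Omega> u g}"

definition Hcurl :: "R3 set \<Rightarrow> vector_field set" where
  "Hcurl \<Omega> = {u \<in> L2 \<Omega>. \<exists>g \<in> L2 \<Omega>. is_weak_curl \<Omega> u g}"

definition Hdiv :: "R3 set \<Rightarrow> vector_field set" where
  "Hdiv \<Omega> = {u \<in> L2 \<Omega>. \<exists>g \<in> L2 \<Omega>. is_weak_div \<Omega> u g}"

text \<open>A weak derivative is unique only up to equality almost everywhere in \<open>\<Omega>\<close>; the following
  operators select a representative.\<close>

definition wgrad :: "R3 set \<Rightarrow> scalar_field \<Rightarrow> vector_field" where
  "wgrad \<Omega> u = (SOME g. g \<in> L2 \<Omega> \<and> is_weak_grad \<Omega> u g)"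

definition wcurl :: "R3 set \<Rightarrow> vector_field \<Rightarrow> vector_field" where
  "wcurl \<Omega> u = (SOME g. g \<in> L2 \<Omega> \<and> is_weak_curl \<Omega> u g)"

definition wdiv :: "R3 set \<Rightarrow> vector_field \<Rightarrow> scalar_field" where
  "wdiv \<Omega> u = (SOME g. g \<in> L2 \<Omega> \<and> is_weak_div \<Omega> u g)"


section \<open>Weak traces\<close>

text \<open>Traces are distributions on \<open>\<Gamma> = frontier \<Omega>\<close>, i.e. functionals of smooth test fields,
  defined by Green's formulas.  With the unit outward normal \<open>n\<close> they extend
  \<open>tr0 \<Omega> u \<psi> = \<integral>\<^sub>\<Gamma> u (\<psi> \<bullet> n)\<close>,
  \<open>tr1 \<Omega> u \<psi> = \<integral>\<^sub>\<Gamma> ((n \<times> u) \<times> n) \<bullet> (n \<times> \<psi>)\<close> and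
  \<open>tr2 \<Omega> u \<phi> = \<integral>\<^sub>\<Gamma> (u \<bullet> n) \<phi>\<close>
  from fields that are smooth up to the boundary; for the second one note that
  \<open>((n \<times> u) \<times> n) \<bullet> (n \<times> \<psi>) = u \<bullet> (n \<times> \<psi>) = (\<psi> \<times> u) \<bullet> n\<close>
  and \<open>div (\<psi> \<times> u) = u \<bullet> curl \<psi> - curl u \<bullet> \<psi>\<close>.  As \<open>\<psi>\<close> and \<open>\<phi>\<close> vary, the boundary weights
  \<open>\<psi> \<bullet> n\<close>, \<open>n \<times> \<psi>\<close> and \<open>\<phi>\<close> are dense in the square-integrable scalar, tangential and scalar fields
  on \<open>\<Gamma>\<close>, so that the functionals determine the traces.\<close>

definition tr0 :: "R3 set \<Rightarrow> scalar_field \<Rightarrow> (vector_field \<Rightarrow> real)" where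
  "tr0 \<Omega> u = (\<lambda>\<psi>. if smooth_vec \<psi>
     then integral\<^sup>L (lebesgue_on \<Omega>) (\<lambda>x. u x * dive \<psi> x + wgrad \<Omega> u x \<bullet> \<psi> x) else 0)"

definition tr1 :: "R3 set \<Rightarrow> vector_field \<Rightarrow> (vector_field \<Rightarrow> real)" where
  "tr1 \<Omega> u = (\<lambda>\<psi>. if smooth_vec \<psi>
     then integral\<^sup>L (lebesgue_on \<Omega>) (\<lambda>x. u x \<bullet> curl \<psi> x - wcurl \<Omega> u x \<bullet> \<psi> x) else 0)"

definition tr2 :: "R3 set \<Rightarrow> vector_field \<Rightarrow> (scalar_field \<Rightarrow> real)" where
  "tr2 \<Omega> u = (\<lambda>\<phi>. if smooth \<phi>
     then integral\<^sup>L (lebesgue_on \<Omega>) (\<lambda>x. u x \<bullet> grad \<phi> x + wdiv \<Omega> u x * \<phi> x) else 0)"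

text \<open>The fields of \<open>V\<close> whose trace is the trace of some member of \<open>W\<close>.\<close>

definition trace_in :: "('u \<Rightarrow> 't) \<Rightarrow> 'u set \<Rightarrow> 'u set \<Rightarrow> 'u set" where
  "trace_in tr V W = {u \<in> V. tr u \<in> tr ` W}"

definition is_direct_sum ::
  "('t \<Rightarrow> real) set \<Rightarrow> ('t \<Rightarrow> real) set \<Rightarrow> ('t \<Rightarrow> real) set \<Rightarrow> bool" where
  "is_direct_sum A B C \<longleftrightarrow>
     A = {\<lambda>t. b t + c t | b c. b \<in> B \<and> c \<in> C} \<and> B \<inter> C = {\<lambda>t. 0}"


section \<open>Polyhedral Lipschitz domains and simplicial meshes\<close>

text \<open>Near each boundary point, \<open>\<Omega>\<close> is the strict epigraph, in some direction \<open>\<nu>\<close>, of a Lipschitz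
  function \<open>f\<close> of the coordinates orthogonal to \<open>\<nu>\<close>.\<close>

definition lipschitz_domain :: "R3 set \<Rightarrow> bool" where
  "lipschitz_domain \<Omega> \<longleftrightarrow> open \<Omega> \<and> bounded \<Omega> \<and> connected \<Omega> \<and>
     (\<forall>x \<in> frontier \<Omega>. \<exists>U \<nu> f L. open U \<and> x \<in> U \<and> norm \<nu> = 1 \<and>
        L-lipschitz_on UNIV (f :: R3 \<Rightarrow> real) \<and>
        \<Omega> \<inter> U = {y \<in> U. f (y - (y \<bullet> \<nu>) *\<^sub>R \<nu>) < y \<bullet> \<nu>})"

definition polyhedral :: "R3 set \<Rightarrow> bool" where
  "polyhedral \<Omega> \<longleftrightarrow>
     (\<exists>F. finite F \<and> (\<forall>S\<in>F. polytope S \<and> aff_dim S = 2) \<and> frontier \<Omega> = \<Union>F)"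

definition mesh :: "R3 set \<Rightarrow> R3 set set \<Rightarrow> bool" where
  "mesh \<Omega> \<T> \<longleftrightarrow> triangulation \<T> \<and> (\<forall>\<tau>\<in>\<T>. 3 simplex \<tau>) \<and> \<Union>\<T> = closure \<Omega>"

definition inscribed_diameter :: "R3 set \<Rightarrow> real" where
  "inscribed_diameter \<tau> = Sup {2 * r | x r. 0 \<le> r \<and> cball x r \<subseteq> \<tau>}"

definition shape_reg :: "R3 set set \<Rightarrow> real" where
  "shape_reg \<T> = Max ((\<lambda>\<tau>. diameter \<tau> / inscribed_diameter \<tau>) ` \<T>)"

definition es1 :: "R3 set set \<Rightarrow> R3 set \<Rightarrow> R3 set" where
  "es1 \<T> \<tau> = interior (\<Union>{\<tau>' \<in> \<T>. \<tau>' \<inter> \<tau> \<noteq> {}})"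

definition es2 :: "R3 set set \<Rightarrow> R3 set \<Rightarrow> R3 set" where
  "es2 \<T> \<tau> = interior (\<Union>{\<tau>' \<in> \<T>. \<tau>' \<inter> closure (es1 \<T> \<tau>) \<noteq> {}})"

definition boundary_cells :: "R3 set \<Rightarrow> R3 set set \<Rightarrow> nat \<Rightarrow> R3 set set" where
  "boundary_cells \<Omega> \<T> l =
     {\<tau> \<in> \<T>. \<exists>S. S face_of \<tau> \<and> int l simplex S \<and> S \<subseteq> frontier \<Omega>}"

definition boundary_region :: "R3 set \<Rightarrow> R3 set set \<Rightarrow> nat \<Rightarrow> R3 set" where
  "boundary_region \<Omega> \<T> l = interior (\<Union>(boundary_cells \<Omega> \<T> l))"


section \<open>Finite element spaces\<close>

definition poly_le :: "nat \<Rightarrow> scalar_field set" where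
  "poly_le k =
     {q. \<exists>c. q = (\<lambda>x. \<Sum>\<alpha> | (\<Sum>i\<in>UNIV. \<alpha> i) \<le> k. c (\<alpha> :: 3 \<Rightarrow> nat) * (\<Prod>i\<in>UNIV. (x $ i) ^ \<alpha> i))}"

definition poly_vec_le :: "nat \<Rightarrow> vector_field set" where
  "poly_vec_le k = {q. \<forall>i. (\<lambda>x. q x $ i) \<in> poly_le k}"

definition nedelec :: "nat \<Rightarrow> vector_field set" where
  "nedelec p = {\<lambda>x. a x + cross3 x (b x) | a b. a \<in> poly_vec_le p \<and> b \<in> poly_vec_le p}"

definition raviart_thomas :: "nat \<Rightarrow> vector_field set" where
  "raviart_thomas p = {\<lambda>x. a x + b x *\<^sub>R x | a b. a \<in> poly_vec_le p \<and> b \<in> poly_le p}"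

definition piecewise ::
  "R3 set set \<Rightarrow> (R3 \<Rightarrow> 'a) set \<Rightarrow> (R3 \<Rightarrow> 'a) set \<Rightarrow> (R3 \<Rightarrow> 'a) set" where
  "piecewise \<T> Q V = {u \<in> V. \<forall>\<tau>\<in>\<T>. \<exists>q\<in>Q. ae_eq \<tau> u q}"

definition FE0 :: "R3 set \<Rightarrow> R3 set set \<Rightarrow> nat \<Rightarrow> scalar_field set" where
  "FE0 \<Omega> \<T> p = piecewise \<T> (poly_le (p + 1)) (H1 \<Omega>)"

definition FE1 :: "R3 set \<Rightarrow> R3 set set \<Rightarrow> nat \<Rightarrow> vector_field set" where
  "FE1 \<Omega> \<T> p = piecewise \<T> (nedelec p) (Hcurl \<Omega>)"

definition FE2 :: "R3 set \<Rightarrow> R3 set set \<Rightarrow> nat \<Rightarrow> vector_field set" where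
  "FE2 \<Omega> \<T> p = piecewise \<T> (raviart_thomas p) (Hdiv \<Omega>)"


section \<open>Properties of boundary operators\<close>

definition preserves_trace :: "('u \<Rightarrow> 't) \<Rightarrow> 'u set \<Rightarrow> ('u \<Rightarrow> 'u) \<Rightarrow> bool" where
  "preserves_trace tr S P \<longleftrightarrow> (\<forall>u\<in>S. tr (P u) = tr u)"

definition kills_trace :: "('u \<Rightarrow> ('t \<Rightarrow> real)) \<Rightarrow> 'u set \<Rightarrow> ('u \<Rightarrow> 'u) \<Rightarrow> bool" where
  "kills_trace tr S P \<longleftrightarrow> (\<forall>u\<in>S. tr (P u) = (\<lambda>t. 0))"

text \<open>\<open>d\<close> maps level \<open>l\<close> to level \<open>l + 1\<close>; \<open>tr'\<close> and \<open>P'\<close> live on level \<open>l + 1\<close>.\<close>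

definition commutes_on_trace ::
  "('v \<Rightarrow> 't) \<Rightarrow> ('u \<Rightarrow> 'v) \<Rightarrow> 'u set \<Rightarrow> ('u \<Rightarrow> 'u) \<Rightarrow> ('v \<Rightarrow> 'v) \<Rightarrow> bool" where
  "commutes_on_trace tr' d V P P' \<longleftrightarrow> (\<forall>u\<in>V. tr' (P' (d u)) = tr' (d (P u)))"

definition vanishes_inside ::
  "R3 set \<Rightarrow> R3 set set \<Rightarrow> nat \<Rightarrow> (R3 \<Rightarrow> 'a::zero) set \<Rightarrow>
   ((R3 \<Rightarrow> 'a) \<Rightarrow> (R3 \<Rightarrow> 'a)) \<Rightarrow> bool" where
  "vanishes_inside \<Omega> \<T> l V P \<longleftrightarrow>
     (\<forall>u\<in>V. \<forall>\<tau> \<in> \<T> - boundary_cells \<Omega> \<T> l. ae_eq \<tau> (P u) (\<lambda>x. 0))"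

definition locally_bounded ::
  "(R3 set set \<Rightarrow> R3 set \<Rightarrow> R3 set) \<Rightarrow> real \<Rightarrow> R3 set \<Rightarrow> R3 set set \<Rightarrow> nat \<Rightarrow>
   ((R3 \<Rightarrow> 'a::euclidean_space) \<Rightarrow> (R3 \<Rightarrow> 'b::euclidean_space)) \<Rightarrow> (R3 \<Rightarrow> 'a) set \<Rightarrow>
   ((R3 \<Rightarrow> 'a) \<Rightarrow> (R3 \<Rightarrow> 'a)) \<Rightarrow> bool" where
  "locally_bounded es C \<Omega> \<T> l d V P \<longleftrightarrow>
     (\<forall>u\<in>V. \<forall>\<tau> \<in> boundary_cells \<Omega> \<T> l.
        L2_norm \<tau> (P u) \<le>
          C * (L2_norm (es \<T> \<tau> \<inter> boundary_region \<Omega> \<T> l) u +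
               diameter \<tau> * L2_norm (es \<T> \<tau> \<inter> boundary_region \<Omega> \<T> l) (d u)))"

text \<open>\<open>P + Q (I - P)\<close>\<close>

definition combine ::
  "((R3 \<Rightarrow> 'a::real_vector) \<Rightarrow> (R3 \<Rightarrow> 'a)) \<Rightarrow> ((R3 \<Rightarrow> 'a) \<Rightarrow> (R3 \<Rightarrow> 'a)) \<Rightarrow>
   (R3 \<Rightarrow> 'a) \<Rightarrow> (R3 \<Rightarrow> 'a)" where
  "combine P Q u = (\<lambda>x. P u x + Q (\<lambda>y. u y - P u y) x)"

end

theory Submission
  imports Defs
begin

text \<open>The field \<open>P\<^sub>0 d u - d P\<^sub>0 u\<close> has zero trace, hence so has its image under \<open>P\<^sub>+\<close>; this is what
  makes the trace of \<open>\<Pi>\<^sub>\<partial>\<close> commute with \<open>d\<close>, while the preservation of traces and the vanishing on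
  interior cells are linear algebra.  The linearity of weak derivatives up to null sets is the
  fundamental lemma of the calculus of variations, and \<open>d d = 0\<close> is the symmetry of the second
  derivatives of test fields.

  For the local bound, \<open>P\<^sub>+\<close> is applied to \<open>u - P\<^sub>0 u\<close>, so \<open>P\<^sub>0 u\<close> and \<open>d P\<^sub>0 u\<close> have to be estimated
  on the cells touching \<open>\<tau>\<close>.  Members of the lowest-order spaces are affine on each cell, so an
  inverse inequality bounds \<open>d P\<^sub>0 u\<close> by \<open>P\<^sub>0 u\<close> divided by the cell diameter.  It remains to bound the
  number of cells touching \<open>\<tau>\<close> and the ratios of their diameters by the shape regularity \<open>\<rho>\<close>.  A volume
  argument bounds the number of cells at a vertex, and since a Lipschitz domain is locally
  connected these cells are linked through common edges, across which the diameter changes at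
  most by the factor \<open>\<rho>\<close>.\<close>

section \<open>Smooth functions\<close>

text \<open>Write \<open>P\<close> for the lowest-order operator and \<open>Q\<close> for the other
  one. The obstacle is the derivative of \<open>P u\<close>. Commutation identifies d (P u) with P
  (d u) only on the boundary, so the hypothesis on P (d u) says nothing about d (P u) inside a cell.
  The inverse inequality fills this gap. It brings in the reciprocal diameter of a neighbouring
  cell, which has to cancel against the diameter of \<tau>; hence diameters must be compared for all
  touching cells, also for pairs that share just one vertex. Shape regularity alone does not compare
  such a pair: two tetrahedra meeting in a point may have any ratio of sizes. The regularity of the
  domain excludes stars of cells that are pinched at their vertex. The three levels share one
  argument, for a first-order operator given by its symbol, with scalar or vector test fields.
  Operators act on representatives, so their linearity holds almost everywhere, whereas traces are
  functionals and are compared exactly.\<close>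

lemma pd_eqI: "(f has_derivative f') (at x) \<Longrightarrow> pd i f x = f' (axis i 1)"
  unfolding pd_def using frechet_derivative_at by metis

lemma smooth_differentiable: "smooth f \<Longrightarrow> f differentiable (at x)"
  unfolding smooth_def by (metis C_k.simps(2) UNIV_I differentiable_on_def)

lemma smooth_pd: "smooth f \<Longrightarrow> smooth (pd i f)"
  unfolding smooth_def by (metis C_k.simps(2))

lemma smooth_continuous: "smooth f \<Longrightarrow> continuous_on S f"
  unfolding smooth_def by (metis C_k.simps(1) continuous_on_subset subset_UNIV)

text \<open>Reduces smoothness to exhibiting a set of differentiable functions that
  \<open>pd\<close> maps into itself, so that later proofs avoid an induction on the order of
  differentiation.\<close>

lemma smooth_coinduct:
  assumes "f \<in> S" and "\<And>f x. f \<in> S \<Longrightarrow> f differentiable (at x)"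
    and "\<And>f i. f \<in> S \<Longrightarrow> pd i f \<in> S"
  shows "smooth f"
proof -
  have "C_k k g" if "g \<in> S" for k g
    using that
  proof (induction k arbitrary: g)
    case 0
    then show ?case
      using assms(2) by (auto intro!: differentiable_imp_continuous_on simp: differentiable_on_def)
  next
    case (Suc k)
    then show ?case
      using assms(2,3) by (auto simp: differentiable_on_def)
  qed
  then show ?thesis using assms(1) by (simp add: smooth_def)
qed

text \<open>Closure under sums and products makes the set stable under \<open>pd\<close> as soon as
  the partial derivatives of the generators lie in it, which is what \<open>smooth_coinduct\<close>
  asks for.\<close>

inductive_set subalgebra :: "scalar_field set \<Rightarrow> scalar_field set" for F where
  generator: "f \<in> F \<Longrightarrow> f \<in> subalgebra F"
| const: "(\<lambda>x. c) \<in> subalgebra F"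
| add: "f \<in> subalgebra F \<Longrightarrow> g \<in> subalgebra F \<Longrightarrow> (\<lambda>x. f x + g x) \<in> subalgebra F"
| mult: "f \<in> subalgebra F \<Longrightarrow> g \<in> subalgebra F \<Longrightarrow> (\<lambda>x. f x * g x) \<in> subalgebra F"

lemma smooth_subalgebra:
  assumes F: "\<And>f x. f \<in> F \<Longrightarrow> f differentiable (at x)"
    and pdF: "\<And>f i. f \<in> F \<Longrightarrow> pd i f \<in> subalgebra F"
    and "f \<in> subalgebra F"
  shows "smooth f"
proof -
  have dF: "f differentiable (at x)" if "f \<in> subalgebra F" for f x
    using that by induction (use F in auto)
  have "pd i f \<in> subalgebra F" if "f \<in> subalgebra F" for f i
    using that
  proof induction
    case (generator f)
    then show ?case by (rule pdF)
  next
    case (const c)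
    have "pd i (\<lambda>x. c) = (\<lambda>x. 0)" by (auto simp: pd_def)
    then show ?case by (simp add: subalgebra.const)
  next
    case (add f g)
    have "pd i (\<lambda>x. f x + g x) = (\<lambda>x. pd i f x + pd i g x)"
    proof
      fix x
      have "((\<lambda>x. f x + g x) has_derivative
          (\<lambda>h. frechet_derivative f (at x) h + frechet_derivative g (at x) h)) (at x)"
        using dF[OF add.hyps(1), of x] dF[OF add.hyps(2), of x]
        by (intro has_derivative_add) (auto simp: frechet_derivative_works)
      from pd_eqI[OF this] show "pd i (\<lambda>x. f x + g x) x = pd i f x + pd i g x"
        by (simp add: pd_def)
    qed
    then show ?case using add.IH by (simp add: subalgebra.add)
  next
    case (mult f g)
    have "pd i (\<lambda>x. f x * g x) = (\<lambda>x. f x * pd i g x + pd i f x * g x)"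
    proof
      fix x
      have "((\<lambda>x. f x * g x) has_derivative
          (\<lambda>h. f x * frechet_derivative g (at x) h + frechet_derivative f (at x) h * g x)) (at x)"
        using dF[OF mult.hyps(1), of x] dF[OF mult.hyps(2), of x]
        by (intro has_derivative_mult) (auto simp: frechet_derivative_works)
      from pd_eqI[OF this] show "pd i (\<lambda>x. f x * g x) x = f x * pd i g x + pd i f x * g x"
        by (simp add: pd_def)
    qed
    then show ?case using mult by (simp add: subalgebra.add subalgebra.mult)
  qed
  with dF assms(3) show ?thesis by (intro smooth_coinduct[of f "subalgebra F"])
qed

lemma smooth_subalgebra_smooth: "f \<in> subalgebra {f. smooth f} \<Longrightarrow> smooth f"
  by (rule smooth_subalgebra[of "{f. smooth f}"])
    (auto intro: smooth_differentiable smooth_pd subalgebra.generator)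

lemma smooth_const [simp]: "smooth (\<lambda>x. c)"
  by (rule smooth_subalgebra_smooth) (rule subalgebra.const)

lemma smooth_add: "smooth f \<Longrightarrow> smooth g \<Longrightarrow> smooth (\<lambda>x. f x + g x)"
  by (rule smooth_subalgebra_smooth) (auto intro: subalgebra.intros)

lemma smooth_mult: "smooth f \<Longrightarrow> smooth g \<Longrightarrow> smooth (\<lambda>x. f x * g x)"
  by (rule smooth_subalgebra_smooth) (auto intro: subalgebra.intros)

lemma smooth_diff: "smooth f \<Longrightarrow> smooth g \<Longrightarrow> smooth (\<lambda>x. f x - g x)"
  using smooth_add[of f "\<lambda>x. (-1) * g x"] smooth_mult[of "\<lambda>x. -1" g] by simp

lemma smooth_sum: "(\<And>i. i \<in> A \<Longrightarrow> smooth (f i)) \<Longrightarrow> smooth (\<lambda>x. \<Sum>i\<in>A. f i x)"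
  by (induction A rule: infinite_finite_induct) (simp_all add: smooth_add)

lemma smooth_prod: "(\<And>i. i \<in> A \<Longrightarrow> smooth (f i)) \<Longrightarrow> smooth (\<lambda>x. \<Prod>i\<in>A. f i x)"
  by (induction A rule: infinite_finite_induct) (simp_all add: smooth_mult)

text \<open>The classical function exp (- c / t), flat at 0. The powers of t in the denominator make
  the family stable under differentiation up to linear combinations, and c is kept free because
  letting it tend to 0 produces the indicator of the half line.\<close>

definition flat_exp :: "real \<Rightarrow> nat \<Rightarrow> real \<Rightarrow> real" where
  "flat_exp c k t = (if t > 0 then exp (- c / t) / t ^ k else 0)"

text \<open>The term of order k + 2 in the series of exp (c / t) beats the pole of order k with two
  powers of t to spare. This quadratic decay makes the derivative at 0 vanish.\<close>

lemma flat_exp_bound: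
  assumes "c > 0"
  shows "\<bar>flat_exp c k t\<bar> \<le> fact (k + 2) / c ^ (k + 2) * t\<^sup>2"
proof (cases "t > 0")
  case True
  have "(c / t) ^ (k + 2) / fact (k + 2) \<le> exp (c / t)"
  proof -
    have "(\<Sum>n\<in>{k+2}. (c / t) ^ n /\<^sub>R fact n) \<le> (\<Sum>n. (c / t) ^ n /\<^sub>R fact n)"
      using True assms by (intro sum_le_suminf summable_exp_generic) (auto simp: divide_inverse)
    then show ?thesis by (simp add: exp_def field_simps)
  qed
  then have "exp (- c / t) \<le> fact (k + 2) * t ^ (k + 2) / c ^ (k + 2)"
  proof -
    define F :: real where "F = fact (k + 2)"
    have "F > 0" by (simp add: F_def)
    have "c ^ (k + 2) / t ^ (k + 2) / F \<le> exp (c / t)"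
      using \<open>(c / t) ^ (k + 2) / fact (k + 2) \<le> exp (c / t)\<close> by (simp only: F_def power_divide)
    then have "c ^ (k + 2) \<le> exp (c / t) * F * t ^ (k + 2)"
      using True \<open>F > 0\<close> by (simp add: pos_divide_le_eq mult_ac del: power_Suc power_add)
    then show ?thesis
      unfolding F_def[symmetric] using assms
      by (simp add: exp_minus pos_le_divide_eq field_simps del: power_Suc power_add)
  qed
  then have "exp (- c / t) / t ^ k \<le> fact (k + 2) * t ^ (k + 2) / c ^ (k + 2) / t ^ k"
    using True by (intro divide_right_mono) auto
  also have "\<dots> = fact (k + 2) / c ^ (k + 2) * t\<^sup>2"
    using True by (simp add: power_add power2_eq_square)
  finally show ?thesis using True by (simp add: flat_exp_def del: fact_Suc power_Suc)
qed (use assms in \<open>auto simp: flat_exp_def\<close>)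

lemma flat_exp_has_derivative:
  assumes "c > 0"
  shows "(flat_exp c k has_real_derivative
           c * flat_exp c (k + 2) t - k * flat_exp c (k + 1) t) (at t)"
proof -
  consider "t > 0" | "t < 0" | "t = 0" by linarith
  then show ?thesis
  proof cases
    case 1
    have "((\<lambda>t. exp (- c / t) / t ^ k) has_real_derivative
           c * flat_exp c (k + 2) t - k * flat_exp c (k + 1) t) (at t)"
    proof -
      have "((\<lambda>t. exp (- c / t)) has_real_derivative exp (- c / t) * (c / t\<^sup>2)) (at t)"
        using 1 by (auto intro!: derivative_eq_intros simp: power2_eq_square)
      from DERIV_divide[OF this DERIV_pow[of k]] 1
      have "((\<lambda>t. exp (- c / t) / t ^ k) has_real_derivative
        (exp (- c / t) * (c / t\<^sup>2) * t ^ k - exp (- c / t) * (k * t ^ (k - Suc 0))) / (t ^ k * t ^ k)) (at t)"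
        by simp
      also have "(exp (- c / t) * (c / t\<^sup>2) * t ^ k - exp (- c / t) * (k * t ^ (k - Suc 0))) / (t ^ k * t ^ k)
          = c * flat_exp c (k + 2) t - k * flat_exp c (k + 1) t"
        using 1 by (cases k) (simp_all add: flat_exp_def field_simps power2_eq_square)
      finally show ?thesis .
    qed
    moreover have "open {0::real<..}" by simp
    ultimately show ?thesis
      by (rule has_field_derivative_transform_within_open) (use 1 in \<open>auto simp: flat_exp_def\<close>)
  next
    case 2
    have "((\<lambda>t. 0) has_real_derivative 0) (at t)" by simp
    moreover have "open {..<0::real}" by simp
    ultimately have "(flat_exp c k has_real_derivative 0) (at t)"
      by (rule has_field_derivative_transform_within_open) (use 2 in \<open>auto simp: flat_exp_def\<close>)
    with 2 show ?thesis by (simp add: flat_exp_def)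
  next
    case 3
    define M where "M = fact (k + 2) / c ^ (k + 2)"
    have M: "\<bar>flat_exp c k h\<bar> \<le> M * h\<^sup>2" for h
      using flat_exp_bound[OF assms, of k h] by (simp add: M_def)
    have "((\<lambda>h. (flat_exp c k (0 + h) - flat_exp c k 0) / h) \<longlongrightarrow> 0) (at 0)"
    proof (rule Lim_null_comparison)
      show "\<forall>\<^sub>F h in at 0. norm ((flat_exp c k (0 + h) - flat_exp c k 0) / h) \<le> M * \<bar>h\<bar>"
        unfolding eventually_at_topological
      proof (intro exI[of _ UNIV] conjI ballI impI)
        fix h :: real assume "h \<noteq> 0"
        then have "norm ((flat_exp c k (0 + h) - flat_exp c k 0) / h) = \<bar>flat_exp c k h\<bar> / \<bar>h\<bar>"
          by (simp add: flat_exp_def)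
        also have "\<dots> \<le> M * h\<^sup>2 / \<bar>h\<bar>" by (intro divide_right_mono M) auto
        also have "\<dots> = M * \<bar>h\<bar>"
          using \<open>h \<noteq> 0\<close> by (simp add: field_simps power2_eq_square)
        finally show "norm ((flat_exp c k (0 + h) - flat_exp c k 0) / h) \<le> M * \<bar>h\<bar>" .
      qed auto
      show "((\<lambda>h. M * \<bar>h\<bar>) \<longlongrightarrow> 0) (at 0)"
        by (auto intro!: tendsto_eq_intros)
    qed
    then have "(flat_exp c k has_real_derivative 0) (at 0)" by (simp add: DERIV_def)
    then show ?thesis using 3 by (simp add: flat_exp_def)
  qed
qed

lemma smooth_flat_exp:
  assumes "c > 0"
  shows "smooth (\<lambda>x. flat_exp c k (r * x $ i + d))"
proof -
  \<comment> \<open>All exponents k belong to the family, since each derivative raises k by one or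
    two; c stays fixed.\<close>
  define F :: "scalar_field set"
    where "F = {\<lambda>x. flat_exp c k (r * x $ i + d) | k r i d. True}"
  have D: "((\<lambda>x. flat_exp c k (r * x $ i + d)) has_derivative
     (\<lambda>h. (c * flat_exp c (k + 2) (r * x $ i + d) - k * flat_exp c (k + 1) (r * x $ i + d)) * (r * h $ i)))
     (at x)" for k r i d and x :: R3
  proof -
    have "((\<lambda>x. r * x $ i + d) has_derivative (\<lambda>h. r * h $ i)) (at x)"
      by (auto intro!: derivative_eq_intros bounded_linear_imp_has_derivative bounded_linear_vec_nth)
    from has_derivative_compose[OF this
        flat_exp_has_derivative[OF assms, unfolded has_field_derivative_def]]
    show ?thesis by simp
  qed
  show ?thesis
  proof (rule smooth_subalgebra[of F])
    show "f differentiable (at x)" if "f \<in> F" for f x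
      using that D unfolding F_def differentiable_def by blast
    show "pd j f \<in> subalgebra F" if fF: "f \<in> F" for f j
    proof -
      obtain k r i d where f: "f = (\<lambda>x. flat_exp c k (r * x $ i + d))"
        using fF unfolding F_def by blast
      have g: "(\<lambda>x. flat_exp c m (r * x $ i + d)) \<in> subalgebra F" for m
        by (rule subalgebra.generator) (auto simp: F_def)
      have "pd j f = (\<lambda>x. (r * axis j 1 $ i) *
          (c * flat_exp c (k + 2) (r * x $ i + d) + (- k) * flat_exp c (k + 1) (r * x $ i + d)))"
        unfolding f by (rule ext, subst pd_eqI[OF D]) (simp add: algebra_simps)
      then show ?thesis
        by (simp only:) (intro subalgebra.mult subalgebra.add subalgebra.const g)
    qed
  qed (auto simp: F_def intro!: subalgebra.generator)
qed

text \<open>Each factor is positive on one of the six open half spaces bounding the box and 0 off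
  it, and tends to 1 on it as 1 / Suc n tends to 0. This yields test functions bounded by 1 that
  converge to the indicator of the box.\<close>

definition box_bump :: "R3 \<Rightarrow> R3 \<Rightarrow> nat \<Rightarrow> scalar_field" where
  "box_bump a b n x =
     (\<Prod>i\<in>UNIV. flat_exp (1 / Suc n) 0 (x $ i - a $ i) * flat_exp (1 / Suc n) 0 (b $ i - x $ i))"

lemma smooth_box_bump: "smooth (box_bump a b n)"
  unfolding box_bump_def
  using smooth_flat_exp[of "1 / Suc n" 0 1 _ "- a $ _"] smooth_flat_exp[of "1 / Suc n" 0 "-1" _ "b $ _"]
  by (intro smooth_prod smooth_mult) simp_all

lemma box_bump_outside: "x \<notin> box a b \<Longrightarrow> box_bump a b n x = 0"
  by (auto simp: box_bump_def flat_exp_def mem_box_cart)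

lemma box_bump_bounds: "\<bar>box_bump a b n x\<bar> \<le> 1"
proof -
  have "\<bar>flat_exp (1 / Suc n) 0 t\<bar> \<le> 1" for t
    by (auto simp: flat_exp_def)
  then show ?thesis
    unfolding box_bump_def abs_prod by (intro prod_le_1) (auto simp: abs_mult mult_le_one)
qed

lemma box_bump_tendsto: "(\<lambda>n. box_bump a b n x) \<longlonglongrightarrow> indicator (box a b) x"
proof (cases "x \<in> box a b")
  case True
  have e: "(\<lambda>n. flat_exp (1 / Suc n) 0 t) \<longlonglongrightarrow> 1" if "t > 0" for t
  proof -
    have "(\<lambda>n. exp (- (1 / Suc n) / t)) \<longlonglongrightarrow> exp (- 0 / t)"
      using that by (intro tendsto_intros LIMSEQ_Suc[OF lim_1_over_n]) auto
    with that show ?thesis by (simp add: flat_exp_def)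
  qed
  have "(\<lambda>n. box_bump a b n x) \<longlonglongrightarrow> (\<Prod>i\<in>(UNIV::3 set). 1 * 1)"
    unfolding box_bump_def
    by (intro tendsto_prod tendsto_mult e) (use True in \<open>auto simp: mem_box_cart\<close>)
  with True show ?thesis by simp
qed (simp add: box_bump_outside)

lemma box_bump_supported:
  assumes "cbox a b \<subseteq> \<Omega>"
  shows "supported_in \<Omega> (box_bump a b n)"
proof -
  have "closure {x. box_bump a b n x \<noteq> 0} \<subseteq> cbox a b"
    using box_bump_outside[of _ a b n] box_subset_cbox[of a b]
    by (intro closure_minimal closed_cbox) auto
  moreover from this have "compact (closure {x. box_bump a b n x \<noteq> 0})"
    by (meson bounded_cbox bounded_subset closed_closure compact_eq_bounded_closed)
  ultimately show ?thesis using assms unfolding supported_in_def by blast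
qed

section \<open>Symmetry of second partial derivatives\<close>

lemma smooth_pd_mean_value:
  assumes "smooth f" "h > 0"
  obtains \<theta> where "0 < \<theta>" "\<theta> < h" "f (x + h *\<^sub>R axis i 1) - f x = h * pd i f (x + \<theta> *\<^sub>R axis i 1)"
proof -
  have D: "((\<lambda>t. f (x + t *\<^sub>R axis i 1)) has_real_derivative pd i f (x + t *\<^sub>R axis i 1)) (at t)" for t
  proof -
    let ?y = "x + t *\<^sub>R axis i 1"
    have f: "(f has_derivative frechet_derivative f (at ?y)) (at ?y)"
      using smooth_differentiable[OF assms(1)] by (simp add: frechet_derivative_works)
    have "((\<lambda>t. x + t *\<^sub>R axis i 1) has_derivative (\<lambda>s. s *\<^sub>R axis i 1)) (at t)"
      by (auto intro!: derivative_eq_intros)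
    from has_derivative_compose[OF this f]
    have "((\<lambda>t. f (x + t *\<^sub>R axis i 1)) has_derivative
        (\<lambda>s. frechet_derivative f (at ?y) (s *\<^sub>R axis i 1))) (at t)" by simp
    moreover have "(\<lambda>s. frechet_derivative f (at ?y) (s *\<^sub>R axis i 1)) = (\<lambda>s. pd i f ?y * s)"
      using has_derivative_linear[OF f] by (auto simp: pd_def linear_scale)
    ultimately show ?thesis by (simp add: has_field_derivative_def)
  qed
  from MVT2[OF assms(2) D] obtain \<theta> where "0 < \<theta>" "\<theta> < h"
    "f (x + h *\<^sub>R axis i 1) - f (x + 0 *\<^sub>R axis i 1) = (h - 0) * pd i f (x + \<theta> *\<^sub>R axis i 1)"
    by metis
  with that show thesis by simp
qed

lemma pd_diff:
  assumes "f differentiable (at x)" "g differentiable (at x)"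
  shows "pd i (\<lambda>x. f x - g x) x = pd i f x - pd i g x"
  using pd_eqI[OF has_derivative_diff[OF assms[unfolded frechet_derivative_works]]]
  by (simp add: pd_def)

lemma smooth_translate: "smooth f \<Longrightarrow> smooth (\<lambda>x. f (x + a))"
  and pd_translate: "smooth f \<Longrightarrow> pd i (\<lambda>x. f (x + a)) = (\<lambda>x. pd i f (x + a))"
proof -
  have D: "((\<lambda>x. f (x + a)) has_derivative frechet_derivative f (at (x + a))) (at x)"
    if "smooth f" for f x
  proof -
    have "((\<lambda>x. x + a) has_derivative (\<lambda>h. h)) (at x)"
      by (auto intro!: derivative_eq_intros)
    from has_derivative_compose[OF this] show ?thesis
      using smooth_differentiable[OF that, of "x + a"] by (simp add: frechet_derivative_works)
  qed
  then have pd: "pd i (\<lambda>x. f (x + a)) = (\<lambda>x. pd i f (x + a))" if "smooth f" for f i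
    using pd_eqI[OF D[OF that]] by (auto simp: pd_def[of i f])
  then show "smooth f \<Longrightarrow> pd i (\<lambda>x. f (x + a)) = (\<lambda>x. pd i f (x + a))" .
  show "smooth (\<lambda>x. f (x + a))" if "smooth f"
  proof (rule smooth_coinduct)
    show "(\<lambda>x. f (x + a)) \<in> {\<lambda>x. g (x + a) | g. smooth g}" using that by blast
    show "g differentiable (at x)" if "g \<in> {\<lambda>x. g (x + a) | g. smooth g}" for g x
      using that D unfolding differentiable_def by blast
    show "pd i g \<in> {\<lambda>x. g (x + a) | g. smooth g}" if "g \<in> {\<lambda>x. g (x + a) | g. smooth g}" for g i
      using that pd smooth_pd by force
  qed
qed

text \<open>The mean value theorem is applied in direction i to an increment in direction j, and
  then in direction j. The left side is symmetric in i and j while the right side is not;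
  \<open>pd_commute\<close> lives on this asymmetry.\<close>

lemma smooth_second_difference:
  assumes f: "smooth f" and h: "h > 0"
  obtains \<theta> \<eta> where "0 < \<theta>" "\<theta> < h" "0 < \<eta>" "\<eta> < h"
    "f (x + h *\<^sub>R axis i 1 + h *\<^sub>R axis j 1) - f (x + h *\<^sub>R axis i 1) - f (x + h *\<^sub>R axis j 1) + f x
      = h\<^sup>2 * pd j (pd i f) (x + \<theta> *\<^sub>R axis i 1 + \<eta> *\<^sub>R axis j 1)"
proof -
  let ?g = "\<lambda>y. f (y + h *\<^sub>R axis j 1) - f y"
  have g: "smooth ?g" by (intro smooth_diff smooth_translate f)
  have pdg: "pd i ?g y = pd i f (y + h *\<^sub>R axis j 1) - pd i f y" for y
    using pd_diff[of "\<lambda>y. f (y + h *\<^sub>R axis j 1)" y f i] pd_translate[OF f, of i "h *\<^sub>R axis j 1"]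
      smooth_differentiable[OF f] smooth_differentiable[OF smooth_translate[OF f]]
    by simp
  obtain \<theta> where \<theta>: "0 < \<theta>" "\<theta> < h"
    "?g (x + h *\<^sub>R axis i 1) - ?g x = h * pd i ?g (x + \<theta> *\<^sub>R axis i 1)"
    using smooth_pd_mean_value[OF g h] by blast
  obtain \<eta> where \<eta>: "0 < \<eta>" "\<eta> < h"
    "pd i f (x + \<theta> *\<^sub>R axis i 1 + h *\<^sub>R axis j 1) - pd i f (x + \<theta> *\<^sub>R axis i 1) =
       h * pd j (pd i f) (x + \<theta> *\<^sub>R axis i 1 + \<eta> *\<^sub>R axis j 1)"
    using smooth_pd_mean_value[OF smooth_pd[OF f] h] by blast
  show thesis
    by (rule that[OF \<theta>(1,2) \<eta>(1,2)]) (use \<theta>(3) \<eta>(3) pdg in \<open>simp add: power2_eq_square\<close>)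
qed

text \<open>Both mixed derivatives, taken at points tending to x, equal the same second difference
  divided by the square of the step; continuity gives the limit.\<close>

lemma pd_commute:
  assumes f: "smooth f"
  shows "pd i (pd j f) x = pd j (pd i f) x"
proof -
  define h :: "nat \<Rightarrow> real" where "h = (\<lambda>n. 1 / Suc n)"
  have h: "h n > 0" for n by (simp add: h_def)
  have h0: "h \<longlonglongrightarrow> 0" unfolding h_def by (rule LIMSEQ_Suc[OF lim_1_over_n])
  have lim: "\<exists>y :: nat \<Rightarrow> R3. y \<longlonglongrightarrow> x \<and> (\<forall>n. f (x + h n *\<^sub>R axis i 1 + h n *\<^sub>R axis j 1)
      - f (x + h n *\<^sub>R axis i 1) - f (x + h n *\<^sub>R axis j 1) + f x = (h n)\<^sup>2 * pd j (pd i f) (y n))"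
    for i j
  proof -
    have "\<exists>\<theta> \<eta>. 0 < \<theta> \<and> \<theta> < h n \<and> 0 < \<eta> \<and> \<eta> < h n \<and>
      f (x + h n *\<^sub>R axis i 1 + h n *\<^sub>R axis j 1) - f (x + h n *\<^sub>R axis i 1) - f (x + h n *\<^sub>R axis j 1) + f x
      = (h n)\<^sup>2 * pd j (pd i f) (x + \<theta> *\<^sub>R axis i 1 + \<eta> *\<^sub>R axis j 1)" for n
      by (rule smooth_second_difference[where x=x and i=i and j=j, OF f h[of n]]) blast
    then obtain \<theta> \<eta> where *: "\<And>n. 0 < \<theta> n \<and> \<theta> n < h n \<and> 0 < \<eta> n \<and> \<eta> n < h n \<and>
      f (x + h n *\<^sub>R axis i 1 + h n *\<^sub>R axis j 1) - f (x + h n *\<^sub>R axis i 1) - f (x + h n *\<^sub>R axis j 1) + f x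
      = (h n)\<^sup>2 * pd j (pd i f) (x + \<theta> n *\<^sub>R axis i 1 + \<eta> n *\<^sub>R axis j 1)"
      by metis
    have "r \<longlonglongrightarrow> 0" if "\<And>n. 0 < r n \<and> r n < h n" for r
      by (rule tendsto_sandwich[OF _ _ tendsto_const h0]) (simp_all add: that less_imp_le)
    with * have "\<theta> \<longlonglongrightarrow> 0" "\<eta> \<longlonglongrightarrow> 0" by auto
    then have "(\<lambda>n. x + \<theta> n *\<^sub>R axis i 1 + \<eta> n *\<^sub>R axis j 1) \<longlonglongrightarrow> x + 0 *\<^sub>R axis i 1 + 0 *\<^sub>R axis j 1"
      by (intro tendsto_intros)
    with * show ?thesis by (intro exI[of _ "\<lambda>n. x + \<theta> n *\<^sub>R axis i 1 + \<eta> n *\<^sub>R axis j 1"]) simp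
  qed
  obtain y where y: "y \<longlonglongrightarrow> x" and yf: "\<And>n. f (x + h n *\<^sub>R axis i 1 + h n *\<^sub>R axis j 1)
      - f (x + h n *\<^sub>R axis i 1) - f (x + h n *\<^sub>R axis j 1) + f x = (h n)\<^sup>2 * pd j (pd i f) (y n)"
    using lim[of i j] by blast
  obtain z where z: "z \<longlonglongrightarrow> x" and zf: "\<And>n. f (x + h n *\<^sub>R axis j 1 + h n *\<^sub>R axis i 1)
      - f (x + h n *\<^sub>R axis j 1) - f (x + h n *\<^sub>R axis i 1) + f x = (h n)\<^sup>2 * pd i (pd j f) (z n)"
    using lim[of j i] by blast
  have "(h n)\<^sup>2 * pd j (pd i f) (y n) = (h n)\<^sup>2 * pd i (pd j f) (z n)" for n
    unfolding yf[of n, symmetric] zf[of n, symmetric] by (simp add: algebra_simps)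
  then have eq: "pd j (pd i f) (y n) = pd i (pd j f) (z n)" for n
    using h[of n] by (metis less_irrefl mult_cancel_left power_eq_0_iff zero_neq_numeral)
  have c: "continuous (at x) (pd k (pd l f))" for k l
    using smooth_continuous[OF smooth_pd[OF smooth_pd[OF f]], of UNIV]
    by (simp add: continuous_on_eq_continuous_at)
  have "(\<lambda>n. pd j (pd i f) (y n)) \<longlonglongrightarrow> pd j (pd i f) x"
    "(\<lambda>n. pd i (pd j f) (z n)) \<longlonglongrightarrow> pd i (pd j f) x"
    using y z c by (auto intro: isCont_tendsto_compose)
  then show ?thesis unfolding eq using LIMSEQ_unique by blast
qed

section \<open>The fundamental lemma of the calculus of variations\<close>

lemma integrable_lebesgue_on_subset:
  fixes f :: "'a::euclidean_space \<Rightarrow> 'b::euclidean_space"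
  assumes "integrable (lebesgue_on T) f" "S \<subseteq> T" "S \<in> sets lebesgue" "T \<in> sets lebesgue"
  shows "integrable (lebesgue_on S) f"
proof -
  have "integrable lebesgue (\<lambda>x. indicator S x *\<^sub>R (if x \<in> T then f x else 0))"
    using assms Lebesgue_Measure.integrable_restrict_UNIV[of T f] by (intro integrable_mult_indicator) auto
  also have "(\<lambda>x. indicator S x *\<^sub>R (if x \<in> T then f x else 0)) = (\<lambda>x. if x \<in> S then f x else 0)"
    using assms(2) by (auto simp: indicator_def fun_eq_iff)
  finally show ?thesis using assms(3) by (simp add: Lebesgue_Measure.integrable_restrict_UNIV)
qed

lemma AE_lebesgue_on_iff_negligible:
  assumes "S \<in> sets lebesgue"
  shows "(AE x in lebesgue_on S. P x) \<longleftrightarrow> negligible {x \<in> S. \<not> P x}"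
proof -
  have "(AE x in lebesgue_on S. P x) \<longleftrightarrow> (AE x in lebesgue. x \<in> S \<longrightarrow> P x)"
    using assms by (simp add: AE_restrict_space_iff)
  also have "\<dots> \<longleftrightarrow> (\<exists>N. negligible N \<and> {x \<in> S. \<not> P x} \<subseteq> N)"
    by (auto simp: eventually_ae_filter negligible_iff_null_sets)
  finally show ?thesis using negligible_subset by blast
qed

text \<open>Lebesgue differentiation recovers f at almost every point from its averages over small
  boxes. Countably many closed boxes exhaust the open set, so one closed box at a time
  suffices.\<close>

lemma AE_lebesgue_on_zero_if_box_integrals_zero:
  fixes f :: "'a::euclidean_space \<Rightarrow> 'b::euclidean_space"
  assumes S: "open S" and f: "integrable (lebesgue_on S) f"
    and zero: "\<And>a b. cbox a b \<subseteq> S \<Longrightarrow> integral\<^sup>L (lebesgue_on (cbox a b)) f = 0"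
  shows "AE x in lebesgue_on S. f x = 0"
proof -
  have S': "S \<in> sets lebesgue" using S by auto
  have *: "negligible {x \<in> cbox a b. f x \<noteq> 0}" if ab: "cbox a b \<subseteq> S" for a b
  proof -
    \<comment> \<open>Extension by zero: every box meets \<open>cbox a b\<close> in a box inside S,
      so all box integrals of \<open>F\<close> vanish, also across the boundary of
      \<open>cbox a b\<close>.\<close>
    define F where "F x = (if x \<in> cbox a b then f x else 0)" for x
    have "integrable lebesgue F"
      unfolding F_def using integrable_lebesgue_on_subset[OF f ab _ S']
      by (simp add: Lebesgue_Measure.integrable_restrict_UNIV)
    then have F: "integrable (lebesgue_on A) F" if "A \<in> sets lebesgue" for A
      using integrable_lebesgue_on_subset[of UNIV F A] that by (simp add: lebesgue_on_UNIV_eq)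
    have F': "F integrable_on cbox c d" for c d
      by (rule integrable_on_lebesgue_on[OF F]) auto
    have int0: "integral (cbox c d) F = 0" for c d
    proof -
      obtain p q where pq: "cbox a b \<inter> cbox c d = cbox p q" using Int_interval[of a b c d] by blast
      have "integral (cbox c d) F = integral\<^sup>L (lebesgue_on (cbox c d)) F"
        by (rule lebesgue_integral_eq_integral[symmetric, OF F]) auto
      also have "\<dots> = integral\<^sup>L (lebesgue_on (cbox a b \<inter> cbox c d)) f"
        unfolding F_def by (rule Lebesgue_Measure.integral_restrict_Int) auto
      also have "\<dots> = 0" unfolding pq using ab pq by (intro zero) blast
      finally show ?thesis .
    qed
    obtain N where N: "negligible N" and lim: "\<And>x e. \<lbrakk>x \<notin> N; 0 < e\<rbrakk> \<Longrightarrow>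
      \<exists>d>0. \<forall>h. 0 < h \<and> h < d \<longrightarrow> norm (integral (cbox x (x + h *\<^sub>R One)) F /\<^sub>R h ^ DIM('a) - F x) < e"
      using integrable_ccontinuous_explicit[OF F'] by blast
    have "norm (F x) < e" if "x \<notin> N" "0 < e" for x e
    proof -
      obtain d where "d > 0" and d: "\<forall>h. 0 < h \<and> h < d \<longrightarrow>
          norm (integral (cbox x (x + h *\<^sub>R One)) F /\<^sub>R h ^ DIM('a) - F x) < e"
        using lim[OF \<open>x \<notin> N\<close> \<open>0 < e\<close>] by blast
      then have "norm (integral (cbox x (x + (d / 2) *\<^sub>R One)) F /\<^sub>R (d / 2) ^ DIM('a) - F x) < e"
        by simp
      then show ?thesis by (simp add: int0)
    qed
    then have "F x = 0" if "x \<notin> N" for x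
      using that by (metis less_irrefl zero_less_norm_iff)
    then have "{x \<in> cbox a b. f x \<noteq> 0} \<subseteq> N" by (force simp: F_def)
    with N show ?thesis by (rule negligible_subset)
  qed
  obtain \<D> where \<D>: "countable \<D>" "\<And>X. X \<in> \<D> \<Longrightarrow> \<exists>a b. X = cbox a b" "\<Union>\<D> = S"
    using open_countable_Union_open_cbox[OF S] by metis
  have "negligible (\<Union>((\<lambda>X. {x \<in> X. f x \<noteq> 0}) ` \<D>))"
  proof (rule negligible_countable_Union)
    show "countable ((\<lambda>X. {x \<in> X. f x \<noteq> 0}) ` \<D>)" using \<D>(1) by simp
    show "negligible t" if t: "t \<in> (\<lambda>X. {x \<in> X. f x \<noteq> 0}) ` \<D>" for t
    proof -
      obtain X where X: "X \<in> \<D>" "t = {x \<in> X. f x \<noteq> 0}" using t by blast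
      obtain a b where "X = cbox a b" using \<D>(2)[OF X(1)] by blast
      moreover have "X \<subseteq> S" using X(1) \<D>(3) by blast
      ultimately show ?thesis using *[of a b] X(2) by simp
    qed
  qed
  also have "\<Union>((\<lambda>X. {x \<in> X. f x \<noteq> 0}) ` \<D>) = {x \<in> S. f x \<noteq> 0}"
    using \<D>(3) by blast
  finally show ?thesis by (simp add: AE_lebesgue_on_iff_negligible[OF S'])
qed

text \<open>Testing with \<open>box_bump\<close> and dominated convergence give the integral over an
  open box; the boundary of the box is a null set.\<close>

lemma du_Bois_Reymond_scalar:
  assumes S: "open S" and f: "integrable (lebesgue_on S) f"
    and zero: "\<And>\<phi>. smooth \<phi> \<Longrightarrow> supported_in S \<phi> \<Longrightarrow> integral\<^sup>L (lebesgue_on S) (\<lambda>x. f x * \<phi> x) = 0"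
  shows "AE x in lebesgue_on S. f x = 0"
proof (rule AE_lebesgue_on_zero_if_box_integrals_zero[OF S f])
  fix a b assume ab: "cbox a b \<subseteq> S"
  have [measurable]: "f \<in> borel_measurable (lebesgue_on S)" using f by auto
  have cont: "continuous_on UNIV (box_bump a b n)" for n
    by (rule smooth_continuous[OF smooth_box_bump])
  have [measurable]: "box_bump a b n \<in> borel_measurable (lebesgue_on S)" for n
    using borel_measurable_continuous_onI[OF cont]
    by (intro measurable_restrict_space1 measurable_completion) simp
  have "(\<lambda>n. integral\<^sup>L (lebesgue_on S) (\<lambda>x. f x * box_bump a b n x))
      \<longlonglongrightarrow> integral\<^sup>L (lebesgue_on S) (\<lambda>x. f x * indicator (box a b) x)"
  proof (rule integral_dominated_convergence[where w = "\<lambda>x. norm (f x)"])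
    show "(\<lambda>x. f x * indicator (box a b) x) \<in> borel_measurable (lebesgue_on S)"
      using S ab box_subset_cbox[of a b]
      by (intro borel_measurable_times borel_measurable_indicator)
        (auto simp: sets_restrict_space intro!: image_eqI[of _ _ "box a b"])
    show "AE x in lebesgue_on S. (\<lambda>n. f x * box_bump a b n x) \<longlonglongrightarrow> f x * indicator (box a b) x"
      by (intro AE_I2 tendsto_intros box_bump_tendsto)
    show "AE x in lebesgue_on S. norm (f x * box_bump a b n x) \<le> norm (f x)" for n
      using box_bump_bounds by (intro AE_I2) (auto simp: abs_mult mult_left_le)
  qed (use f in auto)
  moreover have "integral\<^sup>L (lebesgue_on S) (\<lambda>x. f x * box_bump a b n x) = 0" for n
    by (rule zero[OF smooth_box_bump box_bump_supported[OF ab]])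
  ultimately have "integral\<^sup>L (lebesgue_on S) (\<lambda>x. f x * indicator (box a b) x) = 0"
    by (simp add: LIMSEQ_const_iff)
  moreover have "(\<lambda>x. f x * indicator (box a b) x) = (\<lambda>x. if x \<in> box a b then f x else 0)"
    by (auto simp: indicator_def)
  ultimately have "integral\<^sup>L (lebesgue_on (box a b)) f = 0"
    using Lebesgue_Measure.integral_restrict[of "box a b" S f] S ab box_subset_cbox[of a b] by auto
  moreover have "integral\<^sup>L (lebesgue_on (cbox a b)) f = integral\<^sup>L (lebesgue_on (box a b)) f"
  proof -
    have i: "integrable (lebesgue_on (cbox a b)) f" "integrable (lebesgue_on (box a b)) f"
      using ab box_subset_cbox[of a b] S by (auto intro!: integrable_lebesgue_on_subset[OF f])
    show ?thesis
      using i by (simp add: lebesgue_integral_eq_integral integral_open_interval)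
  qed
  ultimately show "integral\<^sup>L (lebesgue_on (cbox a b)) f = 0" by simp
qed

text \<open>Common form of \<open>smooth\<close> and \<open>smooth_vec\<close>, so that scalar and
  vector test fields are handled by the same lemmas.\<close>

definition smooth_field :: "(R3 \<Rightarrow> 'b::euclidean_space) \<Rightarrow> bool" where
  "smooth_field \<psi> \<longleftrightarrow> (\<forall>b\<in>Basis. smooth (\<lambda>x. \<psi> x \<bullet> b))"

lemma du_Bois_Reymond:
  fixes g :: "R3 \<Rightarrow> 'b::euclidean_space"
  assumes S: "open S" and g: "integrable (lebesgue_on S) g"
    and zero: "\<And>\<psi> :: R3 \<Rightarrow> 'b. smooth_field \<psi> \<Longrightarrow> supported_in S \<psi> \<Longrightarrow>
                  integral\<^sup>L (lebesgue_on S) (\<lambda>x. g x \<bullet> \<psi> x) = 0"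
  shows "ae_eq S g (\<lambda>x. 0)"
proof -
  have "AE x in lebesgue_on S. g x \<bullet> b = 0" if b: "b \<in> Basis" for b
  proof (rule du_Bois_Reymond_scalar[OF S])
    show "integrable (lebesgue_on S) (\<lambda>x. g x \<bullet> b)" using g by simp
    fix \<phi> :: scalar_field assume \<phi>: "smooth \<phi>" "supported_in S \<phi>"
    have "smooth_field (\<lambda>x. \<phi> x *\<^sub>R b)"
      using \<phi>(1) by (auto simp: smooth_field_def intro!: smooth_mult)
    moreover have "supported_in S (\<lambda>x. \<phi> x *\<^sub>R b)"
      using \<phi>(2) nonzero_Basis[OF b] by (simp add: supported_in_def)
    ultimately have "integral\<^sup>L (lebesgue_on S) (\<lambda>x. g x \<bullet> (\<phi> x *\<^sub>R b)) = 0" by (rule zero)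
    then show "integral\<^sup>L (lebesgue_on S) (\<lambda>x. g x \<bullet> b * \<phi> x) = 0" by (simp add: mult.commute)
  qed
  then have "AE x in lebesgue_on S. \<forall>b\<in>Basis. g x \<bullet> b = 0"
    by (simp add: AE_ball_countable countable_finite)
  then show ?thesis unfolding ae_eq_def
  proof eventually_elim
    case (elim x)
    then show ?case using euclidean_eqI[of "g x" 0] by simp
  qed
qed

text \<open>By translation invariance the difference quotients of F along e have integral zero, and
  dominated convergence passes to the derivative. This does the work of Fubini and is the source of
  integration by parts in \<open>wd_affine\<close>.\<close>

lemma integral_directional_derivative_zero:
  fixes F :: "R3 \<Rightarrow> real"
  assumes D: "\<And>x. (F has_derivative F' x) (at x)"
    and cont: "continuous_on UNIV (\<lambda>x. F' x e)"
    and K: "compact K" "\<And>x. x \<notin> K \<Longrightarrow> F x = 0"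
  shows "integral\<^sup>L lebesgue (\<lambda>x. F' x e) = 0"
proof -
  have contF: "continuous_on UNIV F"
    using D by (meson continuous_at_imp_continuous_on has_derivative_continuous)
  have F'0: "F' x e = 0" if "x \<notin> K" for x
  proof -
    have "open (- K)" using K(1) by (simp add: compact_imp_closed open_Compl)
    then have "((\<lambda>x. 0) has_derivative F' x) (at x)"
      using has_derivative_transform_within_open[OF D, of "- K" x "\<lambda>x. 0"] that K(2) by auto
    then show ?thesis using has_derivative_unique has_derivative_const by metis
  qed
  obtain B where B0: "B \<ge> 0" and BK: "\<And>x. x \<in> K \<Longrightarrow> \<bar>F' x e\<bar> \<le> B"
  proof -
    have "bounded ((\<lambda>x. F' x e) ` K)"
      using K(1) cont by (intro compact_imp_bounded compact_continuous_image) (auto intro: continuous_on_subset)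
    then obtain B where "\<forall>x\<in>K. \<bar>F' x e\<bar> \<le> B" by (auto simp: bounded_iff)
    then show thesis by (intro that[of "max B 0"]) auto
  qed
  have B: "\<bar>F' x e\<bar> \<le> B" for x using BK[of x] F'0[of x] B0 by (cases "x \<in> K") auto
  have line: "((\<lambda>s. F (x + s *\<^sub>R e)) has_real_derivative F' (x + s *\<^sub>R e) e) (at s)" for x s
  proof -
    have "((\<lambda>s. x + s *\<^sub>R e) has_derivative (\<lambda>s. s *\<^sub>R e)) (at s)"
      by (auto intro!: derivative_eq_intros)
    from has_derivative_compose[OF this D]
    have "((\<lambda>s. F (x + s *\<^sub>R e)) has_derivative (\<lambda>t. F' (x + s *\<^sub>R e) (t *\<^sub>R e))) (at s)" .
    moreover have "(\<lambda>t. F' (x + s *\<^sub>R e) (t *\<^sub>R e)) = (\<lambda>t. F' (x + s *\<^sub>R e) e * t)"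
      using has_derivative_linear[OF D] by (auto simp: linear_scale)
    ultimately show ?thesis by (simp add: has_field_derivative_def)
  qed
  have mv: "\<bar>F (x + h *\<^sub>R e) - F x\<bar> \<le> B * h" if h: "h > 0" for x h
  proof -
    obtain \<theta> where "F (x + h *\<^sub>R e) - F (x + 0 *\<^sub>R e) = (h - 0) * F' (x + \<theta> *\<^sub>R e) e"
      using MVT2[OF h, of "\<lambda>s. F (x + s *\<^sub>R e)" "\<lambda>s. F' (x + s *\<^sub>R e) e"] line by metis
    with B[of "x + \<theta> *\<^sub>R e"] h show ?thesis by (simp add: abs_mult mult.commute mult_left_mono)
  qed
  define h :: "nat \<Rightarrow> real" where "h = (\<lambda>n. 1 / Suc n)"
  have h: "0 < h n" "h n \<le> 1" for n by (auto simp: h_def)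
  have h0: "h \<longlonglongrightarrow> 0" unfolding h_def by (rule LIMSEQ_Suc[OF lim_1_over_n])
  obtain R where R: "\<And>x. x \<in> K \<Longrightarrow> norm x \<le> R"
    using compact_imp_bounded[OF K(1)] by (auto simp: bounded_iff)
  \<comment> \<open>Translations by at most the norm of e, as h n \<le> 1, keep the difference
    quotients supported in this fixed box, which provides the dominating function.\<close>
  obtain c d where cd: "cball (0 :: R3) (R + norm e) \<subseteq> cbox c d"
    using bounded_subset_cbox_symmetric[OF bounded_cball] by metis
  define G where "G n x = (F (x + h n *\<^sub>R e) - F x) / h n" for n x
  have [measurable]: "F \<in> borel_measurable borel" using contF by (rule borel_measurable_continuous_onI)
  have [measurable]: "(\<lambda>x. F' x e) \<in> borel_measurable borel" using cont by (rule borel_measurable_continuous_onI)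
  have intF: "integrable lborel F"
  proof -
    have "integrable lborel (\<lambda>x. indicator K x *\<^sub>R F x)"
      using K(1) contF by (intro borel_integrable_compact) (auto intro: continuous_on_subset)
    moreover have "(\<lambda>x. indicator K x *\<^sub>R F x) = F" using K(2) by (force simp: indicator_def fun_eq_iff)
    ultimately show ?thesis by simp
  qed
  have shift: "integrable lborel (\<lambda>x. F (x + a))" "integral\<^sup>L lborel (\<lambda>x. F (x + a)) = integral\<^sup>L lborel F" for a
  proof -
    have "integrable (distr lborel borel ((+) a)) F" "integral\<^sup>L (distr lborel borel ((+) a)) F = integral\<^sup>L lborel F"
      using intF by (simp_all add: lborel_distr_plus)
    then show "integrable lborel (\<lambda>x. F (x + a))" "integral\<^sup>L lborel (\<lambda>x. F (x + a)) = integral\<^sup>L lborel F"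
      by (simp_all add: integrable_distr_eq integral_distr add.commute)
  qed
  have G0: "integral\<^sup>L lborel (G n) = 0" for n
    unfolding G_def using shift intF by simp
  have "(\<lambda>n. integral\<^sup>L lborel (G n)) \<longlonglongrightarrow> integral\<^sup>L lborel (\<lambda>x. F' x e)"
  proof (rule integral_dominated_convergence[where w = "\<lambda>x. indicator (cbox c d) x * B"])
    show "integrable lborel (\<lambda>x. indicator (cbox c d) x * B)"
      by (intro integrable_mult_left integrable_real_indicator) (auto simp: emeasure_lborel_cbox_finite less_top[symmetric] emeasure_lborel_cbox_eq)
    show "AE x in lborel. (\<lambda>n. G n x) \<longlonglongrightarrow> F' x e"
    proof (rule AE_I2)
      fix x
      have "((\<lambda>s. (F (x + s *\<^sub>R e) - F x) / s) \<longlongrightarrow> F' x e) (at 0)"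
        using line[of x 0] by (simp add: DERIV_def)
      moreover have "filterlim h (at 0) sequentially"
        using h0 h(1) by (auto simp: filterlim_at less_imp_neq[symmetric])
      ultimately show "(\<lambda>n. G n x) \<longlonglongrightarrow> F' x e"
        unfolding G_def by (rule filterlim_compose)
    qed
    show "AE x in lborel. norm (G n x) \<le> indicator (cbox c d) x * B" for n
    proof (rule AE_I2)
      fix x
      show "norm (G n x) \<le> indicator (cbox c d) x * B"
      proof (cases "x \<in> cbox c d")
        case True
        then show ?thesis using mv[OF h(1)[of n], of x] h(1)[of n] by (simp add: G_def divide_le_eq)
      next
        case False
        with cd have "x \<notin> cball 0 (R + norm e)" by blast
        then have x: "norm x > R + norm e" by simp
        have "x \<notin> K" using R[of x] x norm_ge_zero[of e] by linarith
        moreover have "x + h n *\<^sub>R e \<notin> K"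
        proof
          assume "x + h n *\<^sub>R e \<in> K"
          then have "norm (x + h n *\<^sub>R e) \<le> R" by (rule R)
          moreover have "norm x \<le> norm (x + h n *\<^sub>R e) + norm (h n *\<^sub>R e)"
            using norm_triangle_ineq4[of "x + h n *\<^sub>R e" "h n *\<^sub>R e"] by simp
          moreover have "norm (h n *\<^sub>R e) \<le> norm e"
            using h[of n] by (simp add: mult_left_le_one_le)
          ultimately show False using x by linarith
        qed
        ultimately show ?thesis using K(2) False by (simp add: G_def)
      qed
    qed
  qed (auto simp: G_def[abs_def])
  then have "integral\<^sup>L lborel (\<lambda>x. F' x e) = 0"
    unfolding G0 by (simp add: LIMSEQ_const_iff)
  then show ?thesis by (subst integral_completion) auto
qed

section \<open>Geometry of shape-regular meshes\<close>

lemma simplex3_interior: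
  fixes \<tau> :: "R3 set"
  assumes "3 simplex \<tau>"
  shows "interior \<tau> \<noteq> {}" "closure (interior \<tau>) = \<tau>"
proof -
  have "aff_dim \<tau> = DIM(R3)" using aff_dim_simplex[OF assms] by simp
  then show "interior \<tau> \<noteq> {}"
    using interior_rel_interior_gen[of \<tau>] rel_interior_eq_empty[of \<tau>] convex_simplex[OF assms] assms
    by auto
  then show "closure (interior \<tau>) = \<tau>"
    using convex_closure_interior[OF convex_simplex[OF assms]] closed_simplex[OF assms] by simp
qed

lemma two_radius_le_diameter:
  fixes S :: "'a::euclidean_space set"
  assumes "bounded S" "cball x r \<subseteq> S" "0 \<le> r"
  shows "2 * r \<le> diameter S"
proof -
  have "diameter (cball x r) \<le> diameter S" using assms by (intro diameter_subset)
  then show ?thesis using assms(3) by simp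
qed

lemma inscribed_diameter_le:
  assumes \<tau>: "3 simplex \<tau>" and le: "\<And>x r. 0 \<le> r \<Longrightarrow> cball x r \<subseteq> \<tau> \<Longrightarrow> 2 * r \<le> d"
  shows "inscribed_diameter \<tau> \<le> d"
proof -
  obtain x where "x \<in> \<tau>" using simplex3_interior(1)[OF \<tau>] interior_subset by blast
  \<comment> \<open>The degenerate ball of radius 0 shows that the supremum is over a nonempty
    set.\<close>
  then have "(0::real) \<le> 0 \<and> cball x 0 \<subseteq> \<tau>" by simp
  then have "2 * 0 \<in> {2 * r | x r. 0 \<le> r \<and> cball x r \<subseteq> \<tau>}" by blast
  then have "{2 * r | x r. 0 \<le> r \<and> cball x r \<subseteq> \<tau>} \<noteq> {}" by blast
  then show ?thesis unfolding inscribed_diameter_def by (rule cSup_least) (use le in auto)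
qed

lemma inscribed_diameter_ge:
  assumes "bounded \<tau>" "0 \<le> r" "cball x r \<subseteq> \<tau>"
  shows "2 * r \<le> inscribed_diameter \<tau>"
  unfolding inscribed_diameter_def
proof (rule cSup_upper)
  show "bdd_above {2 * r | x r. 0 \<le> r \<and> cball x r \<subseteq> \<tau>}"
    using two_radius_le_diameter[OF assms(1)] by (auto simp: bdd_above_def)
qed (use assms in auto)

lemma inscribed_diameter_pos:
  assumes "3 simplex \<tau>"
  shows "0 < inscribed_diameter \<tau>"
proof -
  obtain x e where "0 < e" "cball x e \<subseteq> \<tau>"
    using simplex3_interior(1)[OF assms] by (auto simp: mem_interior_cball)
  moreover have "bounded \<tau>" using compact_simplex[OF assms] by (rule compact_imp_bounded)
  ultimately show ?thesis using inscribed_diameter_ge[of \<tau> e x] by linarith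
qed

text \<open>A ball reaching half of the supremum avoids the question whether it is attained; this
  costs the factor 4 in place of 2.\<close>

lemma inscribed_ball:
  assumes \<tau>: "3 simplex \<tau>"
  obtains x r where "0 < r" "cball x r \<subseteq> \<tau>" "inscribed_diameter \<tau> \<le> 4 * r"
proof -
  have pos: "0 < inscribed_diameter \<tau>" by (rule inscribed_diameter_pos[OF \<tau>])
  have "\<exists>x r. 0 \<le> r \<and> cball x r \<subseteq> \<tau> \<and> inscribed_diameter \<tau> / 2 < 2 * r"
  proof (rule ccontr)
    assume "\<not> ?thesis"
    then have "inscribed_diameter \<tau> \<le> inscribed_diameter \<tau> / 2"
      by (intro inscribed_diameter_le[OF \<tau>]) (meson not_less)
    with pos show False by simp
  qed
  then show thesis using that pos by force
qed

text \<open>The ball lies between the plane spanned by the face opposite to \<open>a\<close> and the parallel plane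
  through \<open>a\<close>.\<close>

lemma inscribed_diameter_le_edge:
  assumes \<tau>: "3 simplex \<tau>" and a: "a extreme_point_of \<tau>" and b: "b extreme_point_of \<tau>" and "a \<noteq> b"
  shows "inscribed_diameter \<tau> \<le> dist a b"
proof (rule inscribed_diameter_le[OF \<tau>])
  fix x r assume r: "0 \<le> r" "cball x r \<subseteq> \<tau>"
  obtain C where C: "\<not> affine_dependent C" "int (card C) = 3 + 1" "\<tau> = convex hull C"
    using \<tau> unfolding simplex_def by blast
  have ab: "a \<in> C" "b \<in> C"
    using a b C by (simp_all add: extreme_point_of_convex_hull_affine_independent)
  let ?D = "C - {a}"
  have "\<not> affine_dependent ?D" using C(1) affine_dependent_subset by blast
  moreover have "card ?D = 3" using C ab(1) by (simp add: aff_independent_finite)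
  ultimately have "aff_dim ?D = DIM(R3) - 1"
    using aff_dim_affine_independent[of ?D] by simp
  then obtain n \<beta> where n: "n \<noteq> 0" "affine hull ?D = {x. n \<bullet> x = \<beta>}"
    using aff_dim_eq_hyperplane[of ?D] by auto
  have a': "n \<bullet> a \<noteq> \<beta>" using C(1) ab(1) n(2) unfolding affine_dependent_def by blast
  have D: "n \<bullet> y = \<beta>" if "y \<in> C" "y \<noteq> a" for y
    using hull_inc[of y ?D affine] that n(2) by auto
  have b': "n \<bullet> b = \<beta>" using D ab(2) \<open>a \<noteq> b\<close> by blast
  \<comment> \<open>The sign of n is arbitrary, so the estimate is proved for a normal with a on its
    positive side and then used for n or - n. A diameter of the ball parallel to n fits between the
    two planes, and their distance is at most that of a and b, which lie one on each.\<close>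
  have *: "2 * r \<le> dist a b" if n: "n \<bullet> a > \<beta>" "\<And>y. y \<in> C \<Longrightarrow> y \<noteq> a \<Longrightarrow> n \<bullet> y = \<beta>" "n \<bullet> b = \<beta>" "n \<noteq> 0"
    for n :: R3 and \<beta>
  proof -
    have "convex hull C \<subseteq> {y. n \<bullet> y \<ge> \<beta>} \<inter> {y. n \<bullet> y \<le> n \<bullet> a}"
      using n by (intro hull_minimal convex_Int convex_halfspace_ge convex_halfspace_le) force
    then have lo: "n \<bullet> y \<ge> \<beta>" and hi: "n \<bullet> y \<le> n \<bullet> a" if "y \<in> \<tau>" for y
      using that C(3) by auto
    let ?u = "(r / norm n) *\<^sub>R n"
    have "norm ?u \<le> r" using n(4) r(1) by simp
    then have "x + ?u \<in> \<tau>" "x - ?u \<in> \<tau>" using r(2) by (auto simp: subset_iff dist_norm)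
    then have "n \<bullet> (x + ?u) - n \<bullet> (x - ?u) \<le> n \<bullet> a - \<beta>"
      using lo[of "x - ?u"] hi[of "x + ?u"] by linarith
    moreover have "n \<bullet> (x + ?u) - n \<bullet> (x - ?u) = 2 * r * norm n"
      using n(4) by (simp add: inner_add_right inner_diff_right power2_norm_eq_inner[symmetric] power2_eq_square)
    moreover have "n \<bullet> a - \<beta> = n \<bullet> (a - b)" using n(3) by (simp add: inner_diff_right)
    moreover have "n \<bullet> (a - b) \<le> norm n * dist a b" by (simp add: dist_norm norm_cauchy_schwarz)
    ultimately have "norm n * (2 * r) \<le> norm n * dist a b" by (simp add: mult.commute)
    then show ?thesis using n(4) by (metis mult_le_cancel_left_pos zero_less_norm_iff)
  qed
  show "2 * r \<le> dist a b"
  proof (cases "n \<bullet> a > \<beta>")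
    case True
    then show ?thesis using *[of \<beta> n] D b' n(1) by blast
  next
    case False
    with a' have "(- n) \<bullet> a > - \<beta>" by simp
    then show ?thesis using *[of "- \<beta>" "- n"] D b' n(1) by simp
  qed
qed

lemma card_extreme_points_simplex3:
  assumes "3 simplex \<tau>"
  shows "finite {v. v extreme_point_of \<tau>}" "card {v. v extreme_point_of \<tau>} = 4"
proof -
  obtain C where C: "\<not> affine_dependent C" "int (card C) = 3 + 1" "\<tau> = convex hull C"
    using assms unfolding simplex_def by blast
  then have "{v. v extreme_point_of \<tau>} = C"
    by (simp add: extreme_point_of_convex_hull_affine_independent)
  with C show "finite {v. v extreme_point_of \<tau>}" "card {v. v extreme_point_of \<tau>} = 4"
    by (auto simp: aff_independent_finite)
qed

text \<open>The volume ratio of \<open>card_cells_at_point\<close>, rounded up to an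
  integer.\<close>

definition neighbour_count :: "real \<Rightarrow> nat" where "neighbour_count \<rho> = nat \<lceil>(4 * \<rho>) ^ 3\<rceil>"

text \<open>Each passage through a common edge costs a factor \<rho>, and linking the cells at one
  vertex takes no more passages than there are cells.\<close>

definition size_ratio :: "real \<Rightarrow> real" where "size_ratio \<rho> = \<rho> ^ neighbour_count \<rho>"

section \<open>Cells of a shape-regular mesh\<close>

locale shape_regular_mesh =
  fixes \<Omega> :: "R3 set" and \<T> :: "R3 set set"
  assumes dom: "lipschitz_domain \<Omega>" and mesh: "mesh \<Omega> \<T>"
begin

definition \<rho> :: real where "\<rho> = shape_reg \<T>"

lemma finite_cells: "finite \<T>"
  and simplex_cell: "\<tau> \<in> \<T> \<Longrightarrow> 3 simplex \<tau>"
  and face_cells: "\<tau> \<in> \<T> \<Longrightarrow> \<tau>' \<in> \<T> \<Longrightarrow> (\<tau> \<inter> \<tau>') face_of \<tau>"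
  and Union_cells: "\<Union>\<T> = closure \<Omega>"
  using mesh unfolding mesh_def triangulation_def by auto

lemma compact_cell: "\<tau> \<in> \<T> \<Longrightarrow> compact \<tau>"
  and convex_cell: "\<tau> \<in> \<T> \<Longrightarrow> convex \<tau>"
  and closed_cell: "\<tau> \<in> \<T> \<Longrightarrow> closed \<tau>"
  and bounded_cell: "\<tau> \<in> \<T> \<Longrightarrow> bounded \<tau>"
  using simplex_cell compact_simplex convex_simplex closed_simplex compact_imp_bounded by blast+

lemma diameter_le_inscribed:
  assumes "\<tau> \<in> \<T>"
  shows "diameter \<tau> \<le> \<rho> * inscribed_diameter \<tau>"
proof -
  have "diameter \<tau> / inscribed_diameter \<tau> \<le> \<rho>"
    unfolding \<rho>_def shape_reg_def using finite_cells assms by (intro Max_ge) auto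
  then show ?thesis using inscribed_diameter_pos[OF simplex_cell[OF assms]] by (simp add: divide_le_eq)
qed

lemma cell_ball:
  assumes "\<tau> \<in> \<T>"
  obtains x r where "0 < r" "cball x r \<subseteq> \<tau>" "diameter \<tau> \<le> 4 * \<rho> * r" "2 * r \<le> diameter \<tau>"
proof -
  obtain x r where r: "0 < r" "cball x r \<subseteq> \<tau>" "inscribed_diameter \<tau> \<le> 4 * r"
    using inscribed_ball[OF simplex_cell[OF assms]] .
  have d: "2 * r \<le> diameter \<tau>" using two_radius_le_diameter[OF bounded_cell[OF assms] r(2)] r(1) by simp
  have "0 < \<rho> * inscribed_diameter \<tau>" using diameter_le_inscribed[OF assms] d r(1) by linarith
  then have "\<rho> > 0" using inscribed_diameter_pos[OF simplex_cell[OF assms]]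
    by (simp add: zero_less_mult_iff)
  then have "\<rho> * inscribed_diameter \<tau> \<le> \<rho> * (4 * r)" using r(3) by (intro mult_left_mono) auto
  with diameter_le_inscribed[OF assms] have "diameter \<tau> \<le> 4 * \<rho> * r" by simp
  with r d show thesis using that by blast
qed

lemma diameter_pos: "\<tau> \<in> \<T> \<Longrightarrow> 0 < diameter \<tau>"
  by (erule cell_ball) linarith

text \<open>A cell must exist, because the maximum over an empty mesh is unspecified.\<close>

lemma shape_ge_1:
  assumes "\<tau> \<in> \<T>"
  shows "1 \<le> \<rho>"
proof -
  have "inscribed_diameter \<tau> \<le> diameter \<tau>"
    using two_radius_le_diameter[OF bounded_cell[OF assms]]
    by (intro inscribed_diameter_le[OF simplex_cell[OF assms]])
  also have "\<dots> \<le> \<rho> * inscribed_diameter \<tau>" by (rule diameter_le_inscribed[OF assms])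
  finally show ?thesis using inscribed_diameter_pos[OF simplex_cell[OF assms]] by simp
qed

text \<open>The intersection is a face of each cell, and a proper face misses the interior. If the
  interiors meet, both cells therefore equal their intersection.\<close>

lemma cells_disjoint_interior:
  assumes "\<tau> \<in> \<T>" "\<tau>' \<in> \<T>" "\<tau> \<noteq> \<tau>'"
  shows "interior \<tau> \<inter> interior \<tau>' = {}"
proof (rule ccontr)
  assume ne: "interior \<tau> \<inter> interior \<tau>' \<noteq> {}"
  have "\<tau> \<subseteq> \<tau>'" if "\<tau> \<in> \<T>" "\<tau>' \<in> \<T>" "interior \<tau> \<inter> interior \<tau>' \<noteq> {}" for \<tau> \<tau>'
  proof -
    have "\<tau> \<inter> \<tau>' = \<tau>"
      using face_of_disjoint_interior[OF face_cells[OF that(1,2)]] that(3) interior_subset by blast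
    then show ?thesis by blast
  qed
  from this[of \<tau> \<tau>'] this[of \<tau>' \<tau>] ne assms show False by blast
qed

text \<open>The intersection is compact and convex, hence has an extreme point, and extreme points
  of a face are extreme in the whole cell.\<close>

lemma common_extreme_point:
  assumes "\<tau> \<in> \<T>" "\<tau>' \<in> \<T>" "\<tau> \<inter> \<tau>' \<noteq> {}"
  obtains v where "v extreme_point_of \<tau>" "v extreme_point_of \<tau>'"
proof -
  obtain v where "v extreme_point_of (\<tau> \<inter> \<tau>')"
    using extreme_point_exists_convex[of "\<tau> \<inter> \<tau>'"] assms compact_cell convex_cell
    by (metis compact_Int convex_Int)
  then have "v extreme_point_of \<tau>" "v extreme_point_of \<tau>'"
    using extreme_point_of_face[OF face_cells[OF assms(1,2)]]
      extreme_point_of_face[OF face_cells[OF assms(2,1)]] by (auto simp: Int_commute)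
  then show thesis by (rule that)
qed

text \<open>By Krein and Milman, a common face that is not a point has two extreme points, which are
  vertices of both cells. Their distance is at most the diameter of one cell and at least the
  inscribed diameter of the other.\<close>

lemma diameter_le_of_common_edge:
  assumes "\<tau> \<in> \<T>" "\<tau>' \<in> \<T>" "\<tau> \<inter> \<tau>' \<noteq> {}" "\<And>v. \<tau> \<inter> \<tau>' \<noteq> {v}"
  shows "diameter \<tau>' \<le> \<rho> * diameter \<tau>"
proof -
  let ?F = "\<tau> \<inter> \<tau>'"
  have F: "compact ?F" "convex ?F" using assms compact_cell convex_cell by (auto intro: compact_Int convex_Int)
  have "\<exists>a b. a \<noteq> b \<and> a extreme_point_of ?F \<and> b extreme_point_of ?F"
  proof (rule ccontr)
    assume no: "\<not> ?thesis"
    obtain v where "v extreme_point_of ?F" using extreme_point_exists_convex[OF F assms(3)] .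
    with no have "{x. x extreme_point_of ?F} = {v}" by blast
    then have "?F = {v}" using Krein_Milman[OF F] by simp
    with assms(4) show False by blast
  qed
  then obtain a b where ab: "a \<noteq> b" "a extreme_point_of ?F" "b extreme_point_of ?F" by blast
  then have "a extreme_point_of \<tau>'" "b extreme_point_of \<tau>'"
    using extreme_point_of_face[OF face_cells[OF assms(2,1)]] by (auto simp: Int_commute)
  then have "inscribed_diameter \<tau>' \<le> dist a b"
    using inscribed_diameter_le_edge simplex_cell assms(2) ab(1) by blast
  also have "dist a b \<le> diameter \<tau>"
    using ab(2,3) bounded_cell[OF assms(1)] by (intro diameter_bounded_bound) (auto simp: extreme_point_of_def)
  finally show ?thesis
    using diameter_le_inscribed[OF assms(2)] shape_ge_1[OF assms(1)]
    by (meson mult_left_mono order_trans zero_le_one)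
qed

text \<open>Shrinking the cells at \<open>v\<close> towards \<open>v\<close> to the size of the smallest one gives disjoint sets of
  comparable volume in a ball around \<open>v\<close>.\<close>

lemma card_cells_at_point:
  assumes "\<T> \<noteq> {}"
  shows "real (card {\<tau> \<in> \<T>. v \<in> \<tau>}) \<le> (4 * \<rho>) ^ 3"
proof (cases "{\<tau> \<in> \<T>. v \<in> \<tau>} = {}")
  case True
  moreover have "\<rho> \<ge> 1" using shape_ge_1 assms by blast
  ultimately show ?thesis by (simp only: True card.empty) simp
next
  case False
  let ?N = "{\<tau> \<in> \<T>. v \<in> \<tau>}"
  have fin: "finite ?N" using finite_cells by simp
  have \<rho>1: "\<rho> \<ge> 1" using shape_ge_1 False by blast
  define s where "s = Min (diameter ` ?N)"
  have s_le: "s \<le> diameter \<tau>" if "\<tau> \<in> ?N" for \<tau>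
    unfolding s_def using fin that by (intro Min_le) auto
  have "s \<in> diameter ` ?N" unfolding s_def using fin False by (intro Min_in) auto
  then have s0: "s > 0" using diameter_pos by auto
  \<comment> \<open>Shrunk to diameter s, a cell still contains a ball of this radius: its own ball,
    of radius at least diameter / (4 \<rho>), is scaled by s / diameter.\<close>
  define q where "q = s / (4 * \<rho>)"
  have q0: "q > 0" using s0 \<rho>1 by (simp add: q_def)
  have "\<exists>c. ball c q \<subseteq> interior \<tau> \<and> ball c q \<subseteq> cball v s" if \<tau>: "\<tau> \<in> ?N" for \<tau>
  proof -
    have \<tau>': "\<tau> \<in> \<T>" "v \<in> \<tau>" using \<tau> by auto
    obtain x r where xr: "0 < r" "cball x r \<subseteq> \<tau>" "diameter \<tau> \<le> 4 * \<rho> * r"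
      using cell_ball[OF \<tau>'(1)] by metis
    define t where "t = s / diameter \<tau>"
    have t: "0 < t" "t \<le> 1" using s0 s_le[OF \<tau>] by (auto simp: t_def)
    have "q \<le> t * r"
      using xr(3) s0 \<rho>1 diameter_pos[OF \<tau>'(1)] by (simp add: q_def t_def field_simps)
    let ?c = "v + t *\<^sub>R (x - v)"
    have "y \<in> \<tau> \<and> y \<in> cball v s" if "y \<in> ball ?c q" for y
    proof -
      \<comment> \<open>The preimage of y under the homothety with centre v and factor t.\<close>
      define z where "z = v + (1 / t) *\<^sub>R (y - v)"
      have "y = (1 - t) *\<^sub>R v + t *\<^sub>R z" using t by (simp add: z_def algebra_simps)
      have "z - x = (1 / t) *\<^sub>R (y - ?c)" using t by (simp add: z_def algebra_simps)
      then have "norm (z - x) = norm (y - ?c) / t" using t by (simp add: divide_inverse)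
      also have "\<dots> \<le> r" using that t \<open>q \<le> t * r\<close>
        by (simp add: dist_norm norm_minus_commute pos_divide_le_eq mult.commute)
      finally have z: "z \<in> \<tau>" using xr(2) by (auto simp: dist_norm norm_minus_commute)
      then have "y \<in> \<tau>"
        using convexD_alt[OF convex_cell[OF \<tau>'(1)] \<tau>'(2) z, of t] t \<open>y = _\<close> by simp
      moreover have "dist v y = t * dist v z" 
      proof -
        have "v - y = t *\<^sub>R (v - z)" using \<open>y = _\<close> by (simp add: algebra_simps)
        then show ?thesis using t by (simp add: dist_norm)
      qed
      moreover have "dist v z \<le> diameter \<tau>"
        using diameter_bounded_bound[OF bounded_cell[OF \<tau>'(1)] \<tau>'(2) z] .
      moreover have "t * dist v z \<le> t * diameter \<tau>"
        using t \<open>dist v z \<le> diameter \<tau>\<close> by (intro mult_left_mono) auto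
      moreover have "t * diameter \<tau> = s" using diameter_pos[OF \<tau>'(1)] by (simp add: t_def)
      ultimately show ?thesis by simp
    qed
    then have "ball ?c q \<subseteq> \<tau>" "ball ?c q \<subseteq> cball v s" by blast+
    then show ?thesis using interior_maximal[OF _ open_ball] by blast
  qed
  then obtain c where c: "\<And>\<tau>. \<tau> \<in> ?N \<Longrightarrow> ball (c \<tau>) q \<subseteq> interior \<tau> \<and> ball (c \<tau>) q \<subseteq> cball v s"
    by metis
  have "(\<Sum>\<tau>\<in>?N. measure lebesgue (ball (c \<tau>) q)) = measure lebesgue (\<Union>\<tau>\<in>?N. ball (c \<tau>) q)"
  proof (rule measure_finite_Union[symmetric])
    show "emeasure lebesgue (ball (c \<tau>) q) \<noteq> \<infinity>" for \<tau>
      using fmeasurableD2[OF lmeasurable_ball] by simp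
    show "disjoint_family_on (\<lambda>\<tau>. ball (c \<tau>) q) ?N"
      unfolding disjoint_family_on_def
    proof (intro ballI impI)
      fix \<tau> \<tau>' assume "\<tau> \<in> ?N" "\<tau>' \<in> ?N" "\<tau> \<noteq> \<tau>'"
      then show "ball (c \<tau>) q \<inter> ball (c \<tau>') q = {}"
        using c[of \<tau>] c[of \<tau>'] cells_disjoint_interior[of \<tau> \<tau>'] by blast
    qed
  qed (use fin in auto)
  also have "\<dots> \<le> measure lebesgue (cball v s)"
  proof (rule measure_mono_fmeasurable)
    show "(\<Union>\<tau>\<in>?N. ball (c \<tau>) q) \<in> sets lebesgue" using fin by (intro sets.finite_UN) auto
  qed (use c in auto)
  finally have "card ?N * (unit_ball_vol 3 * q ^ 3) \<le> unit_ball_vol 3 * s ^ 3"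
    using q0 s0 by (simp add: content_ball content_cball)
  moreover have "unit_ball_vol 3 > 0" by simp
  ultimately have "card ?N * q ^ 3 \<le> s ^ 3" by (simp add: mult.left_commute)
  also have "s = 4 * \<rho> * q" using \<rho>1 by (simp add: q_def)
  finally have "card ?N * q ^ 3 \<le> (4 * \<rho>) ^ 3 * q ^ 3" by (simp add: power_mult_distrib)
  then show ?thesis using q0 by simp
qed


section \<open>Local connectedness and comparison of diameters\<close>

lemma open_domain: "open \<Omega>"
  using dom by (simp add: lipschitz_domain_def)

text \<open>At a boundary point two points of the domain are joined by moving in the direction \<open>\<nu>\<close>, then
  along a segment that stays above the Lipschitz graph, and back.\<close>

lemma locally_connected_punctured:
  assumes v: "v \<in> closure \<Omega>" and r: "r > 0"
  obtains \<delta> where "\<delta> > 0" "\<And>y z. y \<in> \<Omega> \<inter> ball v \<delta> - {v} \<Longrightarrow> z \<in> \<Omega> \<inter> ball v \<delta> - {v} \<Longrightarrow>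
    \<exists>X. connected X \<and> X \<subseteq> \<Omega> \<inter> ball v r - {v} \<and> y \<in> X \<and> z \<in> X"
proof (cases "v \<in> \<Omega>")
  case True
  then obtain e where e: "e > 0" "ball v e \<subseteq> \<Omega>" using open_domain open_contains_ball by blast
  define \<delta> where "\<delta> = min e r"
  have "connected (ball v \<delta> - {v})" by (rule connected_punctured_ball) simp
  moreover have "ball v \<delta> \<subseteq> \<Omega> \<inter> ball v r" using e by (auto simp: \<delta>_def)
  ultimately show thesis
    using e(1) r by (intro that[of \<delta>] exI[of _ "ball v \<delta> - {v}"]) (auto simp: \<delta>_def)
next
  case False
  with v open_domain have "v \<in> frontier \<Omega>" by (simp add: frontier_def interior_open)
  then obtain U \<nu> f L where U: "open U" "v \<in> U" and \<nu>: "norm \<nu> = 1"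
    and L: "L-lipschitz_on UNIV (f :: R3 \<Rightarrow> real)"
    and epi: "\<Omega> \<inter> U = {y \<in> U. f (y - (y \<bullet> \<nu>) *\<^sub>R \<nu>) < y \<bullet> \<nu>}"
  proof -
    have "\<exists>U \<nu> f L. open U \<and> v \<in> U \<and> norm \<nu> = 1 \<and> L-lipschitz_on UNIV (f :: R3 \<Rightarrow> real) \<and>
        \<Omega> \<inter> U = {y \<in> U. f (y - (y \<bullet> \<nu>) *\<^sub>R \<nu>) < y \<bullet> \<nu>}"
      using dom \<open>v \<in> frontier \<Omega>\<close> unfolding lipschitz_domain_def by (elim conjE) (drule (1) bspec)
    then show thesis by (elim exE conjE) (rule that)
  qed
  obtain e where e: "e > 0" "ball v e \<subseteq> U" using U open_contains_ball by blast
  have L0: "L \<ge> 0" using L by (rule lipschitz_on_nonneg)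
  define pr where "pr y = y - (y \<bullet> \<nu>) *\<^sub>R \<nu>" for y :: R3
  have \<nu>\<nu>: "\<nu> \<bullet> \<nu> = 1" using \<nu> by (simp add: norm_eq_1)
  have pr_diff: "norm (pr y - pr z) \<le> norm (y - z)" for y z
  proof -
    have "(norm (pr (y - z)))\<^sup>2 + ((y - z) \<bullet> \<nu>)\<^sup>2 = (norm (y - z))\<^sup>2"
      unfolding pr_def power2_norm_eq_inner
      by (simp add: inner_diff_left inner_diff_right \<nu>\<nu> inner_commute power2_eq_square algebra_simps)
    then have "(norm (pr (y - z)))\<^sup>2 \<le> (norm (y - z))\<^sup>2" by (smt (verit) zero_le_power2)
    then have "norm (pr (y - z)) \<le> norm (y - z)" by (simp add: power2_le_iff_abs_le)
    moreover have "pr (y - z) = pr y - pr z" by (simp add: pr_def algebra_simps)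
    ultimately show ?thesis by simp
  qed
  have f_diff: "f (pr y) \<le> f (pr z) + L * norm (y - z)" for y z
  proof -
    have "\<bar>f (pr y) - f (pr z)\<bar> \<le> L * norm (pr y - pr z)"
      using lipschitz_onD[OF L, of "pr y" "pr z"] by (simp add: dist_norm)
    also have "\<dots> \<le> L * norm (y - z)" using pr_diff L0 by (intro mult_left_mono)
    finally show ?thesis by linarith
  qed
  have nu_diff: "y \<bullet> \<nu> \<le> z \<bullet> \<nu> + norm (y - z)" for y z
    using norm_cauchy_schwarz[of "y - z" \<nu>] \<nu> by (simp add: inner_diff_left)
  \<comment> \<open>The boundary point is a limit of points of \<Omega>, which lie above the graph,
    so it lies on or above the graph itself.\<close>
  have fv: "f (pr v) \<le> v \<bullet> \<nu>"
  proof (rule field_le_epsilon)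
    fix d :: real assume d: "d > 0"
    define \<eta> where "\<eta> = min e (d / (L + 1))"
    have "\<eta> > 0" using e d L0 by (simp add: \<eta>_def)
    then obtain y where y: "y \<in> \<Omega>" "dist y v < \<eta>" using v closure_approachable by blast
    then have "y \<in> \<Omega> \<inter> U" using e by (auto simp: \<eta>_def dist_commute)
    then have "f (pr y) < y \<bullet> \<nu>" unfolding epi by (simp add: pr_def)
    then have "f (pr v) \<le> v \<bullet> \<nu> + (L + 1) * dist y v"
      using f_diff[of v y] nu_diff[of y v] by (simp add: dist_norm norm_minus_commute algebra_simps)
    moreover have "(L + 1) * dist y v \<le> (L + 1) * (d / (L + 1))"
      using y(2) L0 by (intro mult_left_mono) (auto simp: \<eta>_def)
    ultimately show "f (pr v) \<le> v \<bullet> \<nu> + d" using L0 by simp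
  qed
  \<comment> \<open>Room for the whole path: its points stay within \<delta> + \<open>T\<close> = (L
    + 3) \<delta> of v, hence inside both U and the ball of radius r.\<close>
  define \<delta> where "\<delta> = min e r / (L + 4)"
  have \<delta>: "\<delta> > 0" using e r L0 by (simp add: \<delta>_def)
  have \<delta>': "(L + 4) * \<delta> = min e r" using L0 by (simp add: \<delta>_def)
  \<comment> \<open>At this height a segment clears the graph: over the ball of radius \<delta> the
    graph rises at most L \<delta> above v, and the points start at most \<delta> below v.\<close>
  define T where "T = (L + 2) * \<delta>"
  have T0: "T > 0" using L0 \<delta> by (simp add: T_def)
  \<comment> \<open>The point v is avoided because in this case it does not belong to
    \<Omega>.\<close>
  have in_X: "w \<in> \<Omega> \<inter> ball v r - {v}" if "norm (w - v) < (L + 4) * \<delta>" "f (pr w) < w \<bullet> \<nu>" for w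
  proof -
    have "w \<in> U" "w \<in> ball v r" using that(1) e unfolding \<delta>' by (auto simp: dist_norm norm_minus_commute)
    moreover from this that(2) have "w \<in> \<Omega> \<inter> U" unfolding epi by (simp add: pr_def)
    ultimately show ?thesis using False by blast
  qed
  have near: "f (pr y) < y \<bullet> \<nu>" if "y \<in> \<Omega> \<inter> ball v \<delta>" for y
  proof -
    have "\<delta> \<le> (L + 4) * \<delta>" using \<delta> L0 by (simp add: algebra_simps)
    then have "y \<in> \<Omega> \<inter> U" using that e \<delta>' by auto
    then show ?thesis unfolding epi by (simp add: pr_def)
  qed
  have vert: "closed_segment y (y + T *\<^sub>R \<nu>) \<subseteq> \<Omega> \<inter> ball v r - {v}" if y: "y \<in> \<Omega> \<inter> ball v \<delta>" for y
  proof
    fix w assume "w \<in> closed_segment y (y + T *\<^sub>R \<nu>)"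
    then obtain s where s: "0 \<le> s" "s \<le> 1" "w = y + (s * T) *\<^sub>R \<nu>"
      by (auto simp: in_segment algebra_simps)
    show "w \<in> \<Omega> \<inter> ball v r - {v}"
    proof (rule in_X)
      have "norm (w - v) \<le> norm (y - v) + norm ((s * T) *\<^sub>R \<nu>)"
        using norm_triangle_ineq[of "y - v" "(s * T) *\<^sub>R \<nu>"] s(3) by (simp add: algebra_simps)
      also have "norm ((s * T) *\<^sub>R \<nu>) \<le> T" using s T0 \<nu> by (simp add: mult_left_le_one_le)
      finally show "norm (w - v) < (L + 4) * \<delta>"
        using y \<delta> by (simp add: T_def dist_norm norm_minus_commute algebra_simps)
      have "pr w = pr y" by (simp add: pr_def s(3) inner_add_left \<nu>\<nu> algebra_simps)
      moreover have "w \<bullet> \<nu> = y \<bullet> \<nu> + s * T" by (simp add: s(3) inner_add_left \<nu>\<nu>)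
      moreover have "s * T \<ge> 0" using s T0 by simp
      ultimately show "f (pr w) < w \<bullet> \<nu>" using near[OF y] by simp
    qed
  qed
  have horiz: "closed_segment (y + T *\<^sub>R \<nu>) (z + T *\<^sub>R \<nu>) \<subseteq> \<Omega> \<inter> ball v r - {v}"
    if y: "y \<in> ball v \<delta>" and z: "z \<in> ball v \<delta>" for y z
  proof
    fix w assume "w \<in> closed_segment (y + T *\<^sub>R \<nu>) (z + T *\<^sub>R \<nu>)"
    then obtain u where u: "0 \<le> u" "u \<le> 1" "w = (1 - u) *\<^sub>R (y + T *\<^sub>R \<nu>) + u *\<^sub>R (z + T *\<^sub>R \<nu>)"
      by (auto simp: in_segment)
    define x where "x = (1 - u) *\<^sub>R y + u *\<^sub>R z"
    have x: "x \<in> closed_segment y z" "w = x + T *\<^sub>R \<nu>"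
      using u by (auto simp: x_def in_segment algebra_simps)
    have "x \<in> ball v \<delta>" using x(1) closed_segment_subset[OF y z convex_ball] by blast
    then have xv: "norm (x - v) < \<delta>" by (simp add: dist_norm norm_minus_commute)
    show "w \<in> \<Omega> \<inter> ball v r - {v}"
    proof (rule in_X)
      have "norm (w - v) \<le> norm (x - v) + norm (T *\<^sub>R \<nu>)"
        using norm_triangle_ineq[of "x - v" "T *\<^sub>R \<nu>"] x(2) by (simp add: algebra_simps)
      also have "norm (T *\<^sub>R \<nu>) = T" using T0 \<nu> by simp
      finally show "norm (w - v) < (L + 4) * \<delta>"
        using xv \<delta> by (simp add: T_def algebra_simps)
      have "pr w = pr x" by (simp add: pr_def x(2) inner_add_left \<nu>\<nu> algebra_simps)
      then have "f (pr w) \<le> v \<bullet> \<nu> + L * norm (x - v)" using f_diff[of x v] fv by simp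
      also have "\<dots> \<le> v \<bullet> \<nu> + L * \<delta>" using xv L0 by (simp add: mult_left_mono)
      also have "\<dots> < x \<bullet> \<nu> + T"
        using nu_diff[of v x] xv \<delta> by (simp add: T_def algebra_simps norm_minus_commute)
      also have "\<dots> = w \<bullet> \<nu>" by (simp add: x(2) inner_add_left \<nu>\<nu>)
      finally show "f (pr w) < w \<bullet> \<nu>" .
    qed
  qed
  show thesis
  proof (rule that[OF \<delta>])
    fix y z assume y: "y \<in> \<Omega> \<inter> ball v \<delta> - {v}" and z: "z \<in> \<Omega> \<inter> ball v \<delta> - {v}"
    let ?X = "closed_segment y (y + T *\<^sub>R \<nu>) \<union> closed_segment (y + T *\<^sub>R \<nu>) (z + T *\<^sub>R \<nu>)
      \<union> closed_segment z (z + T *\<^sub>R \<nu>)"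
    have "connected ?X"
      by (intro connected_Un connected_segment) (auto intro!: ends_in_segment)
    moreover have "?X \<subseteq> \<Omega> \<inter> ball v r - {v}"
      using vert[of y] vert[of z] horiz[of y z] y z by blast
    ultimately show "\<exists>X. connected X \<and> X \<subseteq> \<Omega> \<inter> ball v r - {v} \<and> y \<in> X \<and> z \<in> X"
      by (intro exI[of _ ?X]) auto
  qed
qed

text \<open>If every cell of A met every remaining cell at v in v alone, the two unions would be
  closed sets with only v in common. They would separate \<Omega> near v with v removed, against
  \<open>locally_connected_punctured\<close>.\<close>

lemma star_edge_connected:
  assumes A: "A \<subseteq> {\<tau> \<in> \<T>. v \<in> \<tau>}" "A \<noteq> {}" "A \<noteq> {\<tau> \<in> \<T>. v \<in> \<tau>}"
  obtains \<tau> \<tau>' where "\<tau> \<in> A" "\<tau>' \<in> {\<tau> \<in> \<T>. v \<in> \<tau>} - A" "\<tau> \<inter> \<tau>' \<noteq> {v}"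
proof (rule ccontr)
  assume "\<not> thesis"
  with that have single: "\<tau> \<inter> \<tau>' = {v}" if "\<tau> \<in> A" "\<tau>' \<in> {\<tau> \<in> \<T>. v \<in> \<tau>} - A" for \<tau> \<tau>'
    using that by blast
  define B where "B = {\<tau> \<in> \<T>. v \<in> \<tau>} - A"
  have Bne: "B \<noteq> {}" and B: "B \<subseteq> \<T>" using A unfolding B_def by blast+
  have fin: "finite A" "finite B"
    using A(1) finite_cells unfolding B_def by (auto intro: finite_subset[of _ "{\<tau> \<in> \<T>. v \<in> \<tau>}"])
  have AB: "\<Union>A \<inter> \<Union>B = {v}" using single A Bne unfolding B_def by blast
  have clA: "closed (\<Union>A)" "closed (\<Union>B)"
    using fin A(1) closed_cell by (auto intro!: closed_Union simp: B_def)
  \<comment> \<open>The radius is so small that the ball misses all cells not containing v.\<close>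
  obtain r where r: "r > 0" and cover: "\<Omega> \<inter> ball v r \<subseteq> \<Union>A \<union> \<Union>B"
  proof -
    let ?Z = "\<Union>{\<tau> \<in> \<T>. v \<notin> \<tau>}"
    have "closed ?Z" using finite_cells closed_cell by (intro closed_Union) auto
    then have "open (- ?Z)" "v \<in> - ?Z" by auto
    then obtain r where "r > 0" "ball v r \<subseteq> - ?Z" using open_contains_ball by blast
    moreover have "\<Omega> \<subseteq> \<Union>\<T>" using Union_cells closure_subset by blast
    ultimately show thesis using that[of r] unfolding B_def by blast
  qed
  have v: "v \<in> closure \<Omega>" using A Union_cells by blast
  obtain \<delta> where \<delta>: "\<delta> > 0" and path: "\<And>y z. y \<in> \<Omega> \<inter> ball v \<delta> - {v} \<Longrightarrow> z \<in> \<Omega> \<inter> ball v \<delta> - {v} \<Longrightarrow>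
    \<exists>X. connected X \<and> X \<subseteq> \<Omega> \<inter> ball v r - {v} \<and> y \<in> X \<and> z \<in> X"
    using locally_connected_punctured[OF v r] by metis
  \<comment> \<open>The interior of a cell is only known to lie in the closure of \<Omega>; being
    open, it must meet \<Omega> itself, and it does so arbitrarily close to v.\<close>
  have pt: "\<exists>y. y \<in> \<tau> \<and> y \<in> \<Omega> \<inter> ball v \<delta> - {v}" if \<tau>: "\<tau> \<in> \<T>" "v \<in> \<tau>" for \<tau>
  proof -
    let ?O = "interior \<tau> \<inter> ball v \<delta>"
    have "v \<in> closure (interior \<tau>)" using simplex3_interior(2)[OF simplex_cell[OF \<tau>(1)]] \<tau>(2) by simp
    then have ne: "?O \<noteq> {}"
      using \<delta> closure_approachable[of v "interior \<tau>"] by (fastforce simp: dist_commute)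
    have O: "open (?O - {v})" by (intro open_Diff) auto
    have "?O \<noteq> {v}" using not_open_singleton[of v] by (metis open_Int open_ball open_interior)
    with ne have "?O - {v} \<noteq> {}" by blast
    moreover have "?O - {v} \<subseteq> closure \<Omega>" using \<tau>(1) Union_cells interior_subset by blast
    ultimately have "(?O - {v}) \<inter> \<Omega> \<noteq> {}"
      using open_Int_closure_eq_empty[OF O, of \<Omega>] by blast
    then show ?thesis using interior_subset by blast
  qed
  obtain y where y: "y \<in> \<Union>A" "y \<in> \<Omega> \<inter> ball v \<delta> - {v}" using pt A by blast
  obtain z where z: "z \<in> \<Union>B" "z \<in> \<Omega> \<inter> ball v \<delta> - {v}" using pt Bne unfolding B_def by blast
  obtain X where X: "connected X" "X \<subseteq> \<Omega> \<inter> ball v r - {v}" "y \<in> X" "z \<in> X"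
    using path[OF y(2) z(2)] by blast
  have "X \<subseteq> \<Union>A \<union> \<Union>B" "\<Union>A \<inter> \<Union>B \<inter> X = {}" using X(2) cover AB by blast+
  then show False
    using X y(1) z(1) clA unfolding connected_closed by blast
qed

lemma card_cells_at_point_le: "\<T> \<noteq> {} \<Longrightarrow> card {\<tau> \<in> \<T>. v \<in> \<tau>} \<le> neighbour_count \<rho>"
  using card_cells_at_point[of v] unfolding neighbour_count_def by linarith

text \<open>As long as not every cell at \<open>v\<close> has diameter at most \<open>\<rho> ^ j * diameter \<tau>\<close>, raising \<open>j\<close> by
  one adds a cell sharing an edge with one of those already reached.\<close>

lemma diameter_le_at_point:
  assumes \<tau>: "\<tau> \<in> \<T>" "v \<in> \<tau>" and \<tau>': "\<tau>' \<in> \<T>" "v \<in> \<tau>'"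
  shows "diameter \<tau>' \<le> size_ratio \<rho> * diameter \<tau>"
proof -
  let ?N = "{\<tau> \<in> \<T>. v \<in> \<tau>}"
  define Lv where "Lv j = {\<sigma> \<in> ?N. diameter \<sigma> \<le> \<rho> ^ j * diameter \<tau>}" for j
  have \<rho>1: "\<rho> \<ge> 1" using shape_ge_1 \<tau>(1) .
  have fin: "finite ?N" using finite_cells by simp
  have "Lv j = ?N \<or> card (Lv j) \<ge> Suc j" for j
  proof (induction j)
    case 0
    have "\<tau> \<in> Lv 0" using \<tau> by (simp add: Lv_def)
    moreover have "finite (Lv 0)" using finite_cells by (simp add: Lv_def)
    ultimately show ?case by (metis One_nat_def Suc_leI card_gt_0_iff empty_iff)
  next
    case (Suc j)
    have mono: "Lv j \<subseteq> Lv (Suc j)"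
    proof -
      have "\<rho> ^ j * diameter \<tau> \<le> \<rho> ^ Suc j * diameter \<tau>"
        using \<rho>1 diameter_pos[OF \<tau>(1)] by (intro mult_right_mono power_increasing) auto
      then show ?thesis unfolding Lv_def by auto
    qed
    show ?case
    proof (cases "Lv j = ?N")
      case True
      with mono show ?thesis unfolding Lv_def by blast
    next
      case False
      have "\<tau> \<in> Lv j" using \<tau> \<rho>1 diameter_pos[OF \<tau>(1)] by (simp add: Lv_def one_le_power)
      then obtain \<sigma> \<sigma>' where s: "\<sigma> \<in> Lv j" "\<sigma>' \<in> ?N - Lv j" "\<sigma> \<inter> \<sigma>' \<noteq> {v}"
        using star_edge_connected[of "Lv j" v] False unfolding Lv_def by blast
      have v: "v \<in> \<sigma> \<inter> \<sigma>'" using s by (auto simp: Lv_def)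
      with s(3) have ne: "\<sigma> \<inter> \<sigma>' \<noteq> {u}" for u by (metis singletonD)
      have "diameter \<sigma>' \<le> \<rho> * diameter \<sigma>"
        using s v ne by (intro diameter_le_of_common_edge) (auto simp: Lv_def)
      also have "\<dots> \<le> \<rho> * (\<rho> ^ j * diameter \<tau>)"
        using s(1) \<rho>1 by (intro mult_left_mono) (auto simp: Lv_def)
      finally have "\<sigma>' \<in> Lv (Suc j)" using s(2) by (simp add: Lv_def mult.assoc)
      with s(2) mono have "Lv j \<subset> Lv (Suc j)" by blast
      moreover have "finite (Lv (Suc j))" using finite_cells by (simp add: Lv_def)
      ultimately have "card (Lv j) < card (Lv (Suc j))" by (simp add: psubset_card_mono)
      with Suc False show ?thesis by simp
    qed
  qed
  \<comment> \<open>At j = \<open>neighbour_count \<rho>\<close> the alternative with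
    \<open>Suc j\<close> cells is excluded, so all cells at v have been reached.\<close>
  moreover have "card (Lv j) \<le> neighbour_count \<rho>" for j
    using card_mono[OF fin, of "Lv j"] card_cells_at_point_le[of v] \<tau>(1) by (force simp: Lv_def)
  ultimately have "Lv (neighbour_count \<rho>) = ?N" by (metis not_less_eq_eq)
  then show ?thesis using \<tau>' unfolding Lv_def size_ratio_def by blast
qed

lemma diameter_le_of_touching:
  assumes "\<tau> \<in> \<T>" "\<tau>' \<in> \<T>" "\<tau> \<inter> \<tau>' \<noteq> {}"
  shows "diameter \<tau>' \<le> size_ratio \<rho> * diameter \<tau>"
  using assms diameter_le_at_point by blast

text \<open>Every touching cell contains one of the four vertices of \<tau>.\<close>

lemma card_touching:
  assumes \<tau>: "\<tau> \<in> \<T>"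
  shows "card {\<tau>' \<in> \<T>. \<tau>' \<inter> \<tau> \<noteq> {}} \<le> 4 * neighbour_count \<rho>"
proof -
  let ?E = "{v. v extreme_point_of \<tau>}"
  have "{\<tau>' \<in> \<T>. \<tau>' \<inter> \<tau> \<noteq> {}} \<subseteq> (\<Union>v\<in>?E. {\<tau>' \<in> \<T>. v \<in> \<tau>'})"
  proof
    fix \<tau>' assume "\<tau>' \<in> {\<tau>' \<in> \<T>. \<tau>' \<inter> \<tau> \<noteq> {}}"
    then have "\<tau>' \<in> \<T>" "\<tau> \<inter> \<tau>' \<noteq> {}" by auto
    from common_extreme_point[OF \<tau> this] obtain v where "v extreme_point_of \<tau>" "v extreme_point_of \<tau>'" .
    then show "\<tau>' \<in> (\<Union>v\<in>?E. {\<tau>' \<in> \<T>. v \<in> \<tau>'})"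
      using \<open>\<tau>' \<in> \<T>\<close> by (auto simp: extreme_point_of_def)
  qed
  moreover have "finite (\<Union>v\<in>?E. {\<tau>' \<in> \<T>. v \<in> \<tau>'})"
    using card_extreme_points_simplex3(1)[OF simplex_cell[OF \<tau>]] finite_cells by auto
  ultimately have "card {\<tau>' \<in> \<T>. \<tau>' \<inter> \<tau> \<noteq> {}} \<le> card (\<Union>v\<in>?E. {\<tau>' \<in> \<T>. v \<in> \<tau>'})"
    by (intro card_mono)
  also have "\<dots> \<le> (\<Sum>v\<in>?E. card {\<tau>' \<in> \<T>. v \<in> \<tau>'})"
    by (rule card_UN_le[OF card_extreme_points_simplex3(1)[OF simplex_cell[OF \<tau>]]])
  also have "\<dots> \<le> (\<Sum>v\<in>?E. neighbour_count \<rho>)"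
    using \<tau> by (intro sum_mono card_cells_at_point_le) auto
  finally show ?thesis by (simp add: card_extreme_points_simplex3(2)[OF simplex_cell[OF \<tau>]])
qed

lemma cell_subset_es1:
  assumes "\<tau> \<in> \<T>" "\<tau>' \<in> \<T>" "\<tau>' \<inter> \<tau> \<noteq> {}"
  shows "\<tau>' \<subseteq> closure (es1 \<T> \<tau>)"
proof -
  have "interior \<tau>' \<subseteq> es1 \<T> \<tau>" unfolding es1_def using assms by (intro interior_mono) blast
  then show ?thesis using simplex3_interior(2)[OF simplex_cell[OF assms(2)]] closure_mono by metis
qed

text \<open>A cell meeting \<open>\<tau>'\<close> also meets the closure of the first patch of
  \<tau>, because \<open>\<tau>'\<close> lies in this closure.\<close>

lemma es1_subset_es2:
  assumes "\<tau> \<in> \<T>" "\<tau>' \<in> \<T>" "\<tau>' \<inter> \<tau> \<noteq> {}"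
  shows "es1 \<T> \<tau>' \<subseteq> es2 \<T> \<tau>"
  unfolding es1_def[of \<T> \<tau>'] es2_def
  using cell_subset_es1[OF assms] by (intro interior_mono) blast

end

section \<open>Weak derivatives and their traces\<close>

lemma L2_measurable: "u \<in> L2 S \<Longrightarrow> u \<in> borel_measurable (lebesgue_on S)"
  and L2_square_integrable: "u \<in> L2 S \<Longrightarrow> integrable (lebesgue_on S) (\<lambda>x. (norm (u x))\<^sup>2)"
  by (simp_all add: L2_def)

lemma power2_norm_add_le: "(norm (a + b))\<^sup>2 \<le> 2 * (norm a)\<^sup>2 + 2 * (norm b)\<^sup>2"
proof -
  have "(norm (a + b))\<^sup>2 \<le> (norm a + norm b)\<^sup>2" by (intro power_mono norm_triangle_ineq) auto
  also have "\<dots> \<le> 2 * (norm a)\<^sup>2 + 2 * (norm b)\<^sup>2"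
    using sum_squares_bound[of "norm a" "norm b"] by (simp add: power2_sum)
  finally show ?thesis .
qed

lemma L2_lincomb:
  assumes "u \<in> L2 S" "v \<in> L2 S"
  shows "(\<lambda>x. a *\<^sub>R u x + b *\<^sub>R v x) \<in> L2 S"
proof -
  have [measurable]: "u \<in> borel_measurable (lebesgue_on S)" "v \<in> borel_measurable (lebesgue_on S)"
    using assms by (simp_all add: L2_measurable)
  have "integrable (lebesgue_on S) (\<lambda>x. 2 * (a\<^sup>2 * (norm (u x))\<^sup>2) + 2 * (b\<^sup>2 * (norm (v x))\<^sup>2))"
    using assms by (intro Bochner_Integration.integrable_add Bochner_Integration.integrable_mult_right) (simp_all add: L2_square_integrable)
  then have "integrable (lebesgue_on S) (\<lambda>x. (norm (a *\<^sub>R u x + b *\<^sub>R v x))\<^sup>2)"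
  proof (rule Bochner_Integration.integrable_bound)
    show "AE x in lebesgue_on S. norm ((norm (a *\<^sub>R u x + b *\<^sub>R v x))\<^sup>2)
        \<le> norm (2 * (a\<^sup>2 * (norm (u x))\<^sup>2) + 2 * (b\<^sup>2 * (norm (v x))\<^sup>2))"
    proof (rule AE_I2)
      fix x
      show "norm ((norm (a *\<^sub>R u x + b *\<^sub>R v x))\<^sup>2)
        \<le> norm (2 * (a\<^sup>2 * (norm (u x))\<^sup>2) + 2 * (b\<^sup>2 * (norm (v x))\<^sup>2))"
        using power2_norm_add_le[of "a *\<^sub>R u x" "b *\<^sub>R v x"]
        by (simp add: power_mult_distrib)
    qed
  qed measurable
  then show ?thesis by (simp add: L2_def)
qed

lemma L2_add: "u \<in> L2 S \<Longrightarrow> v \<in> L2 S \<Longrightarrow> (\<lambda>x. u x + v x) \<in> L2 S"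
  using L2_lincomb[of u S v 1 1] by simp

lemma L2_diff: "u \<in> L2 S \<Longrightarrow> v \<in> L2 S \<Longrightarrow> (\<lambda>x. u x - v x) \<in> L2 S"
  using L2_lincomb[of u S v 1 "-1"] by simp

lemma integrable_L2:
  assumes "S \<in> lmeasurable" "u \<in> L2 S"
  shows "integrable (lebesgue_on S) u"
proof -
  interpret finite_measure "lebesgue_on S" by (rule finite_measure_lebesgue_on[OF assms(1)])
  have "integrable (lebesgue_on S) (\<lambda>x. 1 + (norm (u x))\<^sup>2)"
    using assms by (intro Bochner_Integration.integrable_add) (simp_all add: L2_square_integrable)
  then show ?thesis
  proof (rule Bochner_Integration.integrable_bound)
    show "AE x in lebesgue_on S. norm (u x) \<le> norm (1 + (norm (u x))\<^sup>2)"
    proof (rule AE_I2)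
      fix x
      have "2 * norm (u x) \<le> 1 + (norm (u x))\<^sup>2"
        using sum_squares_bound[of 1 "norm (u x)"] by simp
      then have "norm (u x) \<le> 1 + (norm (u x))\<^sup>2"
        using norm_ge_zero[of "u x"] by linarith
      then show "norm (u x) \<le> norm (1 + (norm (u x))\<^sup>2)" by simp
    qed
  qed (use assms L2_measurable in blast)
qed

lemma continuous_measurable_lebesgue_on:
  fixes F :: "R3 \<Rightarrow> 'b::euclidean_space"
  assumes "continuous_on UNIV F"
  shows "F \<in> borel_measurable (lebesgue_on S)"
  using borel_measurable_continuous_onI[OF assms]
  by (intro measurable_restrict_space1 measurable_completion) simp

lemma integrable_inner_continuous:
  fixes u F :: "R3 \<Rightarrow> 'b::euclidean_space"
  assumes S: "bounded S" "S \<in> sets lebesgue" and u: "u \<in> L2 S" and F: "continuous_on UNIV F"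
  shows "integrable (lebesgue_on S) (\<lambda>x. u x \<bullet> F x)"
proof -
  have "compact (F ` closure S)"
    using S(1) F by (intro compact_continuous_image) (auto intro: continuous_on_subset simp: compact_closure)
  then obtain B where B: "\<And>x. x \<in> S \<Longrightarrow> norm (F x) \<le> B"
    using closure_subset by (metis bounded_iff compact_imp_bounded imageI subsetD)
  have [measurable]: "F \<in> borel_measurable (lebesgue_on S)" "u \<in> borel_measurable (lebesgue_on S)"
    using continuous_measurable_lebesgue_on[OF F] L2_measurable[OF u] by auto
  have "S \<in> lmeasurable" using S by (rule bounded_set_imp_lmeasurable)
  then have "integrable (lebesgue_on S) (\<lambda>x. B * norm (u x))"
    using integrable_L2[OF _ u] by simp
  then show ?thesis
  proof (rule Bochner_Integration.integrable_bound)
    show "AE x in lebesgue_on S. norm (u x \<bullet> F x) \<le> norm (B * norm (u x))"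
    proof (rule AE_I2)
      fix x assume "x \<in> space (lebesgue_on S)"
      then have "norm (F x) \<le> B" using B by simp
      then have "norm (u x) * norm (F x) \<le> norm (u x) * B" by (intro mult_left_mono) auto
      also have "\<dots> \<le> norm (B * norm (u x))" by (simp add: mult.commute abs_mult mult_right_mono)
      finally show "norm (u x \<bullet> F x) \<le> norm (B * norm (u x))"
        using Cauchy_Schwarz_ineq2[of "u x" "F x"] by simp
    qed
  qed measurable
qed

lemma ae_eq_refl [simp]: "ae_eq S u u"
  by (simp add: ae_eq_def)

lemma ae_eq_trans: "ae_eq S u v \<Longrightarrow> ae_eq S v w \<Longrightarrow> ae_eq S u w"
  unfolding ae_eq_def by (erule (1) eventually_elim2) simp

lemma ae_eq_lincomb:
  "ae_eq S u u' \<Longrightarrow> ae_eq S v v' \<Longrightarrow>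
   ae_eq S (\<lambda>x. a *\<^sub>R u x + b *\<^sub>R v x) (\<lambda>x. a *\<^sub>R u' x + b *\<^sub>R v' x)"
  unfolding ae_eq_def by (erule (1) eventually_elim2) simp

lemma ae_eq_add:
  fixes u v :: "R3 \<Rightarrow> 'a::real_vector"
  shows "ae_eq S u u' \<Longrightarrow> ae_eq S v v' \<Longrightarrow> ae_eq S (\<lambda>x. u x + v x) (\<lambda>x. u' x + v' x)"
  using ae_eq_lincomb[of S u u' v v' 1 1] by simp

lemma ae_eq_negligible:
  assumes "S \<in> sets lebesgue"
  shows "ae_eq S u v \<longleftrightarrow> negligible {x \<in> S. u x \<noteq> v x}"
  using assms by (simp add: ae_eq_def AE_lebesgue_on_iff_negligible)

text \<open>As T may exceed S by a null set, this transfers statements from \<Omega> to closed cells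
  reaching the boundary, and from the interior of a cell to the cell.\<close>

lemma ae_eq_subset_null:
  assumes "ae_eq S u v" "S \<in> sets lebesgue" "T \<in> sets lebesgue" "negligible (T - S)"
  shows "ae_eq T u v"
proof -
  have "negligible ({x \<in> S. u x \<noteq> v x} \<union> (T - S))" using assms by (simp add: ae_eq_negligible)
  then have "negligible {x \<in> T. u x \<noteq> v x}" by (rule negligible_subset) blast
  then show ?thesis using assms(3) by (simp add: ae_eq_negligible)
qed

lemma ae_linear_operator_lincomb:
  assumes P: "ae_linear_operator \<Omega> V W P"
    and V: "\<And>c u. u \<in> V \<Longrightarrow> (\<lambda>x. c *\<^sub>R u x) \<in> V" and uv: "u \<in> V" "v \<in> V"
  shows "ae_eq \<Omega> (P (\<lambda>x. a *\<^sub>R u x + b *\<^sub>R v x)) (\<lambda>x. a *\<^sub>R P u x + b *\<^sub>R P v x)"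
proof -
  have "ae_eq \<Omega> (P (\<lambda>x. a *\<^sub>R u x + b *\<^sub>R v x)) (\<lambda>x. P (\<lambda>x. a *\<^sub>R u x) x + P (\<lambda>x. b *\<^sub>R v x) x)"
    using P V[OF uv(1), of a] V[OF uv(2), of b] unfolding ae_linear_operator_def by (elim conjE) simp
  moreover have "ae_eq \<Omega> (\<lambda>x. P (\<lambda>x. a *\<^sub>R u x) x + P (\<lambda>x. b *\<^sub>R v x) x) (\<lambda>x. a *\<^sub>R P u x + b *\<^sub>R P v x)"
    using P uv unfolding ae_linear_operator_def by (intro ae_eq_add) blast+
  ultimately show ?thesis by (rule ae_eq_trans)
qed

lemma ae_linear_operator_diff:
  assumes "ae_linear_operator \<Omega> V W P"
    and "\<And>c u. u \<in> V \<Longrightarrow> (\<lambda>x. c *\<^sub>R u x) \<in> V" "u \<in> V" "v \<in> V"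
  shows "ae_eq \<Omega> (P (\<lambda>x. u x - v x)) (\<lambda>x. P u x - P v x)"
  using ae_linear_operator_lincomb[OF assms, of 1 "-1"] by simp

section \<open>Derivatives of smooth test fields\<close>

lemma smooth_field_has_derivative:
  assumes "smooth_field \<psi>"
  shows "(\<psi> has_derivative frechet_derivative \<psi> (at x)) (at x)"
proof -
  have "\<psi> differentiable (at x)"
    using assms smooth_differentiable unfolding smooth_field_def
    by (subst differentiable_componentwise_within) blast
  then show ?thesis by (simp add: frechet_derivative_works)
qed

lemma smooth_field_pd:
  assumes "smooth_field \<psi>"
  shows "pd i (\<lambda>x. \<psi> x \<bullet> b) x = frechet_derivative \<psi> (at x) (axis i 1) \<bullet> b"
  by (rule pd_eqI[OF has_derivative_inner_left[OF smooth_field_has_derivative[OF assms]]])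

lemma continuous_on_smooth_field:
  assumes "smooth_field \<psi>"
  shows "continuous_on S \<psi>"
  using assms smooth_continuous unfolding smooth_field_def
  by (subst continuous_on_componentwise) blast

lemma smooth_inner_linear_pd:
  assumes "smooth_field \<psi>" "linear f"
  shows "smooth (\<lambda>x. f (frechet_derivative \<psi> (at x) (axis i 1)) \<bullet> a)"
proof -
  have "f (frechet_derivative \<psi> (at x) (axis i 1)) \<bullet> a = (\<Sum>b\<in>Basis. pd i (\<lambda>x. \<psi> x \<bullet> b) x * (f b \<bullet> a))" for x
  proof -
    have "f (frechet_derivative \<psi> (at x) (axis i 1))
        = f (\<Sum>b\<in>Basis. (frechet_derivative \<psi> (at x) (axis i 1) \<bullet> b) *\<^sub>R b)"
      by (simp only: euclidean_representation)
    then show ?thesis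
      by (simp add: linear_sum[OF assms(2)] linear_scale[OF assms(2)] inner_sum_left smooth_field_pd[OF assms(1)])
  qed
  then show ?thesis
    using assms(1) unfolding smooth_field_def
    by (simp only:) (intro smooth_sum smooth_mult smooth_const smooth_pd, blast)
qed

lemma frechet_derivative_outside_support:
  fixes \<psi> :: "R3 \<Rightarrow> 'b::real_normed_vector"
  assumes "x \<notin> closure {x. \<psi> x \<noteq> 0}"
  shows "frechet_derivative \<psi> (at x) = (\<lambda>h. 0)"
proof -
  have "((\<lambda>x. 0) has_derivative (\<lambda>h. 0)) (at x)" by simp
  moreover have "open (- closure {x. \<psi> x \<noteq> 0})" by (intro open_Compl closed_closure)
  ultimately have "(\<psi> has_derivative (\<lambda>h. 0)) (at x)"
    by (rule has_derivative_transform_within_open)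
      (use assms closure_subset[of "{x. \<psi> x \<noteq> 0}"] in auto)
  then show ?thesis by (rule frechet_derivative_at[symmetric])
qed

text \<open>The gradient, the curl and the divergence are the weak derivatives \<open>g\<close> defined by
  \<open>\<integral> u \<bullet> D \<psi> = s * \<integral> g \<bullet> \<psi>\<close> for the operators \<open>D = div\<close>, \<open>D = curl\<close> and \<open>D = grad\<close>, respectively;
  the symbol of \<open>D\<close> is \<open>T\<close>.\<close>

locale weak_derivative =
  fixes T :: "3 \<Rightarrow> 'b::euclidean_space \<Rightarrow> 'a::euclidean_space" and T' :: "3 \<Rightarrow> 'a \<Rightarrow> 'b" and s :: real
  assumes linear_T: "linear (T i)"
    and adjoint: "T' i u \<bullet> w = u \<bullet> T i w"
    and norm_T': "norm (T' i u) \<le> norm u"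
    and sign: "\<bar>s\<bar> = 1"
begin

definition D :: "(R3 \<Rightarrow> 'b) \<Rightarrow> R3 \<Rightarrow> 'a" where
  "D \<psi> x = (\<Sum>i\<in>UNIV. T i (frechet_derivative \<psi> (at x) (axis i 1)))"

definition is_wd :: "R3 set \<Rightarrow> (R3 \<Rightarrow> 'a) \<Rightarrow> (R3 \<Rightarrow> 'b) \<Rightarrow> bool" where
  "is_wd \<Omega> u g \<longleftrightarrow> (\<forall>\<psi>. smooth_field \<psi> \<and> supported_in \<Omega> \<psi> \<longrightarrow>
     integral\<^sup>L (lebesgue_on \<Omega>) (\<lambda>x. u x \<bullet> D \<psi> x) = s * integral\<^sup>L (lebesgue_on \<Omega>) (\<lambda>x. g x \<bullet> \<psi> x))"

definition V :: "R3 set \<Rightarrow> (R3 \<Rightarrow> 'a) set" where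
  "V \<Omega> = {u \<in> L2 \<Omega>. \<exists>g \<in> L2 \<Omega>. is_wd \<Omega> u g}"

definition wd :: "R3 set \<Rightarrow> (R3 \<Rightarrow> 'a) \<Rightarrow> (R3 \<Rightarrow> 'b)" where
  "wd \<Omega> u = (SOME g. g \<in> L2 \<Omega> \<and> is_wd \<Omega> u g)"

definition tr :: "R3 set \<Rightarrow> (R3 \<Rightarrow> 'a) \<Rightarrow> (R3 \<Rightarrow> 'b) \<Rightarrow> real" where
  "tr \<Omega> u = (\<lambda>\<psi>. if smooth_field \<psi>
     then integral\<^sup>L (lebesgue_on \<Omega>) (\<lambda>x. u x \<bullet> D \<psi> x - s * (wd \<Omega> u x \<bullet> \<psi> x)) else 0)"

lemma smooth_field_D:
  assumes "smooth_field \<psi>"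
  shows "smooth_field (D \<psi>)"
  unfolding smooth_field_def D_def inner_sum_left
  by (intro ballI smooth_sum smooth_inner_linear_pd assms linear_T)

lemma continuous_on_D: "smooth_field \<psi> \<Longrightarrow> continuous_on S (D \<psi>)"
  by (intro continuous_on_smooth_field smooth_field_D)

lemma D_outside:
  assumes "x \<notin> closure {x. \<psi> x \<noteq> 0}"
  shows "D \<psi> x = 0"
proof -
  have "frechet_derivative \<psi> (at x) = (\<lambda>h. 0)" by (rule frechet_derivative_outside_support[OF assms])
  then show ?thesis by (simp add: D_def linear_0[OF linear_T])
qed

lemma supported_in_D:
  assumes "supported_in \<Omega> \<psi>"
  shows "supported_in \<Omega> (D \<psi>)"
proof -
  have sub: "closure {x. D \<psi> x \<noteq> 0} \<subseteq> closure {x. \<psi> x \<noteq> 0}"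
    using D_outside by (intro closure_minimal) auto
  then have "compact (closure {x. D \<psi> x \<noteq> 0})"
    using assms unfolding supported_in_def
    by (meson bounded_subset closed_closure compact_eq_bounded_closed)
  with sub assms show ?thesis unfolding supported_in_def by blast
qed

end

locale weak_derivative_on = weak_derivative T T' s
  for T :: "3 \<Rightarrow> 'b::euclidean_space \<Rightarrow> 'a::euclidean_space" and T' s +
  fixes \<Omega> :: "R3 set"
  assumes open_\<Omega>: "open \<Omega>" and bounded_\<Omega>: "bounded \<Omega>"
begin

lemma sets_\<Omega> [simp]: "\<Omega> \<in> sets lebesgue"
  using open_\<Omega> by auto

lemma lmeasurable_\<Omega>: "\<Omega> \<in> lmeasurable"
  using bounded_\<Omega> sets_\<Omega> by (rule bounded_set_imp_lmeasurable)

lemma V_L2: "u \<in> V \<Omega> \<Longrightarrow> u \<in> L2 \<Omega>"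
  by (simp add: V_def)

lemma wd_L2: "u \<in> V \<Omega> \<Longrightarrow> wd \<Omega> u \<in> L2 \<Omega>"
  and is_wd_wd: "u \<in> V \<Omega> \<Longrightarrow> is_wd \<Omega> u (wd \<Omega> u)"
proof -
  have "wd \<Omega> u \<in> L2 \<Omega> \<and> is_wd \<Omega> u (wd \<Omega> u)" if "u \<in> V \<Omega>"
  proof -
    have "\<exists>g. g \<in> L2 \<Omega> \<and> is_wd \<Omega> u g" using that by (auto simp: V_def)
    then show ?thesis unfolding wd_def by (rule someI_ex)
  qed
  then show "u \<in> V \<Omega> \<Longrightarrow> wd \<Omega> u \<in> L2 \<Omega>" "u \<in> V \<Omega> \<Longrightarrow> is_wd \<Omega> u (wd \<Omega> u)" by auto
qed

lemma integrable_D: "u \<in> L2 \<Omega> \<Longrightarrow> smooth_field \<psi> \<Longrightarrow> integrable (lebesgue_on \<Omega>) (\<lambda>x. u x \<bullet> D \<psi> x)"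
  by (intro integrable_inner_continuous bounded_\<Omega> sets_\<Omega> continuous_on_D)

lemma integrable_test: "g \<in> L2 \<Omega> \<Longrightarrow> smooth_field \<psi> \<Longrightarrow> integrable (lebesgue_on \<Omega>) (\<lambda>x. g x \<bullet> \<psi> x)"
  by (intro integrable_inner_continuous bounded_\<Omega> sets_\<Omega> continuous_on_smooth_field)

lemma is_wd_unique:
  assumes "is_wd \<Omega> u g" "is_wd \<Omega> u g'" "g \<in> L2 \<Omega>" "g' \<in> L2 \<Omega>"
  shows "ae_eq \<Omega> g g'"
proof -
  have "ae_eq \<Omega> (\<lambda>x. g x - g' x) (\<lambda>x. 0)"
  proof (rule du_Bois_Reymond[OF open_\<Omega>])
    show "integrable (lebesgue_on \<Omega>) (\<lambda>x. g x - g' x)"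
      by (intro integrable_L2 lmeasurable_\<Omega> L2_diff assms)
    fix \<psi> :: "R3 \<Rightarrow> 'b" assume \<psi>: "smooth_field \<psi>" "supported_in \<Omega> \<psi>"
    then have "s * integral\<^sup>L (lebesgue_on \<Omega>) (\<lambda>x. g x \<bullet> \<psi> x) = s * integral\<^sup>L (lebesgue_on \<Omega>) (\<lambda>x. g' x \<bullet> \<psi> x)"
      using assms(1,2) unfolding is_wd_def by metis
    then have "integral\<^sup>L (lebesgue_on \<Omega>) (\<lambda>x. g x \<bullet> \<psi> x) = integral\<^sup>L (lebesgue_on \<Omega>) (\<lambda>x. g' x \<bullet> \<psi> x)"
      using sign by auto
    then show "integral\<^sup>L (lebesgue_on \<Omega>) (\<lambda>x. (g x - g' x) \<bullet> \<psi> x) = 0"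
      using integrable_test[OF assms(3) \<psi>(1)] integrable_test[OF assms(4) \<psi>(1)]
      by (simp add: inner_diff_left)
  qed
  then show ?thesis unfolding ae_eq_def by (rule eventually_mono) simp
qed

lemma is_wd_lincomb:
  assumes "is_wd \<Omega> u g" "is_wd \<Omega> v h" "u \<in> L2 \<Omega>" "v \<in> L2 \<Omega>" "g \<in> L2 \<Omega>" "h \<in> L2 \<Omega>"
  shows "is_wd \<Omega> (\<lambda>x. a *\<^sub>R u x + b *\<^sub>R v x) (\<lambda>x. a *\<^sub>R g x + b *\<^sub>R h x)"
  unfolding is_wd_def
proof (intro allI impI)
  fix \<psi> :: "R3 \<Rightarrow> 'b" assume \<psi>: "smooth_field \<psi> \<and> supported_in \<Omega> \<psi>"
  then show "integral\<^sup>L (lebesgue_on \<Omega>) (\<lambda>x. (a *\<^sub>R u x + b *\<^sub>R v x) \<bullet> D \<psi> x) =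
      s * integral\<^sup>L (lebesgue_on \<Omega>) (\<lambda>x. (a *\<^sub>R g x + b *\<^sub>R h x) \<bullet> \<psi> x)"
    using assms(1,2) integrable_D[OF assms(3)] integrable_D[OF assms(4)]
      integrable_test[OF assms(5)] integrable_test[OF assms(6)]
    unfolding is_wd_def by (simp add: inner_add_left algebra_simps)
qed

lemma V_lincomb:
  assumes "u \<in> V \<Omega>" "v \<in> V \<Omega>"
  shows "(\<lambda>x. a *\<^sub>R u x + b *\<^sub>R v x) \<in> V \<Omega>"
    and "ae_eq \<Omega> (wd \<Omega> (\<lambda>x. a *\<^sub>R u x + b *\<^sub>R v x)) (\<lambda>x. a *\<^sub>R wd \<Omega> u x + b *\<^sub>R wd \<Omega> v x)"
proof -
  let ?w = "\<lambda>x. a *\<^sub>R u x + b *\<^sub>R v x" and ?g = "\<lambda>x. a *\<^sub>R wd \<Omega> u x + b *\<^sub>R wd \<Omega> v x"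
  have wd: "is_wd \<Omega> ?w ?g"
    using assms by (intro is_wd_lincomb is_wd_wd V_L2 wd_L2)
  have g: "?g \<in> L2 \<Omega>" using assms by (intro L2_lincomb wd_L2)
  have "?w \<in> L2 \<Omega>" using assms by (intro L2_lincomb V_L2)
  with wd g show "?w \<in> V \<Omega>" by (auto simp: V_def)
  then show "ae_eq \<Omega> (wd \<Omega> ?w) ?g"
    using is_wd_unique[OF is_wd_wd wd wd_L2 g] by blast
qed

lemma V_scale: "u \<in> V \<Omega> \<Longrightarrow> (\<lambda>x. c *\<^sub>R u x) \<in> V \<Omega>"
  using V_lincomb(1)[of u u c 0] by simp

lemma V_add: "u \<in> V \<Omega> \<Longrightarrow> v \<in> V \<Omega> \<Longrightarrow> (\<lambda>x. u x + v x) \<in> V \<Omega>"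
  using V_lincomb(1)[of u v 1 1] by simp

lemma V_diff: "u \<in> V \<Omega> \<Longrightarrow> v \<in> V \<Omega> \<Longrightarrow> (\<lambda>x. u x - v x) \<in> V \<Omega>"
  using V_lincomb(1)[of u v 1 "-1"] by simp

lemma wd_add: "u \<in> V \<Omega> \<Longrightarrow> v \<in> V \<Omega> \<Longrightarrow> ae_eq \<Omega> (wd \<Omega> (\<lambda>x. u x + v x)) (\<lambda>x. wd \<Omega> u x + wd \<Omega> v x)"
  using V_lincomb(2)[of u v 1 1] by simp

lemma wd_diff: "u \<in> V \<Omega> \<Longrightarrow> v \<in> V \<Omega> \<Longrightarrow> ae_eq \<Omega> (wd \<Omega> (\<lambda>x. u x - v x)) (\<lambda>x. wd \<Omega> u x - wd \<Omega> v x)"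
  using V_lincomb(2)[of u v 1 "-1"] by simp

lemma integral_inner_cong_ae:
  fixes u v F :: "R3 \<Rightarrow> 'c::euclidean_space"
  assumes "ae_eq \<Omega> u v" "u \<in> L2 \<Omega>" "v \<in> L2 \<Omega>" "continuous_on UNIV F"
  shows "integral\<^sup>L (lebesgue_on \<Omega>) (\<lambda>x. u x \<bullet> F x) = integral\<^sup>L (lebesgue_on \<Omega>) (\<lambda>x. v x \<bullet> F x)"
proof (rule integral_cong_AE)
  show "AE x in lebesgue_on \<Omega>. u x \<bullet> F x = v x \<bullet> F x"
    using assms(1) unfolding ae_eq_def by (rule eventually_mono) simp
qed (use assms integrable_inner_continuous[OF bounded_\<Omega> sets_\<Omega>] in blast)+

text \<open>An equality of functions, since SOME selects from the same set of candidates for both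
  arguments: the defining integrals do not see null sets.\<close>

lemma wd_cong:
  assumes "ae_eq \<Omega> u v" "u \<in> L2 \<Omega>" "v \<in> L2 \<Omega>"
  shows "wd \<Omega> u = wd \<Omega> v"
proof -
  have "is_wd \<Omega> u g \<longleftrightarrow> is_wd \<Omega> v g" for g
    unfolding is_wd_def by (simp add: integral_inner_cong_ae[OF assms continuous_on_D] cong: conj_cong)
  then show ?thesis unfolding wd_def by simp
qed

lemma tr_cong:
  assumes "ae_eq \<Omega> u v" "u \<in> V \<Omega>" "v \<in> V \<Omega>"
  shows "tr \<Omega> u = tr \<Omega> v"
proof
  fix \<psi> :: "R3 \<Rightarrow> 'b"
  show "tr \<Omega> u \<psi> = tr \<Omega> v \<psi>"
  proof (cases "smooth_field \<psi>")
    case True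
    have "integral\<^sup>L (lebesgue_on \<Omega>) (\<lambda>x. u x \<bullet> D \<psi> x) = integral\<^sup>L (lebesgue_on \<Omega>) (\<lambda>x. v x \<bullet> D \<psi> x)"
      using assms by (intro integral_inner_cong_ae continuous_on_D True V_L2)
    moreover have "wd \<Omega> u = wd \<Omega> v" using assms by (intro wd_cong V_L2)
    ultimately show ?thesis
      using True integrable_D[OF V_L2[OF assms(2)] True] integrable_D[OF V_L2[OF assms(3)] True]
        integrable_test[OF wd_L2[OF assms(3)] True]
      by (simp add: tr_def)
  qed (simp add: tr_def)
qed

text \<open>The chosen weak derivatives are linear only almost everywhere, which integrals against
  test fields do not notice; so the linearity of traces is exact.\<close>

lemma tr_lincomb:
  assumes "u \<in> V \<Omega>" "v \<in> V \<Omega>"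
  shows "tr \<Omega> (\<lambda>x. a *\<^sub>R u x + b *\<^sub>R v x) = (\<lambda>\<psi>. a * tr \<Omega> u \<psi> + b * tr \<Omega> v \<psi>)"
proof
  fix \<psi> :: "R3 \<Rightarrow> 'b"
  let ?w = "\<lambda>x. a *\<^sub>R u x + b *\<^sub>R v x" and ?g = "\<lambda>x. a *\<^sub>R wd \<Omega> u x + b *\<^sub>R wd \<Omega> v x"
  show "tr \<Omega> ?w \<psi> = a * tr \<Omega> u \<psi> + b * tr \<Omega> v \<psi>"
  proof (cases "smooth_field \<psi>")
    case True
    have w: "?w \<in> V \<Omega>" by (rule V_lincomb(1)[OF assms])
    have *: "integral\<^sup>L (lebesgue_on \<Omega>) (\<lambda>x. wd \<Omega> ?w x \<bullet> \<psi> x) = integral\<^sup>L (lebesgue_on \<Omega>) (\<lambda>x. ?g x \<bullet> \<psi> x)"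
      using assms by (intro integral_inner_cong_ae V_lincomb(2) wd_L2 w L2_lincomb
          continuous_on_smooth_field True)
    have "tr \<Omega> ?w \<psi> = integral\<^sup>L (lebesgue_on \<Omega>) (\<lambda>x. ?w x \<bullet> D \<psi> x)
        - s * integral\<^sup>L (lebesgue_on \<Omega>) (\<lambda>x. wd \<Omega> ?w x \<bullet> \<psi> x)"
      using True integrable_D[OF V_L2[OF w] True] integrable_test[OF wd_L2[OF w] True]
      by (simp add: tr_def)
    also have "\<dots> = a * tr \<Omega> u \<psi> + b * tr \<Omega> v \<psi>"
      unfolding * using True integrable_D[OF V_L2[OF assms(1)] True] integrable_D[OF V_L2[OF assms(2)] True]
        integrable_test[OF wd_L2[OF assms(1)] True] integrable_test[OF wd_L2[OF assms(2)] True]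
      by (simp add: tr_def inner_add_left algebra_simps)
    finally show ?thesis .
  qed (simp add: tr_def)
qed

lemma tr_add: "u \<in> V \<Omega> \<Longrightarrow> v \<in> V \<Omega> \<Longrightarrow> tr \<Omega> (\<lambda>x. u x + v x) = (\<lambda>\<psi>. tr \<Omega> u \<psi> + tr \<Omega> v \<psi>)"
  using tr_lincomb[of u v 1 1] by simp

lemma tr_diff: "u \<in> V \<Omega> \<Longrightarrow> v \<in> V \<Omega> \<Longrightarrow> tr \<Omega> (\<lambda>x. u x - v x) = (\<lambda>\<psi>. tr \<Omega> u \<psi> - tr \<Omega> v \<psi>)"
  using tr_lincomb[of u v 1 "-1"] by simp

lemma tr_combine:
  assumes "P u \<in> V \<Omega>" "Q (\<lambda>y. u y - P u y) \<in> V \<Omega>"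
  shows "tr \<Omega> (combine P Q u) = (\<lambda>\<psi>. tr \<Omega> (P u) \<psi> + tr \<Omega> (Q (\<lambda>y. u y - P u y)) \<psi>)"
  unfolding combine_def using tr_add[OF assms] .

text \<open>Write the trace of u as that of f in \<open>W0\<close> plus that of w in
  \<open>W\<close>. \<open>P\<close> kills the trace of u - f and keeps that of f, so
  \<open>P u\<close> has the trace of f; the remainder u - P u then has the trace of w, which
  \<open>Q\<close> keeps.\<close>

lemma preserves_trace_combine:
  assumes W: "W0 \<subseteq> V \<Omega>" "W \<subseteq> V \<Omega>"
    and sum: "is_direct_sum (tr \<Omega> ` Wp) (tr \<Omega> ` W0) (tr \<Omega> ` W)"
    and P: "ae_linear_operator \<Omega> (V \<Omega>) W0 P" and Q: "ae_linear_operator \<Omega> (V \<Omega>) W Q"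
    and P_tr: "preserves_trace (tr \<Omega>) (trace_in (tr \<Omega>) (V \<Omega>) W0) P"
    and Q_tr: "preserves_trace (tr \<Omega>) (trace_in (tr \<Omega>) (V \<Omega>) W) Q"
    and P_kill: "kills_trace (tr \<Omega>) (trace_in (tr \<Omega>) (V \<Omega>) W) P"
  shows "preserves_trace (tr \<Omega>) (trace_in (tr \<Omega>) (V \<Omega>) Wp) (combine P Q)"
  unfolding preserves_trace_def
proof
  have PV: "P v \<in> V \<Omega>" and QV: "Q v \<in> V \<Omega>" if "v \<in> V \<Omega>" for v
    using that P Q W unfolding ae_linear_operator_def by blast+
  fix u assume "u \<in> trace_in (tr \<Omega>) (V \<Omega>) Wp"
  then have u: "u \<in> V \<Omega>" and "tr \<Omega> u \<in> tr \<Omega> ` Wp" by (auto simp: trace_in_def)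
  then have "tr \<Omega> u \<in> {\<lambda>t. b t + c t | b c. b \<in> tr \<Omega> ` W0 \<and> c \<in> tr \<Omega> ` W}"
    using sum unfolding is_direct_sum_def by blast
  then obtain f w where f: "f \<in> W0" and w: "w \<in> W" and tu: "tr \<Omega> u = (\<lambda>t. tr \<Omega> f t + tr \<Omega> w t)"
    by blast
  have fV: "f \<in> V \<Omega>" using f W by blast
  have "tr \<Omega> (\<lambda>x. u x - f x) = tr \<Omega> w" using tr_diff[OF u fV] tu by simp
  then have "(\<lambda>x. u x - f x) \<in> trace_in (tr \<Omega>) (V \<Omega>) W"
    using V_diff[OF u fV] w by (auto simp: trace_in_def)
  then have "tr \<Omega> (P (\<lambda>x. u x - f x)) = (\<lambda>t. 0)" using P_kill unfolding kills_trace_def by blast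
  moreover have "tr \<Omega> (P (\<lambda>x. u x - f x)) = tr \<Omega> (\<lambda>x. P u x - P f x)"
    using ae_linear_operator_diff[OF P V_scale u fV] u fV
    by (intro tr_cong PV V_diff)
  ultimately have "(\<lambda>t. tr \<Omega> (P u) t - tr \<Omega> (P f) t) = (\<lambda>t. 0)"
    using tr_diff[OF PV[OF u] PV[OF fV]] by simp
  moreover have "tr \<Omega> (P f) = tr \<Omega> f"
    using P_tr f fV unfolding preserves_trace_def trace_in_def by blast
  ultimately have Pu: "tr \<Omega> (P u) = tr \<Omega> f" by (simp add: fun_eq_iff)
  have r: "(\<lambda>y. u y - P u y) \<in> V \<Omega>" by (intro V_diff u PV)
  have "tr \<Omega> (\<lambda>y. u y - P u y) = tr \<Omega> w" using tr_diff[OF u PV[OF u]] tu Pu by simp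
  then have "(\<lambda>y. u y - P u y) \<in> trace_in (tr \<Omega>) (V \<Omega>) W" using r w by (auto simp: trace_in_def)
  then have "tr \<Omega> (Q (\<lambda>y. u y - P u y)) = tr \<Omega> w"
    using Q_tr \<open>tr \<Omega> (\<lambda>y. u y - P u y) = tr \<Omega> w\<close> unfolding preserves_trace_def by metis
  then show "tr \<Omega> (combine P Q u) = tr \<Omega> u"
    using tr_combine[of P u Q, OF PV[OF u] QV[OF r]] Pu tu by simp
qed

lemma vanishes_inside_combine:
  assumes P: "\<And>u. u \<in> V \<Omega> \<Longrightarrow> P u \<in> V \<Omega>"
    and "vanishes_inside \<Omega> \<T> l (V \<Omega>) P" "vanishes_inside \<Omega> \<T> l (V \<Omega>) Q"
  shows "vanishes_inside \<Omega> \<T> l (V \<Omega>) (combine P Q)"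
  unfolding vanishes_inside_def
proof (intro ballI)
  fix u \<tau> assume u: "u \<in> V \<Omega>" and \<tau>: "\<tau> \<in> \<T> - boundary_cells \<Omega> \<T> l"
  have "(\<lambda>y. u y - P u y) \<in> V \<Omega>" by (intro V_diff u P)
  then have "ae_eq \<tau> (\<lambda>x. P u x + Q (\<lambda>y. u y - P u y) x) (\<lambda>x. 0 + 0)"
    using assms(2,3) u \<tau> unfolding vanishes_inside_def by (intro ae_eq_add) blast+
  then show "ae_eq \<tau> (combine P Q u) (\<lambda>x. 0)" by (simp add: combine_def[abs_def])
qed

end

text \<open>X is the first derivative and Y the next one. Weak derivatives are defined by duality,
  so the test operators compose in the opposite order.\<close>

locale weak_complex =
  X: weak_derivative_on T T' s \<Omega> + Y: weak_derivative_on U U' t \<Omega>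
  for T :: "3 \<Rightarrow> 'b::euclidean_space \<Rightarrow> 'a::euclidean_space" and T' s \<Omega>
    and U :: "3 \<Rightarrow> 'c::euclidean_space \<Rightarrow> 'b" and U' t +
  assumes D_D: "smooth_field \<psi> \<Longrightarrow> X.D (Y.D \<psi>) x = 0"
begin

text \<open>Testing the derivative of u with \<open>Y.D \<psi>\<close> amounts, up to sign, to
  testing u with \<open>X.D (Y.D \<psi>)\<close>, which is 0. So the next weak derivative exists and
  is 0.\<close>

lemma wd_V:
  assumes u: "u \<in> X.V \<Omega>"
  shows "X.wd \<Omega> u \<in> Y.V \<Omega>"
proof -
  have "Y.is_wd \<Omega> (X.wd \<Omega> u) (\<lambda>x. 0)"
    unfolding Y.is_wd_def
  proof (intro allI impI)
    fix \<psi> :: "R3 \<Rightarrow> 'c" assume \<psi>: "smooth_field \<psi> \<and> supported_in \<Omega> \<psi>"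
    then have "integral\<^sup>L (lebesgue_on \<Omega>) (\<lambda>x. u x \<bullet> X.D (Y.D \<psi>) x)
        = s * integral\<^sup>L (lebesgue_on \<Omega>) (\<lambda>x. X.wd \<Omega> u x \<bullet> Y.D \<psi> x)"
      using X.is_wd_wd[OF u] Y.smooth_field_D Y.supported_in_D unfolding X.is_wd_def by blast
    with \<psi> X.sign show "integral\<^sup>L (lebesgue_on \<Omega>) (\<lambda>x. X.wd \<Omega> u x \<bullet> Y.D \<psi> x)
        = t * integral\<^sup>L (lebesgue_on \<Omega>) (\<lambda>x. 0 \<bullet> \<psi> x)"
      by (auto simp: D_D)
  qed
  moreover have "(\<lambda>x. 0 :: 'c) \<in> L2 \<Omega>" by (simp add: L2_def)
  ultimately show ?thesis using X.wd_L2[OF u] by (auto simp: Y.V_def)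
qed

lemma commutes_on_trace_combine:
  assumes W: "W0 \<subseteq> X.V \<Omega>" "W \<subseteq> X.V \<Omega>" "W0' \<subseteq> Y.V \<Omega>" "W' \<subseteq> Y.V \<Omega>" "(\<lambda>x. 0) \<in> W'"
    and P: "ae_linear_operator \<Omega> (X.V \<Omega>) W0 P" and Q: "ae_linear_operator \<Omega> (X.V \<Omega>) W Q"
    and P': "ae_linear_operator \<Omega> (Y.V \<Omega>) W0' P'" and Q': "ae_linear_operator \<Omega> (Y.V \<Omega>) W' Q'"
    and Q'_tr: "preserves_trace (Y.tr \<Omega>) (trace_in (Y.tr \<Omega>) (Y.V \<Omega>) W') Q'"
    and cP: "commutes_on_trace (Y.tr \<Omega>) (X.wd \<Omega>) (X.V \<Omega>) P P'"
    and cQ: "commutes_on_trace (Y.tr \<Omega>) (X.wd \<Omega>) (X.V \<Omega>) Q Q'"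
  shows "commutes_on_trace (Y.tr \<Omega>) (X.wd \<Omega>) (X.V \<Omega>) (combine P Q) (combine P' Q')"
  unfolding commutes_on_trace_def
proof
  have PV: "P v \<in> X.V \<Omega>" and QV: "Q v \<in> X.V \<Omega>" if "v \<in> X.V \<Omega>" for v
    using that P Q W unfolding ae_linear_operator_def by blast+
  have P'V: "P' v \<in> Y.V \<Omega>" and Q'V: "Q' v \<in> Y.V \<Omega>" if "v \<in> Y.V \<Omega>" for v
    using that P' Q' W unfolding ae_linear_operator_def by blast+
  let ?t = "Y.tr \<Omega>" and ?d = "X.wd \<Omega>"
  fix u assume u: "u \<in> X.V \<Omega>"
  note Pu = PV[OF u] and du = wd_V[OF u]
  note dPu = wd_V[OF Pu] and P'du = P'V[OF du]
  \<comment> \<open>This commutator may be nonzero inside \<Omega>, and \<open>Q'\<close> acts on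
    fields rather than on traces. It is harmless because its zero trace is the trace of a member of
    \<open>W'\<close>, namely 0.\<close>
  define e where "e = (\<lambda>x. P' (?d u) x - ?d (P u) x)"
  have e: "e \<in> Y.V \<Omega>" unfolding e_def by (intro Y.V_diff P'du dPu)
  have tP: "?t (P' (?d v)) = ?t (?d (P v))" and tQ: "?t (Q' (?d v)) = ?t (?d (Q v))"
    if "v \<in> X.V \<Omega>" for v using that cP cQ unfolding commutes_on_trace_def by blast+
  have "?t e = (\<lambda>\<psi>. 0)" unfolding e_def using Y.tr_diff[OF P'du dPu] tP[OF u] by simp
  moreover have "?t (\<lambda>x. 0) = (\<lambda>\<psi>. 0)"
    using Y.tr_diff[OF du du] by simp
  ultimately have "e \<in> trace_in ?t (Y.V \<Omega>) W'" using e W(5) unfolding trace_in_def by force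
  then have te: "?t (Q' e) = (\<lambda>\<psi>. 0)"
    using Q'_tr \<open>?t e = _\<close> unfolding preserves_trace_def by metis
  \<comment> \<open>The mixed term follows from \<open>Q' e\<close> by linearity and from the
    commutation of \<open>Q\<close> applied to the field \<open>P u\<close>.\<close>
  have tQ'P': "?t (Q' (P' (?d u))) = ?t (?d (Q (P u)))"
  proof -
    have "?t (Q' e) = ?t (\<lambda>x. Q' (P' (?d u)) x - Q' (?d (P u)) x)"
      unfolding e_def
      by (intro Y.tr_cong ae_linear_operator_diff[OF Q' Y.V_scale] Q'V Y.V_diff P'du dPu)
    then show ?thesis
      using Y.tr_diff[OF Q'V[OF P'du] Q'V[OF dPu]] te tQ[OF Pu] by (simp add: fun_eq_iff)
  qed
  have r': "(\<lambda>x. ?d u x - P' (?d u) x) \<in> Y.V \<Omega>" by (intro Y.V_diff du P'du)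
  have "?t (Q' (\<lambda>x. ?d u x - P' (?d u) x)) = ?t (\<lambda>x. Q' (?d u) x - Q' (P' (?d u)) x)"
    by (intro Y.tr_cong ae_linear_operator_diff[OF Q' Y.V_scale] Q'V Y.V_diff du P'du)
  also have "\<dots> = (\<lambda>\<psi>. ?t (?d (Q u)) \<psi> - ?t (?d (Q (P u))) \<psi>)"
    using Y.tr_diff[OF Q'V[OF du] Q'V[OF P'du]] tQ[OF u] tQ'P' by simp
  finally have L: "?t (combine P' Q' (?d u)) =
      (\<lambda>\<psi>. ?t (?d (P u)) \<psi> + (?t (?d (Q u)) \<psi> - ?t (?d (Q (P u))) \<psi>))"
    using Y.tr_combine[of P' "?d u" Q', OF P'du Q'V[OF r']] tP[OF u] by simp
  have r: "(\<lambda>x. u x - P u x) \<in> X.V \<Omega>" by (intro X.V_diff u Pu)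
  note Qr = QV[OF r] and Qu = QV[OF u] and QPu = QV[OF Pu]
  have "ae_eq \<Omega> (combine P Q u) (\<lambda>x. P u x + (Q u x - Q (P u) x))"
    unfolding combine_def
    by (intro ae_eq_add ae_eq_refl ae_linear_operator_diff[OF Q X.V_scale] u Pu)
  then have "?d (combine P Q u) = ?d (\<lambda>x. P u x + (Q u x - Q (P u) x))"
    unfolding combine_def using Pu Qr Qu QPu by (intro X.wd_cong X.V_L2 X.V_add X.V_diff)
  then have "?t (?d (combine P Q u)) = ?t (?d (\<lambda>x. P u x + (Q u x - Q (P u) x)))" by simp
  also have "\<dots> = ?t (\<lambda>x. ?d (P u) x + (?d (Q u) x - ?d (Q (P u)) x))"
  proof (rule Y.tr_cong)
    show "ae_eq \<Omega> (?d (\<lambda>x. P u x + (Q u x - Q (P u) x)))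
      (\<lambda>x. ?d (P u) x + (?d (Q u) x - ?d (Q (P u)) x))"
      using X.wd_add[OF Pu X.V_diff[OF Qu QPu]] ae_eq_add[OF ae_eq_refl X.wd_diff[OF Qu QPu]]
      by (rule ae_eq_trans)
  qed (intro wd_V X.V_add X.V_diff Y.V_add Y.V_diff Pu Qu QPu)+
  also have "\<dots> = (\<lambda>\<psi>. ?t (?d (P u)) \<psi> + (?t (?d (Q u)) \<psi> - ?t (?d (Q (P u))) \<psi>))"
    using Y.tr_add[OF dPu Y.V_diff[OF wd_V[OF Qu] wd_V[OF QPu]]] Y.tr_diff[OF wd_V[OF Qu] wd_V[OF QPu]]
    by simp
  finally show "?t (combine P' Q' (?d u)) = ?t (?d (combine P Q u))" using L by simp
qed

end

section \<open>The inverse inequality\<close>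

lemma L2_iff_restrict:
  assumes "S \<in> sets lebesgue"
  shows "u \<in> L2 S \<longleftrightarrow> (\<lambda>x. if x \<in> S then u x else 0) \<in> borel_measurable lebesgue \<and>
    integrable lebesgue (\<lambda>x. if x \<in> S then (norm (u x))\<^sup>2 else 0)"
  using assms by (simp add: L2_def borel_measurable_if Lebesgue_Measure.integrable_restrict_UNIV)

text \<open>Lebesgue measure is complete, so the values of u on the null set T - S affect neither
  measurability nor the integral.\<close>

lemma L2_subset_null:
  assumes u: "u \<in> L2 S" and S: "S \<in> sets lebesgue" and T: "T \<in> sets lebesgue" and null: "negligible (T - S)"
  shows "u \<in> L2 T"
proof -
  have AE: "AE x in lebesgue. x \<notin> T - S"
    using null by (intro AE_not_in) (simp add: negligible_iff_null_sets)
  have uS: "(\<lambda>x. if x \<in> S then u x else 0) \<in> borel_measurable lebesgue"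
    "integrable lebesgue (\<lambda>x. if x \<in> S then (norm (u x))\<^sup>2 else 0)"
    using u S by (simp_all add: L2_iff_restrict)
  have m: "(\<lambda>x. indicator T x *\<^sub>R (if x \<in> S then u x else 0)) \<in> borel_measurable lebesgue"
    using uS(1) T by (intro borel_measurable_scaleR borel_measurable_indicator)
  have m': "(\<lambda>x. if x \<in> T then u x else 0) \<in> borel_measurable lebesgue"
    by (rule borel_measurable_AE[OF m]) (use AE in \<open>rule eventually_mono, auto simp: indicator_def\<close>)
  have i: "integrable lebesgue (\<lambda>x. indicator T x *\<^sub>R (if x \<in> S then (norm (u x))\<^sup>2 else 0))"
    using uS(2) T by (intro integrable_mult_indicator)
  have "(\<lambda>x. (norm (if x \<in> T then u x else 0))\<^sup>2) \<in> borel_measurable lebesgue"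
    using m' by measurable
  also have "(\<lambda>x. (norm (if x \<in> T then u x else 0))\<^sup>2) = (\<lambda>x. if x \<in> T then (norm (u x))\<^sup>2 else 0)"
    by auto
  finally have m'': "(\<lambda>x. if x \<in> T then (norm (u x))\<^sup>2 else 0) \<in> borel_measurable lebesgue" .
  have "integrable lebesgue (\<lambda>x. if x \<in> T then (norm (u x))\<^sup>2 else 0)"
  proof (rule integrable_cong_AE_imp[OF i m''])
    show "AE x in lebesgue. indicator T x *\<^sub>R (if x \<in> S then (norm (u x))\<^sup>2 else 0) =
        (if x \<in> T then (norm (u x))\<^sup>2 else 0)"
      using AE by (rule eventually_mono) (auto simp: indicator_def)
  qed
  with m' T show ?thesis by (simp add: L2_iff_restrict)
qed

lemma L2_subset: "u \<in> L2 T \<Longrightarrow> S \<subseteq> T \<Longrightarrow> S \<in> sets lebesgue \<Longrightarrow> T \<in> sets lebesgue \<Longrightarrow> u \<in> L2 S"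
  by (erule L2_subset_null) (auto simp: Diff_eq_empty_iff[THEN iffD2])

lemma L2_norm_nonneg [simp]: "0 \<le> L2_norm S u"
  by (simp add: L2_norm_def)

lemma L2_norm_power2: "(L2_norm S u)\<^sup>2 = integral\<^sup>L (lebesgue_on S) (\<lambda>x. (norm (u x))\<^sup>2)"
  by (simp add: L2_norm_def)

lemma L2_norm_cong:
  assumes "ae_eq S u v" "u \<in> L2 S" "v \<in> L2 S"
  shows "L2_norm S u = L2_norm S v"
proof -
  have "integral\<^sup>L (lebesgue_on S) (\<lambda>x. (norm (u x))\<^sup>2) = integral\<^sup>L (lebesgue_on S) (\<lambda>x. (norm (v x))\<^sup>2)"
  proof (rule integral_cong_AE)
    show "AE x in lebesgue_on S. (norm (u x))\<^sup>2 = (norm (v x))\<^sup>2"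
      using assms(1) unfolding ae_eq_def by (rule eventually_mono) simp
  qed (use assms L2_square_integrable in blast)+
  then show ?thesis by (simp add: L2_norm_def)
qed

lemma L2_norm_zero:
  assumes "ae_eq S u (\<lambda>x. 0)" "u \<in> L2 S"
  shows "L2_norm S u = 0"
  using L2_norm_cong[OF assms] by (simp add: L2_def L2_norm_def)

text \<open>The sets may overlap: each point of S is counted at least once on the right.\<close>

lemma L2_norm_power2_le_sum:
  assumes F: "finite F" "\<And>A. A \<in> F \<Longrightarrow> A \<in> sets lebesgue" and S: "S \<in> sets lebesgue" "S \<subseteq> \<Union>F"
    and u: "u \<in> L2 (\<Union>F)"
  shows "(L2_norm S u)\<^sup>2 \<le> (\<Sum>A\<in>F. (L2_norm A u)\<^sup>2)"
proof -
  have UF: "\<Union>F \<in> sets lebesgue" using F by (intro sets.finite_Union) auto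
  have uA: "u \<in> L2 A" if "A \<in> F" for A using that F by (intro L2_subset[OF u _ _ UF]) auto
  have uS: "u \<in> L2 S" by (rule L2_subset[OF u S(2,1) UF])
  have eq: "(L2_norm A u)\<^sup>2 = integral\<^sup>L lebesgue (\<lambda>x. if x \<in> A then (norm (u x))\<^sup>2 else 0)"
    if "A \<in> sets lebesgue" for A
    using that by (simp add: L2_norm_power2 Lebesgue_Measure.integral_restrict_UNIV)
  have i: "integrable lebesgue (\<lambda>x. if x \<in> A then (norm (u x))\<^sup>2 else 0)" if "u \<in> L2 A" "A \<in> sets lebesgue" for A
    using that by (simp add: L2_iff_restrict)
  have "(L2_norm S u)\<^sup>2 \<le> integral\<^sup>L lebesgue (\<lambda>x. \<Sum>A\<in>F. if x \<in> A then (norm (u x))\<^sup>2 else 0)"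
    unfolding eq[OF S(1)]
  proof (rule integral_mono)
    show "integrable lebesgue (\<lambda>x. \<Sum>A\<in>F. if x \<in> A then (norm (u x))\<^sup>2 else 0)"
      by (intro Bochner_Integration.integrable_sum i uA F)
    show "(if x \<in> S then (norm (u x))\<^sup>2 else 0) \<le> (\<Sum>A\<in>F. if x \<in> A then (norm (u x))\<^sup>2 else 0)" for x
    proof (cases "x \<in> S")
      case True
      then obtain A where A: "A \<in> F" "x \<in> A" using S(2) by blast
      then have "(if x \<in> A then (norm (u x))\<^sup>2 else 0) \<le> (\<Sum>A\<in>F. if x \<in> A then (norm (u x))\<^sup>2 else 0)"
        using F(1) by (intro member_le_sum) auto
      with A True show ?thesis by simp
    qed (simp add: sum_nonneg)
  qed (rule i[OF uS S(1)])
  also have "\<dots> = (\<Sum>A\<in>F. (L2_norm A u)\<^sup>2)"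
    using F uA by (subst Bochner_Integration.integral_sum) (auto intro!: i simp: eq)
  finally show ?thesis .
qed

lemma L2_norm_le_sum:
  assumes "finite F" "\<And>A. A \<in> F \<Longrightarrow> A \<in> sets lebesgue" "S \<in> sets lebesgue" "S \<subseteq> \<Union>F" "u \<in> L2 (\<Union>F)"
  shows "L2_norm S u \<le> (\<Sum>A\<in>F. L2_norm A u)"
proof -
  have "L2_norm S u \<le> L2_set (\<lambda>A. L2_norm A u) F"
    using L2_norm_power2_le_sum[OF assms] by (simp add: L2_set_def real_le_rsqrt)
  also have "\<dots> \<le> (\<Sum>A\<in>F. L2_norm A u)" by (rule L2_set_le_sum) simp
  finally show ?thesis .
qed

lemma L2_norm_mono:
  assumes "S \<subseteq> T" "u \<in> L2 T" "S \<in> sets lebesgue" "T \<in> sets lebesgue"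
  shows "L2_norm S u \<le> L2_norm T u"
  using L2_norm_le_sum[of "{T}" S u] assms by simp

text \<open>A triangle inequality with the factor 2 follows from the pointwise estimate of squares
  alone; the constants absorb the factor.\<close>

lemma L2_norm_add_le:
  assumes "u \<in> L2 S" "v \<in> L2 S"
  shows "L2_norm S (\<lambda>x. u x + v x) \<le> 2 * (L2_norm S u + L2_norm S v)"
proof (rule power2_le_imp_le)
  have "(L2_norm S (\<lambda>x. u x + v x))\<^sup>2
      \<le> integral\<^sup>L (lebesgue_on S) (\<lambda>x. 2 * (norm (u x))\<^sup>2 + 2 * (norm (v x))\<^sup>2)"
    unfolding L2_norm_power2
    using L2_add[OF assms] assms
    by (intro integral_mono Bochner_Integration.integrable_add Bochner_Integration.integrable_mult_right
        power2_norm_add_le) (simp_all add: L2_square_integrable)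
  also have "\<dots> = 2 * (L2_norm S u)\<^sup>2 + 2 * (L2_norm S v)\<^sup>2"
    using assms by (simp add: L2_norm_power2 L2_square_integrable)
  also have "\<dots> \<le> (2 * (L2_norm S u + L2_norm S v))\<^sup>2"
  proof -
    have "0 \<le> L2_norm S u * L2_norm S v" by simp
    then show ?thesis
      using zero_le_power2[of "L2_norm S u"] zero_le_power2[of "L2_norm S v"]
      by (simp add: power2_eq_square algebra_simps)
  qed
  finally show "(L2_norm S (\<lambda>x. u x + v x))\<^sup>2 \<le> (2 * (L2_norm S u + L2_norm S v))\<^sup>2" .
qed simp

lemma L2_norm_diff_le:
  assumes "u \<in> L2 S" "v \<in> L2 S"
  shows "L2_norm S (\<lambda>x. u x - v x) \<le> 2 * (L2_norm S u + L2_norm S v)"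
  using L2_norm_add_le[of u S "\<lambda>x. - v x"] L2_lincomb[OF assms(2) assms(2), of "-1" 0] assms
  by (simp add: L2_norm_def)

lemma continuous_L2:
  fixes F :: "R3 \<Rightarrow> 'b::euclidean_space"
  assumes S: "bounded S" "S \<in> sets lebesgue" and F: "continuous_on UNIV F"
  shows "F \<in> L2 S"
proof -
  have "(\<lambda>x. 1 :: real) \<in> L2 S"
  proof -
    interpret finite_measure "lebesgue_on S"
      using S by (intro finite_measure_lebesgue_on bounded_set_imp_lmeasurable)
    show ?thesis by (simp add: L2_def)
  qed
  moreover have "continuous_on UNIV (\<lambda>x. (norm (F x))\<^sup>2)" using F by (intro continuous_intros)
  ultimately have "integrable (lebesgue_on S) (\<lambda>x. 1 \<bullet> (norm (F x))\<^sup>2)"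
    by (rule integrable_inner_continuous[OF S])
  then show ?thesis using continuous_measurable_lebesgue_on[OF F] by (simp add: L2_def)
qed

section \<open>Affine fields on a cell\<close>

definition affine_field :: "(R3 \<Rightarrow> 'a::real_vector) \<Rightarrow> bool" where
  "affine_field q \<longleftrightarrow> (\<exists>q0 A. linear A \<and> q = (\<lambda>x. q0 + A x))"

lemma integral_ball_translate:
  fixes f :: "R3 \<Rightarrow> real"
  assumes f: "continuous_on UNIV f"
  shows "integral\<^sup>L (lebesgue_on (ball x r)) (\<lambda>y. f (y + a)) = integral\<^sup>L (lebesgue_on (ball (x + a) r)) f"
proof -
  have m: "f \<in> borel_measurable borel" using f by (rule borel_measurable_continuous_onI)
  have m': "(\<lambda>y. f (y + a)) \<in> borel_measurable borel"
    by (intro borel_measurable_continuous_onI continuous_on_compose2[OF f] continuous_intros) auto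
  have restrict: "integral\<^sup>L (lebesgue_on (ball z r)) g = integral\<^sup>L lborel (\<lambda>y. indicator (ball z r) y * g y)"
    if g: "g \<in> borel_measurable borel" for g :: "R3 \<Rightarrow> real" and z
  proof -
    have "integral\<^sup>L (lebesgue_on (ball z r)) g = integral\<^sup>L lebesgue (\<lambda>y. indicator (ball z r) y * g y)"
      by (subst integral_restrict_space) auto
    also have "\<dots> = integral\<^sup>L lborel (\<lambda>y. indicator (ball z r) y * g y)"
      using g by (intro integral_completion borel_measurable_times borel_measurable_indicator) auto
    finally show ?thesis .
  qed
  have "integral\<^sup>L (lebesgue_on (ball (x + a) r)) f
      = integral\<^sup>L (distr lborel borel ((+) a)) (\<lambda>y. indicator (ball (x + a) r) y * f y)"
    by (simp add: restrict[OF m] lborel_distr_plus)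
  also have "\<dots> = integral\<^sup>L lborel (\<lambda>y. indicator (ball (x + a) r) (a + y) * f (a + y))"
    using m by (intro integral_distr borel_measurable_times borel_measurable_indicator) auto
  also have "(\<lambda>y. indicator (ball (x + a) r) (a + y) * f (a + y)) = (\<lambda>y. indicator (ball x r) y * f (y + a))"
    by (auto simp: indicator_def dist_norm fun_eq_iff add.commute)
  also have "integral\<^sup>L lborel \<dots> = integral\<^sup>L (lebesgue_on (ball x r)) (\<lambda>y. f (y + a))"
    by (rule restrict[OF m', symmetric])
  finally show ?thesis by simp
qed

text \<open>On a ball of half the radius the increment of an affine field is constant, and it is the
  difference of two values taken in the large ball.\<close>

lemma affine_inverse_estimate:
  fixes A :: "R3 \<Rightarrow> 'a::euclidean_space"
  assumes A: "linear A" and e: "norm e = 1" and \<tau>: "compact \<tau>" "convex \<tau>"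
    and r: "0 < r" "cball x r \<subseteq> \<tau>" and h: "diameter \<tau> \<le> 4 * \<rho> * r" "0 < diameter \<tau>" and \<rho>: "1 \<le> \<rho>"
  shows "norm (A e) * sqrt (measure lebesgue \<tau>) \<le> 512 * \<rho> ^ 3 / diameter \<tau> * L2_norm \<tau> (\<lambda>x. q0 + A x)"
proof -
  define q where "q = (\<lambda>x. q0 + A x)"
  let ?h = "diameter \<tau>" and ?B = "ball x (r / 2)" and ?f = "\<lambda>x. (norm (q x))\<^sup>2"
  \<comment> \<open>Of length r / 2, so that the translate of \<open>?B\<close> still lies in the
    ball of radius r.\<close>
  define a where "a = (r / 2) *\<^sub>R e"
  have contA: "continuous_on UNIV A" by (rule linear_continuous_on[OF A[unfolded linear_conv_bounded_linear]])
  then have contq: "continuous_on UNIV q" unfolding q_def by (intro continuous_intros)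
  then have contf: "continuous_on UNIV ?f" by (intro continuous_intros)
  have st: "\<tau> \<in> sets lebesgue" "bounded \<tau>" using \<tau>(1) by (auto simp: compact_imp_bounded compact_imp_closed)
  have i\<tau>: "q \<in> L2 \<tau>" by (rule continuous_L2[OF st(2,1) contq])
  have sub: "ball (x + a) (r / 2) \<subseteq> \<tau>" "?B \<subseteq> \<tau>"
  proof -
    have "norm a = r / 2" using e r by (simp add: a_def)
    then have "ball (x + a) (r / 2) \<subseteq> cball x r"
      by (intro order_trans[OF ball_subset_cball]) (simp add: cball_subset_cball_iff dist_norm)
    then show "ball (x + a) (r / 2) \<subseteq> \<tau>" using r(2) by blast
    have "?B \<subseteq> cball x r" using r(1) by auto
    then show "?B \<subseteq> \<tau>" using r(2) by blast
  qed
  have le: "integral\<^sup>L (lebesgue_on S) ?f \<le> (L2_norm \<tau> q)\<^sup>2" if "S \<subseteq> \<tau>" "S \<in> sets lebesgue" for S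
    using L2_norm_mono[OF that(1) i\<tau> that(2) st(1)] by (simp flip: L2_norm_power2 add: power_mono)
  have L2B: "q \<in> L2 ?B" "(\<lambda>y. q (y + a)) \<in> L2 ?B"
    using contq by (auto intro!: continuous_L2 continuous_on_compose2[OF contq] continuous_intros)
  have "(norm (A a))\<^sup>2 * measure lebesgue ?B = integral\<^sup>L (lebesgue_on ?B) (\<lambda>y. (norm (q (y + a) - q y))\<^sup>2)"
    by (simp add: q_def linear_add[OF A] measure_restrict_space)
  also have "\<dots> \<le> integral\<^sup>L (lebesgue_on ?B) (\<lambda>y. 2 * (norm (q (y + a)))\<^sup>2 + 2 * (norm (q y))\<^sup>2)"
  proof (rule integral_mono)
    show "(norm (q (y + a) - q y))\<^sup>2 \<le> 2 * (norm (q (y + a)))\<^sup>2 + 2 * (norm (q y))\<^sup>2" for y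
      using power2_norm_add_le[of "q (y + a)" "- q y"] by simp
    show "integrable (lebesgue_on ?B) (\<lambda>y. (norm (q (y + a) - q y))\<^sup>2)"
      by (rule L2_square_integrable[OF L2_diff[OF L2B(2,1)]])
    show "integrable (lebesgue_on ?B) (\<lambda>y. 2 * (norm (q (y + a)))\<^sup>2 + 2 * (norm (q y))\<^sup>2)"
      using L2B by (intro Bochner_Integration.integrable_add Bochner_Integration.integrable_mult_right
          L2_square_integrable)
  qed
  also have "\<dots> = 2 * integral\<^sup>L (lebesgue_on ?B) (\<lambda>y. ?f (y + a)) + 2 * integral\<^sup>L (lebesgue_on ?B) ?f"
    using L2_square_integrable[OF L2B(1)] L2_square_integrable[OF L2B(2)] by simp
  also have "\<dots> \<le> 2 * (L2_norm \<tau> q)\<^sup>2 + 2 * (L2_norm \<tau> q)\<^sup>2"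
    unfolding integral_ball_translate[OF contf]
    by (intro add_mono mult_left_mono le sub) auto
  finally have 1: "(norm (A a))\<^sup>2 * measure lebesgue ?B \<le> 4 * (L2_norm \<tau> q)\<^sup>2" by simp
  have nA: "(norm (A a))\<^sup>2 = r\<^sup>2 / 4 * (norm (A e))\<^sup>2"
    using r(1) by (simp add: a_def linear_scale[OF A] power_mult_distrib power_divide)
  \<comment> \<open>The cell lies in a ball of radius at most 4 \<rho> r, which has (8 \<rho>) ^ 3 =
    512 \<rho> ^ 3 times the volume of \<open>?B\<close>.\<close>
  have "\<tau> \<subseteq> cball x ?h"
    using diameter_bounded_bound[OF st(2)] r centre_in_cball[of x r] by (auto simp: subset_iff)
  then have "measure lebesgue \<tau> \<le> measure lebesgue (cball x ?h)"
    using st(1) by (intro measure_mono_fmeasurable) auto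
  also have "\<dots> = unit_ball_vol 3 * ?h ^ 3" using h(2) by (simp add: content_cball)
  also have "\<dots> \<le> unit_ball_vol 3 * (4 * \<rho> * r) ^ 3"
    using h by (intro mult_left_mono power_mono) auto
  also have "\<dots> = 512 * \<rho> ^ 3 * measure lebesgue ?B"
    using r(1) by (simp add: content_ball power_mult_distrib power_divide)
  finally have 2: "measure lebesgue \<tau> \<le> 512 * \<rho> ^ 3 * measure lebesgue ?B" .
  have hr: "?h\<^sup>2 \<le> 16 * \<rho>\<^sup>2 * r\<^sup>2"
    using power_mono[OF h(1), of 2] h(2) by (simp add: power_mult_distrib)
  have "?h\<^sup>2 * ((norm (A e))\<^sup>2 * measure lebesgue \<tau>)
      \<le> (16 * \<rho>\<^sup>2 * r\<^sup>2) * ((norm (A e))\<^sup>2 * (512 * \<rho> ^ 3 * measure lebesgue ?B))"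
    by (intro mult_mono hr 2) (use \<rho> in auto)
  also have "\<dots> = 32768 * \<rho> ^ 5 * ((norm (A a))\<^sup>2 * measure lebesgue ?B)"
    unfolding nA by (simp add: power_numeral_reduce)
  also have "\<dots> \<le> 32768 * \<rho> ^ 5 * (4 * (L2_norm \<tau> q)\<^sup>2)"
    by (intro mult_left_mono 1) (use \<rho> in auto)
  \<comment> \<open>The product of the constants is 131072 \<rho> ^ 5; as \<rho> \<ge> 1, it can be
    rounded up to 262144 \<rho> ^ 6, the square of 512 \<rho> ^ 3.\<close>
  also have "\<dots> \<le> (512 * \<rho> ^ 3 * L2_norm \<tau> q)\<^sup>2"
  proof -
    have "\<rho> ^ 5 \<le> \<rho> ^ 6" using \<rho> by (intro power_increasing) auto
    then have "131072 * \<rho> ^ 5 * (L2_norm \<tau> q)\<^sup>2 \<le> 262144 * \<rho> ^ 6 * (L2_norm \<tau> q)\<^sup>2"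
      using \<rho> by (intro mult_right_mono mult_mono) auto
    then show ?thesis by (simp add: power_mult_distrib flip: power_mult)
  qed
  finally have "(?h * (norm (A e) * sqrt (measure lebesgue \<tau>)))\<^sup>2 \<le> (512 * \<rho> ^ 3 * L2_norm \<tau> q)\<^sup>2"
    by (simp add: power_mult_distrib)
  then have "?h * (norm (A e) * sqrt (measure lebesgue \<tau>)) \<le> 512 * \<rho> ^ 3 * L2_norm \<tau> q"
    by (rule power2_le_imp_le) (use \<rho> in auto)
  then show ?thesis using h(2) unfolding q_def by (simp add: field_simps)
qed

lemma integral_restrict_support:
  fixes f :: "R3 \<Rightarrow> real"
  assumes "S \<subseteq> T" "S \<in> sets lebesgue" "T \<in> sets lebesgue" "\<And>x. x \<notin> S \<Longrightarrow> f x = 0"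
  shows "integral\<^sup>L (lebesgue_on T) f = integral\<^sup>L (lebesgue_on S) f"
proof -
  have "f = (\<lambda>x. if x \<in> S then f x else 0)" using assms(4) by auto
  then show ?thesis using Lebesgue_Measure.integral_restrict[OF assms(1-3), of f] by simp
qed

context weak_derivative_on
begin

text \<open>Integration by parts against test fields supported in S, where v can be replaced by the
  affine field with its constant derivative. Since s * s = 1, the sign s can be moved to the other
  side.\<close>

lemma wd_affine:
  assumes v: "v \<in> V \<Omega>" and S: "open S" "S \<subseteq> \<Omega>" and A: "linear A" and vq: "ae_eq S v (\<lambda>x. q0 + A x)"
  shows "ae_eq S (wd \<Omega> v) (\<lambda>x. - s *\<^sub>R (\<Sum>i\<in>UNIV. T' i (A (axis i 1))))"
proof -
  define q where "q = (\<lambda>x. q0 + A x)"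
  define c where "c = (\<Sum>i\<in>UNIV. T' i (A (axis i 1)))"
  have Sl: "S \<in> sets lebesgue" using S by auto
  have contA: "continuous_on UNIV A" by (rule linear_continuous_on[OF A[unfolded linear_conv_bounded_linear]])
  then have contq: "continuous_on UNIV q" unfolding q_def by (intro continuous_intros)
  have qL: "q \<in> L2 \<Omega>" by (rule continuous_L2[OF bounded_\<Omega> sets_\<Omega> contq])
  have cL: "(\<lambda>x. c) \<in> L2 \<Omega>" by (rule continuous_L2[OF bounded_\<Omega> sets_\<Omega>]) simp
  have "ae_eq S (\<lambda>x. wd \<Omega> v x + s *\<^sub>R c) (\<lambda>x. 0)"
  proof (rule du_Bois_Reymond[OF S(1)])
    have wcL: "(\<lambda>x. wd \<Omega> v x + s *\<^sub>R c) \<in> L2 \<Omega>"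
      using L2_lincomb[OF wd_L2[OF v] cL, of 1 s] by simp
    then show "integrable (lebesgue_on S) (\<lambda>x. wd \<Omega> v x + s *\<^sub>R c)"
      by (intro integrable_lebesgue_on_subset[OF integrable_L2[OF lmeasurable_\<Omega>]] S Sl sets_\<Omega>)
    fix \<psi> :: "R3 \<Rightarrow> 'b" assume \<psi>: "smooth_field \<psi>" "supported_in S \<psi>"
    then have \<psi>\<Omega>: "supported_in \<Omega> \<psi>" using S(2) unfolding supported_in_def by blast
    let ?K = "closure {x. \<psi> x \<noteq> 0}"
    have K: "compact ?K" "?K \<subseteq> S" using \<psi>(2) by (auto simp: supported_in_def)
    have \<psi>0: "\<psi> x = 0" if "x \<notin> ?K" for x using that closure_subset[of "{x. \<psi> x \<noteq> 0}"] by blast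
    have D0: "D \<psi> x = 0" if "x \<notin> S" for x using D_outside[of x \<psi>] that K(2) by blast
    have Ti: "bounded_linear (T i)" for i using linear_T by (simp add: linear_conv_bounded_linear)
    have contT: "continuous_on UNIV (\<lambda>x. T i (frechet_derivative \<psi> (at x) (axis i 1)))" for i
      by (subst continuous_on_componentwise)
        (intro ballI smooth_continuous smooth_inner_linear_pd \<psi>(1) linear_T)
    have cont\<psi>: "continuous_on UNIV \<psi>" by (rule continuous_on_smooth_field[OF \<psi>(1)])
    have contT\<psi>: "continuous_on UNIV (\<lambda>x. T i (\<psi> x))" for i
      by (rule bounded_linear.continuous_on[OF Ti cont\<psi>])
    \<comment> \<open>The integrand is the derivative in direction i of the inner product of q and T
      i \<psi>, a function of compact support.\<close>
    have zero: "integral\<^sup>L (lebesgue_on \<Omega>) (\<lambda>x. A (axis i 1) \<bullet> T i (\<psi> x) +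
        q x \<bullet> T i (frechet_derivative \<psi> (at x) (axis i 1))) = 0" (is "integral\<^sup>L _ ?F' = 0") for i
    proof -
      have Dq: "(q has_derivative A) (at x)" for x
        unfolding q_def using A by (auto intro!: derivative_eq_intros simp: linear_conv_bounded_linear
            bounded_linear_imp_has_derivative)
      have D: "((\<lambda>x. q x \<bullet> T i (\<psi> x)) has_derivative
         (\<lambda>k. q x \<bullet> T i (frechet_derivative \<psi> (at x) k) + A k \<bullet> T i (\<psi> x))) (at x)" for x
        by (intro has_derivative_inner Dq bounded_linear.has_derivative[OF Ti]
            smooth_field_has_derivative \<psi>(1))
      have eq: "?F' = (\<lambda>x. q x \<bullet> T i (frechet_derivative \<psi> (at x) (axis i 1)) + A (axis i 1) \<bullet> T i (\<psi> x))"
        by (simp add: add.commute)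
      have 0: "integral\<^sup>L lebesgue ?F' = 0"
        unfolding eq
      proof (rule integral_directional_derivative_zero[OF D _ K(1)])
        show "continuous_on UNIV
          (\<lambda>x. q x \<bullet> T i (frechet_derivative \<psi> (at x) (axis i 1)) + A (axis i 1) \<bullet> T i (\<psi> x))"
          by (intro continuous_intros contq contT contT\<psi>)
        show "q x \<bullet> T i (\<psi> x) = 0" if "x \<notin> ?K" for x
          using \<psi>0[OF that] by (simp add: linear_0[OF linear_T])
      qed
      have F'0: "?F' x = 0" if x: "x \<notin> \<Omega>" for x
      proof -
        have xK: "x \<notin> ?K" using x K(2) S(2) by blast
        have "frechet_derivative \<psi> (at x) = (\<lambda>h. 0)" by (rule frechet_derivative_outside_support[OF xK])
        then show ?thesis using \<psi>0[OF xK] by (simp add: linear_0[OF linear_T])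
      qed
      have "integral\<^sup>L (lebesgue_on UNIV) ?F' = integral\<^sup>L (lebesgue_on \<Omega>) ?F'"
        by (rule integral_restrict_support) (use F'0 in auto)
      with 0 show ?thesis by (simp add: lebesgue_on_UNIV_eq)
    qed
    have i1: "integrable (lebesgue_on \<Omega>) (\<lambda>x. A (axis i 1) \<bullet> T i (\<psi> x))" for i
      by (rule integrable_inner_continuous[OF bounded_\<Omega> sets_\<Omega> continuous_L2[OF bounded_\<Omega> sets_\<Omega>] contT\<psi>]) simp
    have i2: "integrable (lebesgue_on \<Omega>) (\<lambda>x. q x \<bullet> T i (frechet_derivative \<psi> (at x) (axis i 1)))" for i
      by (rule integrable_inner_continuous[OF bounded_\<Omega> sets_\<Omega> qL contT])
    have "0 = (\<Sum>i\<in>UNIV. integral\<^sup>L (lebesgue_on \<Omega>) (\<lambda>x. A (axis i 1) \<bullet> T i (\<psi> x) +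
        q x \<bullet> T i (frechet_derivative \<psi> (at x) (axis i 1))))" by (simp add: zero)
    also have "\<dots> = integral\<^sup>L (lebesgue_on \<Omega>) (\<lambda>x. \<Sum>i\<in>UNIV. A (axis i 1) \<bullet> T i (\<psi> x) +
        q x \<bullet> T i (frechet_derivative \<psi> (at x) (axis i 1)))"
      by (rule Bochner_Integration.integral_sum[symmetric]) (intro Bochner_Integration.integrable_add i1 i2)
    also have "\<dots> = integral\<^sup>L (lebesgue_on \<Omega>) (\<lambda>x. c \<bullet> \<psi> x + q x \<bullet> D \<psi> x)"
      by (simp add: sum.distrib c_def D_def inner_sum_left inner_sum_right adjoint)
    also have "\<dots> = integral\<^sup>L (lebesgue_on \<Omega>) (\<lambda>x. c \<bullet> \<psi> x) + integral\<^sup>L (lebesgue_on \<Omega>) (\<lambda>x. q x \<bullet> D \<psi> x)"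
      by (rule Bochner_Integration.integral_add[OF integrable_test[OF cL \<psi>(1)] integrable_D[OF qL \<psi>(1)]])
    \<comment> \<open>The fields q and v agree almost everywhere in S, and \<open>D \<psi>\<close>
      vanishes outside S.\<close>
    also have "integral\<^sup>L (lebesgue_on \<Omega>) (\<lambda>x. q x \<bullet> D \<psi> x) = integral\<^sup>L (lebesgue_on \<Omega>) (\<lambda>x. v x \<bullet> D \<psi> x)"
    proof (rule integral_cong_AE)
      have "AE x in lebesgue_on S. v x = q x" using vq by (simp add: ae_eq_def q_def)
      then have "AE x in lebesgue. x \<in> S \<longrightarrow> v x = q x" using Sl by (simp add: AE_restrict_space_iff)
      then have "AE x in lebesgue. x \<in> \<Omega> \<longrightarrow> q x \<bullet> D \<psi> x = v x \<bullet> D \<psi> x"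
        by (rule eventually_mono) (use D0 in force)
      then show "AE x in lebesgue_on \<Omega>. q x \<bullet> D \<psi> x = v x \<bullet> D \<psi> x" by (simp add: AE_restrict_space_iff)
    qed (use integrable_D[OF qL \<psi>(1)] integrable_D[OF V_L2[OF v] \<psi>(1)] in blast)+
    also have "\<dots> = s * integral\<^sup>L (lebesgue_on \<Omega>) (\<lambda>x. wd \<Omega> v x \<bullet> \<psi> x)"
      using is_wd_wd[OF v] \<psi>(1) \<psi>\<Omega> unfolding is_wd_def by blast
    finally have "integral\<^sup>L (lebesgue_on \<Omega>) (\<lambda>x. c \<bullet> \<psi> x) = - (s * integral\<^sup>L (lebesgue_on \<Omega>) (\<lambda>x. wd \<Omega> v x \<bullet> \<psi> x))"
      by simp
    moreover have "s * s = 1" using sign by (metis abs_mult_self_eq mult_1)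
    ultimately have "integral\<^sup>L (lebesgue_on \<Omega>) (\<lambda>x. wd \<Omega> v x \<bullet> \<psi> x) + s * integral\<^sup>L (lebesgue_on \<Omega>) (\<lambda>x. c \<bullet> \<psi> x) = 0"
      by (simp flip: mult.assoc)
    then have "integral\<^sup>L (lebesgue_on \<Omega>) (\<lambda>x. (wd \<Omega> v x + s *\<^sub>R c) \<bullet> \<psi> x) = 0"
      using integrable_test[OF wd_L2[OF v] \<psi>(1)] integrable_test[OF cL \<psi>(1)]
      by (simp add: inner_add_left)
    moreover have "integral\<^sup>L (lebesgue_on \<Omega>) (\<lambda>x. (wd \<Omega> v x + s *\<^sub>R c) \<bullet> \<psi> x)
        = integral\<^sup>L (lebesgue_on S) (\<lambda>x. (wd \<Omega> v x + s *\<^sub>R c) \<bullet> \<psi> x)"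
    proof (rule integral_restrict_support[OF S(2) Sl sets_\<Omega>])
      fix x assume "x \<notin> S"
      then have "x \<notin> ?K" using K(2) by blast
      then have "\<psi> x = 0" by (rule \<psi>0)
      then show "(wd \<Omega> v x + s *\<^sub>R c) \<bullet> \<psi> x = 0" by simp
    qed
    ultimately show "integral\<^sup>L (lebesgue_on S) (\<lambda>x. (wd \<Omega> v x + s *\<^sub>R c) \<bullet> \<psi> x) = 0" by simp
  qed
  then show ?thesis unfolding ae_eq_def c_def by (rule eventually_mono) (simp add: eq_neg_iff_add_eq_0)
qed

end

section \<open>The local bound\<close>

text \<open>The faces are convex with empty interior, hence null sets. So closed cells can be used
  although fields are determined in \<Omega> only.\<close>

lemma negligible_frontier_polyhedral:
  assumes "polyhedral \<Omega>"
  shows "negligible (frontier \<Omega>)"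
proof -
  obtain F where F: "finite F" "\<And>S. S \<in> F \<Longrightarrow> polytope S \<and> aff_dim S = 2" "frontier \<Omega> = \<Union>F"
    using assms unfolding polyhedral_def by blast
  have "negligible S" if "S \<in> F" for S
  proof -
    have "interior S = {}" using F(2)[OF that] by (simp add: interior_rel_interior_gen)
    moreover have "convex S" using F(2)[OF that] by (simp add: polytope_imp_convex)
    ultimately show ?thesis by (simp add: negligible_convex_interior)
  qed
  then show ?thesis using F(1,3) by auto
qed

text \<open>The constant of \<open>affine_inverse_estimate\<close>, once for each of the three partial derivatives.\<close>

definition inverse_const :: "real \<Rightarrow> real" where "inverse_const \<rho> = 1536 * \<rho> ^ 3"

text \<open>In the bracket, the first term bounds \<open>P u\<close>, the second one the effect of
  \<open>Q\<close> on u, and the last one its effect on \<open>P u\<close>;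
  \<open>4 * neighbour_count \<rho>\<close> counts the touching cells, and the other factors 2 come
  from the triangle inequalities.\<close>

definition bound_const :: "real \<Rightarrow> real \<Rightarrow> real" where
  "bound_const \<rho> k = 2 * (k * size_ratio \<rho> + 2 * k +
     2 * k * real (4 * neighbour_count \<rho>) * (1 + inverse_const \<rho> * size_ratio \<rho>) * (k * size_ratio \<rho>))"

locale mesh_derivative = weak_derivative_on T T' s \<Omega> + shape_regular_mesh \<Omega> \<T>
  for T :: "3 \<Rightarrow> 'b::euclidean_space \<Rightarrow> 'a::euclidean_space" and T' s \<Omega> \<T> +
  assumes polyhedral: "polyhedral \<Omega>"
begin

lemma sets_cell: "\<tau> \<in> \<T> \<Longrightarrow> \<tau> \<in> sets lebesgue"
  using closed_cell by auto

lemma cell_subset: "\<tau> \<in> \<T> \<Longrightarrow> \<tau> \<subseteq> closure \<Omega>"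
  using Union_cells by blast

lemma negligible_diff_domain: "S \<subseteq> closure \<Omega> \<Longrightarrow> negligible (S - \<Omega>)"
  using negligible_frontier_polyhedral[OF polyhedral] open_\<Omega>
  by (auto simp: frontier_def interior_open intro: negligible_subset)

lemma L2_closure: "u \<in> L2 \<Omega> \<Longrightarrow> S \<subseteq> closure \<Omega> \<Longrightarrow> S \<in> sets lebesgue \<Longrightarrow> u \<in> L2 S"
  by (intro L2_subset_null[of u \<Omega> S] negligible_diff_domain sets_\<Omega>)

lemma V_L2_closure: "u \<in> V \<Omega> \<Longrightarrow> S \<subseteq> closure \<Omega> \<Longrightarrow> S \<in> sets lebesgue \<Longrightarrow> u \<in> L2 S"
  by (rule L2_closure[OF V_L2])

lemma wd_L2_closure: "u \<in> V \<Omega> \<Longrightarrow> S \<subseteq> closure \<Omega> \<Longrightarrow> S \<in> sets lebesgue \<Longrightarrow> wd \<Omega> u \<in> L2 S"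
  by (rule L2_closure[OF wd_L2])

lemma es_subset: "es1 \<T> \<tau> \<subseteq> closure \<Omega>" "es2 \<T> \<tau> \<subseteq> closure \<Omega>"
  unfolding es1_def es2_def Union_cells[symmetric] by (intro order_trans[OF interior_subset] Union_mono; blast)+

lemma ae_eq_cell: "ae_eq \<Omega> u v \<Longrightarrow> \<tau> \<subseteq> closure \<Omega> \<Longrightarrow> \<tau> \<in> sets lebesgue \<Longrightarrow> ae_eq \<tau> u v"
  by (intro ae_eq_subset_null[of \<Omega> u v \<tau>] negligible_diff_domain sets_\<Omega>)

text \<open>Almost everywhere in the cell the weak derivative is a constant c, so its norm is that
  of c times the square root of the volume. As \<open>T'\<close> does not increase norms, c is
  bounded by the three directional derivatives of q.\<close>

lemma inverse_estimate:
  assumes \<tau>: "\<tau> \<in> \<T>" and v: "v \<in> V \<Omega>" and q: "affine_field q" "ae_eq \<tau> v q"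
  shows "L2_norm \<tau> (wd \<Omega> v) \<le> inverse_const \<rho> / diameter \<tau> * L2_norm \<tau> v"
proof -
  obtain q0 A where A: "linear A" and q': "q = (\<lambda>x. q0 + A x)" using q(1) by (auto simp: affine_field_def)
  note m\<tau> = sets_cell[OF \<tau>]
  \<comment> \<open>The intersection with \<Omega> is taken because the interior of a cell is only
    known to lie in the closure of \<Omega>; what is lost is a null set.\<close>
  define S where "S = interior \<tau> \<inter> \<Omega>"
  have S: "open S" "S \<subseteq> \<Omega>" "S \<subseteq> \<tau>" using open_\<Omega> interior_subset by (auto simp: S_def)
  have Sl: "S \<in> sets lebesgue" using S(1) by auto
  have null: "negligible (\<tau> - S)"
  proof -
    have "negligible (frontier \<tau>)" by (rule negligible_convex_frontier[OF convex_cell[OF \<tau>]])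
    then have "negligible (frontier \<tau> \<union> (\<tau> - \<Omega>))"
      using negligible_diff_domain[OF cell_subset[OF \<tau>]] by simp
    then show ?thesis
      by (rule negligible_subset) (use closure_subset[of \<tau>] in \<open>auto simp: S_def frontier_def\<close>)
  qed
  define c where "c = - s *\<^sub>R (\<Sum>i\<in>UNIV. T' i (A (axis i 1)))"
  have "ae_eq S v (\<lambda>x. q0 + A x)"
    using q(2) S(3) unfolding q' by (intro ae_eq_subset_null[of \<tau> v _ S] m\<tau> Sl) auto
  then have "ae_eq S (wd \<Omega> v) (\<lambda>x. c)" unfolding c_def by (rule wd_affine[OF v S(1,2) A])
  then have c: "ae_eq \<tau> (wd \<Omega> v) (\<lambda>x. c)" by (rule ae_eq_subset_null) (use m\<tau> Sl null in auto)
  have contA: "continuous_on UNIV A" by (rule linear_continuous_on[OF A[unfolded linear_conv_bounded_linear]])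
  have qL: "q \<in> L2 \<tau>"
    unfolding q' by (intro continuous_L2 bounded_cell \<tau> m\<tau> continuous_intros contA)
  have cL: "(\<lambda>x. c) \<in> L2 \<tau>" by (intro continuous_L2 bounded_cell \<tau> m\<tau>) simp
  have vL: "v \<in> L2 \<tau>" "wd \<Omega> v \<in> L2 \<tau>"
    by (intro V_L2_closure wd_L2_closure v cell_subset \<tau> m\<tau>)+
  obtain x r where r: "0 < r" "cball x r \<subseteq> \<tau>" "diameter \<tau> \<le> 4 * \<rho> * r" using cell_ball[OF \<tau>] by metis
  let ?m = "sqrt (measure lebesgue \<tau>)" and ?C = "512 * \<rho> ^ 3 / diameter \<tau> * L2_norm \<tau> q"
  have b: "norm (A (axis i 1)) * ?m \<le> ?C" for i
    unfolding q'
    by (rule affine_inverse_estimate[OF A _ compact_cell[OF \<tau>] convex_cell[OF \<tau>] r diameter_pos[OF \<tau>] shape_ge_1[OF \<tau>]])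
      simp
  have "norm c = norm (\<Sum>i\<in>UNIV. T' i (A (axis i 1)))" using sign by (simp add: c_def)
  also have "\<dots> \<le> (\<Sum>i\<in>UNIV. norm (A (axis i 1)))"
    by (rule order_trans[OF norm_sum sum_mono[OF norm_T']])
  finally have "norm c * ?m \<le> (\<Sum>i\<in>UNIV. norm (A (axis i 1))) * ?m" by (rule mult_right_mono) simp
  also have "\<dots> = (\<Sum>i\<in>UNIV. norm (A (axis i 1)) * ?m)" by (rule sum_distrib_right)
  also have "\<dots> \<le> (\<Sum>i\<in>(UNIV::3 set). ?C)" by (rule sum_mono[OF b])
  also have "\<dots> = inverse_const \<rho> / diameter \<tau> * L2_norm \<tau> q" by (simp add: inverse_const_def)
  also have "L2_norm \<tau> q = L2_norm \<tau> v" using L2_norm_cong[OF q(2) vL(1) qL] by simp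
  finally have "norm c * ?m \<le> inverse_const \<rho> / diameter \<tau> * L2_norm \<tau> v" .
  moreover have "L2_norm \<tau> (wd \<Omega> v) = norm c * ?m"
  proof -
    have "L2_norm \<tau> (wd \<Omega> v) = L2_norm \<tau> (\<lambda>x. c)" by (rule L2_norm_cong[OF c vL(2) cL])
    then show ?thesis
      using m\<tau> by (simp add: L2_norm_def measure_restrict_space real_sqrt_mult)
  qed
  ultimately show ?thesis by simp
qed

text \<open>The second ring arises because \<open>Q\<close> on \<tau> sees \<open>P u\<close> on the
  cells touching \<tau>, and \<open>P u\<close> on such a cell sees u on the first ring of that
  cell. The absolute value makes the constant nonnegative whatever the sign of K.\<close>

lemma locally_bounded_combine:
  assumes P: "\<And>u. u \<in> V \<Omega> \<Longrightarrow> P u \<in> V \<Omega>" and Q: "\<And>u. u \<in> V \<Omega> \<Longrightarrow> Q u \<in> V \<Omega>"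
    and affine: "\<And>u \<tau>. u \<in> V \<Omega> \<Longrightarrow> \<tau> \<in> \<T> \<Longrightarrow> \<exists>q. affine_field q \<and> ae_eq \<tau> (P u) q"
    and P0: "vanishes_inside \<Omega> \<T> l (V \<Omega>) P"
    and Pb: "locally_bounded es1 K \<Omega> \<T> l (wd \<Omega>) (V \<Omega>) P"
    and Qb: "locally_bounded es1 K \<Omega> \<T> l (wd \<Omega>) (V \<Omega>) Q"
  shows "locally_bounded es2 (bound_const (shape_reg \<T>) \<bar>K\<bar>) \<Omega> \<T> l (wd \<Omega>) (V \<Omega>) (combine P Q)"
  unfolding locally_bounded_def
proof (intro ballI)
  fix u \<tau> assume u: "u \<in> V \<Omega>" and "\<tau> \<in> boundary_cells \<Omega> \<T> l"
  then have \<tau>b: "\<tau> \<in> boundary_cells \<Omega> \<T> l" and \<tau>: "\<tau> \<in> \<T>" by (auto simp: boundary_cells_def)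
  define R where "R = boundary_region \<Omega> \<T> l"
  define k where "k = \<bar>K\<bar>"
  define h where "h = diameter \<tau>"
  define M where "M = size_ratio \<rho>"
  define N where "N = real (4 * neighbour_count \<rho>)"
  define c where "c = inverse_const \<rho>"
  define nu where "nu = L2_norm (es2 \<T> \<tau> \<inter> R) u"
  define ndu where "ndu = L2_norm (es2 \<T> \<tau> \<inter> R) (wd \<Omega> u)"
  define S where "S = es1 \<T> \<tau> \<inter> R"
  define F where "F = {\<tau>' \<in> \<T>. \<tau>' \<inter> \<tau> \<noteq> {}}"
  note Pu = P[OF u]
  have r: "(\<lambda>y. u y - P u y) \<in> V \<Omega>" by (intro V_diff u Pu)
  have k0: "k \<ge> 0" and h0: "h > 0" and \<rho>1: "\<rho> \<ge> 1" and M1: "M \<ge> 1" and N0: "N \<ge> 0" and c0: "c \<ge> 0"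
    using diameter_pos[OF \<tau>] shape_ge_1[OF \<tau>]
    by (auto simp: k_def h_def M_def N_def c_def size_ratio_def inverse_const_def one_le_power)
  have n0: "nu \<ge> 0" "ndu \<ge> 0" by (simp_all add: nu_def ndu_def)
  have open_es: "open (es1 \<T> \<sigma>)" "open (es2 \<T> \<sigma>)" "open R" for \<sigma>
    by (simp_all add: es1_def es2_def R_def boundary_region_def)
  have es_sets: "es1 \<T> \<sigma> \<inter> R \<in> sets lebesgue" "es2 \<T> \<sigma> \<inter> R \<in> sets lebesgue" for \<sigma>
    using open_es by auto
  have es_cl: "es1 \<T> \<sigma> \<inter> R \<subseteq> closure \<Omega>" "es2 \<T> \<sigma> \<inter> R \<subseteq> closure \<Omega>" for \<sigma>
    using es_subset by blast+
  have es_le: "L2_norm (es1 \<T> \<tau>' \<inter> R) w \<le> L2_norm (es2 \<T> \<tau> \<inter> R) w"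
    if "\<tau>' \<in> F" "w \<in> L2 \<Omega>" for \<tau>' and w :: "R3 \<Rightarrow> 'c::euclidean_space"
  proof (rule L2_norm_mono)
    show "es1 \<T> \<tau>' \<inter> R \<subseteq> es2 \<T> \<tau> \<inter> R" using es1_subset_es2[OF \<tau>, of \<tau>'] that(1) by (auto simp: F_def)
  qed (intro L2_closure[OF that(2)] es_cl es_sets)+
  have \<tau>F: "\<tau> \<in> F" using \<tau> simplex3_interior(1)[OF simplex_cell[OF \<tau>]] interior_subset by (auto simp: F_def)
  have FT: "F \<subseteq> \<T>" "finite F" using finite_cells by (auto simp: F_def)
  have F_sets: "\<sigma> \<in> sets lebesgue" if "\<sigma> \<in> F" for \<sigma> using that FT sets_cell by blast
  have F_cl: "\<Union>F \<subseteq> closure \<Omega>" "\<Union>F \<in> sets lebesgue"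
    using FT F_sets Union_cells by (auto intro!: sets.finite_Union)
  have cardF: "real (card F) \<le> N"
    using card_touching[OF \<tau>] unfolding F_def N_def by simp
  have SF: "S \<subseteq> \<Union>F" unfolding S_def F_def es1_def using interior_subset by blast
  have S_sets: "S \<in> sets lebesgue" and S_cl: "S \<subseteq> closure \<Omega>" using es_sets es_cl by (auto simp: S_def)
  \<comment> \<open>A common bound for \<open>P u\<close> on all cells touching \<tau>, with their
    diameters replaced by M h; on cells that are not boundary cells it holds because
    \<open>P u\<close> vanishes there.\<close>
  define E where "E = k * (nu + M * h * ndu)"
  have E0: "E \<ge> 0" using k0 n0 M1 h0 by (simp add: E_def)
  have hF: "diameter \<tau>' \<le> M * h" "h \<le> M * diameter \<tau>'" if "\<tau>' \<in> F" for \<tau>'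
    using diameter_le_of_touching[OF \<tau>, of \<tau>'] diameter_le_of_touching[OF _ \<tau>, of \<tau>'] that
    by (auto simp: F_def M_def h_def Int_commute)
  have local: "L2_norm \<sigma> (B w) \<le> k * (L2_norm (es1 \<T> \<sigma> \<inter> R) w + diameter \<sigma> * L2_norm (es1 \<T> \<sigma> \<inter> R) (wd \<Omega> w))"
    if "locally_bounded es1 K \<Omega> \<T> l (wd \<Omega>) (V \<Omega>) B" "w \<in> V \<Omega>" "\<sigma> \<in> boundary_cells \<Omega> \<T> l" for B w \<sigma>
  proof -
    have "\<sigma> \<in> \<T>" using that(3) by (simp add: boundary_cells_def)
    have "L2_norm \<sigma> (B w) \<le> K * (L2_norm (es1 \<T> \<sigma> \<inter> R) w + diameter \<sigma> * L2_norm (es1 \<T> \<sigma> \<inter> R) (wd \<Omega> w))"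
      using that unfolding locally_bounded_def R_def by blast
    also have "\<dots> \<le> k * (L2_norm (es1 \<T> \<sigma> \<inter> R) w + diameter \<sigma> * L2_norm (es1 \<T> \<sigma> \<inter> R) (wd \<Omega> w))"
      using diameter_pos[OF \<open>\<sigma> \<in> \<T>\<close>] by (intro mult_right_mono) (auto simp: k_def)
    finally show ?thesis .
  qed
  have PE: "L2_norm \<tau>' (P u) \<le> E" if \<tau>': "\<tau>' \<in> F" for \<tau>'
  proof (cases "\<tau>' \<in> boundary_cells \<Omega> \<T> l")
    case True
    have "L2_norm \<tau>' (P u) \<le> k * (L2_norm (es1 \<T> \<tau>' \<inter> R) u + diameter \<tau>' * L2_norm (es1 \<T> \<tau>' \<inter> R) (wd \<Omega> u))"
      by (rule local[OF Pb u True])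
    also have "\<dots> \<le> E"
      unfolding E_def nu_def ndu_def
      using k0 M1 h0 by (intro mult_left_mono add_mono mult_mono es_le \<tau>' V_L2 wd_L2 u hF) auto
    finally show ?thesis .
  next
    case False
    then have "ae_eq \<tau>' (P u) (\<lambda>x. 0)" using P0 u \<tau>' FT unfolding vanishes_inside_def by blast
    moreover have "P u \<in> L2 \<tau>'" using \<tau>' FT by (intro V_L2_closure Pu cell_subset sets_cell) auto
    ultimately show ?thesis using L2_norm_zero E0 by metis
  qed
  have PS: "L2_norm S (P u) \<le> N * E"
  proof -
    have "L2_norm S (P u) \<le> (\<Sum>\<tau>'\<in>F. L2_norm \<tau>' (P u))"
      by (intro L2_norm_le_sum FT F_sets S_sets SF V_L2_closure Pu F_cl)
    also have "\<dots> \<le> (\<Sum>\<tau>'\<in>F. E)" by (intro sum_mono PE)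
    also have "\<dots> \<le> N * E" using mult_right_mono[OF cardF E0] by simp
    finally show ?thesis .
  qed
  \<comment> \<open>The inverse inequality divides by the diameter of the neighbour, which is at
    least h / M.\<close>
  have dPE: "L2_norm \<tau>' (wd \<Omega> (P u)) \<le> c * M / h * E" if \<tau>': "\<tau>' \<in> F" for \<tau>'
  proof -
    have \<tau>'T: "\<tau>' \<in> \<T>" using \<tau>' FT by blast
    obtain q where "affine_field q" "ae_eq \<tau>' (P u) q" using affine[OF u \<tau>'T] by blast
    from inverse_estimate[OF \<tau>'T Pu this]
    have "L2_norm \<tau>' (wd \<Omega> (P u)) \<le> c / diameter \<tau>' * L2_norm \<tau>' (P u)" by (simp add: c_def)
    also have "\<dots> \<le> c * M / h * E"
    proof (intro mult_mono PE \<tau>')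
      have "c * h \<le> c * (M * diameter \<tau>')" using hF(2)[OF \<tau>'] c0 by (rule mult_left_mono)
      then show "c / diameter \<tau>' \<le> c * M / h"
        using diameter_pos[OF \<tau>'T] h0 by (simp add: field_simps)
    qed (use c0 M1 h0 in auto)
    finally show ?thesis .
  qed
  have dPS: "L2_norm S (wd \<Omega> (P u)) \<le> N * (c * M / h * E)"
  proof -
    have "L2_norm S (wd \<Omega> (P u)) \<le> (\<Sum>\<tau>'\<in>F. L2_norm \<tau>' (wd \<Omega> (P u)))"
      by (intro L2_norm_le_sum FT F_sets S_sets SF wd_L2_closure Pu F_cl)
    also have "\<dots> \<le> (\<Sum>\<tau>'\<in>F. c * M / h * E)" by (intro sum_mono dPE)
    also have "\<dots> \<le> N * (c * M / h * E)"
    proof -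
      have "0 \<le> c * M / h * E" using c0 M1 h0 E0 by simp
      from mult_right_mono[OF cardF this] show ?thesis by simp
    qed
    finally show ?thesis .
  qed
  have uS: "L2_norm S u \<le> nu" and duS: "L2_norm S (wd \<Omega> u) \<le> ndu"
    unfolding S_def nu_def ndu_def by (intro es_le \<tau>F V_L2 wd_L2 u)+
  have LS: "u \<in> L2 S" "P u \<in> L2 S" "wd \<Omega> u \<in> L2 S" "wd \<Omega> (P u) \<in> L2 S"
    "wd \<Omega> (\<lambda>y. u y - P u y) \<in> L2 S"
    by (intro V_L2_closure wd_L2_closure u Pu r S_sets S_cl)+
  have rS: "L2_norm S (\<lambda>y. u y - P u y) \<le> 2 * (nu + N * E)"
    by (rule order_trans[OF L2_norm_diff_le[OF LS(1,2)]]) (intro mult_left_mono add_mono uS PS, simp)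
  have "L2_norm S (wd \<Omega> (\<lambda>y. u y - P u y)) = L2_norm S (\<lambda>x. wd \<Omega> u x - wd \<Omega> (P u) x)"
    by (intro L2_norm_cong ae_eq_cell[OF wd_diff[OF u Pu]] LS L2_diff S_sets S_cl)
  also have "\<dots> \<le> 2 * (ndu + N * (c * M / h * E))"
    by (rule order_trans[OF L2_norm_diff_le[OF LS(3,4)]]) (intro mult_left_mono add_mono duS dPS, simp)
  finally have drS: "L2_norm S (wd \<Omega> (\<lambda>y. u y - P u y)) \<le> 2 * (ndu + N * (c * M / h * E))" .
  have "L2_norm \<tau> (Q (\<lambda>y. u y - P u y))
      \<le> k * (L2_norm S (\<lambda>y. u y - P u y) + h * L2_norm S (wd \<Omega> (\<lambda>y. u y - P u y)))"
    using local[OF Qb r \<tau>b] by (simp add: S_def h_def)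
  also have "\<dots> \<le> k * (2 * (nu + N * E) + h * (2 * (ndu + N * (c * M / h * E))))"
    using k0 h0 by (intro mult_left_mono add_mono rS drS) auto
  \<comment> \<open>The weight h of the derivative cancels the factor 1 / h from the inverse
    inequality.\<close>
  also have "\<dots> = k * (2 * (nu + h * ndu) + 2 * N * (1 + c * M) * E)"
    using h0 by (simp add: field_simps)
  finally have Q\<tau>: "L2_norm \<tau> (Q (\<lambda>y. u y - P u y)) \<le> k * (2 * (nu + h * ndu) + 2 * N * (1 + c * M) * E)" .
  have EM: "E \<le> k * M * (nu + h * ndu)"
  proof -
    have "nu \<le> M * nu" using mult_right_mono[OF M1 n0(1)] by simp
    then have "k * (nu + M * h * ndu) \<le> k * (M * nu + M * h * ndu)" using k0 by (intro mult_left_mono) auto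
    then show ?thesis by (simp add: E_def algebra_simps)
  qed
  have L\<tau>: "P u \<in> L2 \<tau>" "Q (\<lambda>y. u y - P u y) \<in> L2 \<tau>"
    by (intro V_L2_closure Pu Q r cell_subset sets_cell \<tau>)+
  have "L2_norm \<tau> (combine P Q u) \<le> 2 * (L2_norm \<tau> (P u) + L2_norm \<tau> (Q (\<lambda>y. u y - P u y)))"
    unfolding combine_def by (rule L2_norm_add_le[OF L\<tau>])
  also have "\<dots> \<le> 2 * (E + k * (2 * (nu + h * ndu) + 2 * N * (1 + c * M) * E))"
    by (intro mult_left_mono add_mono PE[OF \<tau>F] Q\<tau>) simp
  also have "\<dots> \<le> 2 * (k * M * (nu + h * ndu) +
      k * (2 * (nu + h * ndu) + 2 * N * (1 + c * M) * (k * M * (nu + h * ndu))))"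
    using k0 N0 c0 M1 by (intro mult_left_mono add_mono EM order_refl) auto
  also have "\<dots> = bound_const \<rho> k * (nu + h * ndu)"
    by (simp add: bound_const_def M_def N_def c_def algebra_simps)
  finally show "L2_norm \<tau> (combine P Q u) \<le> bound_const (shape_reg \<T>) \<bar>K\<bar> *
      (L2_norm (es2 \<T> \<tau> \<inter> boundary_region \<Omega> \<T> l) u +
       diameter \<tau> * L2_norm (es2 \<T> \<tau> \<inter> boundary_region \<Omega> \<T> l) (wd \<Omega> u))"
    by (simp add: nu_def ndu_def h_def k_def R_def \<rho>_def)
qed

end

section \<open>Gradient, curl and divergence\<close>

lemma smooth_field_vec: "smooth_field \<psi> \<longleftrightarrow> smooth_vec \<psi>"
  by (auto simp: smooth_field_def smooth_vec_def Basis_vec_def inner_axis)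

lemma smooth_field_scalar: "smooth_field \<phi> \<longleftrightarrow> smooth \<phi>"
  by (simp add: smooth_field_def)

text \<open>Named after the weak derivative: the test operator \<open>gr.D\<close> is the
  divergence, the sum of the i-th components of the i-th partial derivatives.\<close>

interpretation gr: weak_derivative "\<lambda>i (v :: R3). v $ i" "\<lambda>i (r :: real). r *\<^sub>R axis i (1 :: real)" "-1"
  by unfold_locales (auto simp: linear_iff inner_axis' mult.commute)

text \<open>The curl is the sum of the cross products of the i-th unit vector with the i-th partial
  derivative. The sign of integration by parts is undone by the skew symmetry of the cross product,
  so s = 1.\<close>

interpretation cu: weak_derivative "\<lambda>i. cross3 (axis i 1)" "\<lambda>i u. cross3 u (axis i 1)" 1
proof (rule weak_derivative.intro)
  show "linear (cross3 (axis i 1))" for i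
    by (simp add: linear_iff cross_add_right cross_mult_right)
  show "cross3 u (axis i 1) \<bullet> w = u \<bullet> cross3 (axis i 1) w" for i u w
    by (simp add: cross3_def inner_vec_def sum_3 algebra_simps)
  show "norm (cross3 u (axis i 1)) \<le> norm u" for i u
  proof -
    have "(norm (cross3 u (axis i 1)))\<^sup>2 \<le> (norm u)\<^sup>2"
      by (simp add: norm_cross)
    then show ?thesis by (rule power2_le_imp_le) simp
  qed
qed simp

interpretation di: weak_derivative "\<lambda>i (r :: real). r *\<^sub>R axis i (1 :: real)" "\<lambda>i (v :: R3). v $ i" "-1"
  by unfold_locales (auto simp: linear_iff algebra_simps inner_axis component_le_norm_cart)

lemma frechet_derivative_component:
  assumes "smooth_vec \<psi>"
  shows "frechet_derivative \<psi> (at x) (axis i 1) $ j = pd i (\<lambda>y. \<psi> y $ j) x"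
  using pd_eqI[OF bounded_linear.has_derivative[OF bounded_linear_vec_nth smooth_field_has_derivative], of \<psi> i j x]
    assms by (simp add: smooth_field_vec)

lemma gr_D: "smooth_vec \<psi> \<Longrightarrow> gr.D \<psi> = dive \<psi>"
  by (auto simp: gr.D_def dive_def frechet_derivative_component)

lemma cross3_axis:
  "cross3 (axis 1 1) w = vector [0, - w $ 3, w $ 2]"
  "cross3 (axis 2 1) w = vector [w $ 3, 0, - w $ 1]"
  "cross3 (axis 3 1) w = vector [- w $ 2, w $ 1, 0]"
  by (simp_all add: cross3_def axis_def vec_eq_iff forall_3)

lemma cu_D: "smooth_vec \<psi> \<Longrightarrow> cu.D \<psi> = curl \<psi>"
  unfolding cu.D_def
  by (rule ext) (simp add: curl_def sum_3 cross3_axis vec_eq_iff forall_3 frechet_derivative_component)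

lemma di_D: "di.D \<phi> = grad \<phi>"
  unfolding di.D_def by (rule ext) (simp add: grad_def pd_def vec_eq_iff forall_3 sum_3, simp add: axis_def)

lemma gr_is_wd: "gr.is_wd = is_weak_grad"
  by (auto simp: fun_eq_iff gr.is_wd_def is_weak_grad_def smooth_field_vec gr_D)

lemma cu_is_wd: "cu.is_wd = is_weak_curl"
  by (auto simp: fun_eq_iff cu.is_wd_def is_weak_curl_def smooth_field_vec cu_D)

lemma di_is_wd: "di.is_wd = is_weak_div"
  by (auto simp: fun_eq_iff di.is_wd_def is_weak_div_def smooth_field_scalar di_D)

lemma gr_eqs: "gr.V = H1" "gr.wd = wgrad" "gr.tr = tr0"
proof -
  show "gr.V = H1" by (auto simp: fun_eq_iff gr.V_def H1_def gr_is_wd)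
  show wd: "gr.wd = wgrad" by (simp add: fun_eq_iff gr.wd_def wgrad_def gr_is_wd)
  show "gr.tr = tr0" by (auto simp: fun_eq_iff gr.tr_def tr0_def smooth_field_vec gr_D wd)
qed

lemma cu_eqs: "cu.V = Hcurl" "cu.wd = wcurl" "cu.tr = tr1"
proof -
  show "cu.V = Hcurl" by (auto simp: fun_eq_iff cu.V_def Hcurl_def cu_is_wd)
  show wd: "cu.wd = wcurl" by (simp add: fun_eq_iff cu.wd_def wcurl_def cu_is_wd)
  show "cu.tr = tr1" by (auto simp: fun_eq_iff cu.tr_def tr1_def smooth_field_vec cu_D wd)
qed

lemma di_eqs: "di.V = Hdiv" "di.wd = wdiv" "di.tr = tr2"
proof -
  show "di.V = Hdiv" by (auto simp: fun_eq_iff di.V_def Hdiv_def di_is_wd)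
  show wd: "di.wd = wdiv" by (simp add: fun_eq_iff di.wd_def wdiv_def di_is_wd)
  show "di.tr = tr2" by (auto simp: fun_eq_iff di.tr_def tr2_def smooth_field_scalar di_D wd)
qed

text \<open>Because test operators compose in reverse, div curl = 0 for test fields makes the weak
  curl of a weak gradient vanish; curl grad = 0 in \<open>cu_D_di_D\<close> does the same for the
  weak divergence of a weak curl.\<close>

lemma gr_D_cu_D:
  assumes "smooth_field \<psi>"
  shows "gr.D (cu.D \<psi>) x = 0"
proof -
  have \<psi>: "smooth_vec \<psi>" "smooth_vec (curl \<psi>)"
    using assms cu.smooth_field_D[OF assms] by (simp_all add: smooth_field_vec cu_D)
  then have s: "smooth (\<lambda>y. \<psi> y $ j)" for j by (simp add: smooth_vec_def)
  have pdd: "pd k (\<lambda>y. pd i (\<lambda>y. \<psi> y $ j) y - pd l (\<lambda>y. \<psi> y $ m) y) x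
      = pd k (pd i (\<lambda>y. \<psi> y $ j)) x - pd k (pd l (\<lambda>y. \<psi> y $ m)) x" for i j k l m
    by (intro pd_diff smooth_differentiable smooth_pd s)
  have "gr.D (cu.D \<psi>) x = dive (curl \<psi>) x" using \<psi> by (simp add: cu_D gr_D)
  also have "\<dots> = 0"
    using pd_commute[OF s, of 1 2] pd_commute[OF s, of 1 3] pd_commute[OF s, of 2 3]
    by (simp add: dive_def curl_def sum_3 pdd)
  finally show ?thesis .
qed

lemma cu_D_di_D:
  assumes "smooth_field \<phi>"
  shows "cu.D (di.D \<phi>) x = 0"
proof -
  have \<phi>: "smooth \<phi>" "smooth_vec (grad \<phi>)"
    using assms di.smooth_field_D[OF assms] by (simp_all add: smooth_field_vec smooth_field_scalar di_D)
  have "cu.D (di.D \<phi>) x = curl (grad \<phi>) x" using \<phi> by (simp add: cu_D di_D)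
  also have "\<dots> = 0"
    using pd_commute[OF \<phi>(1), of 1 2] pd_commute[OF \<phi>(1), of 1 3] pd_commute[OF \<phi>(1), of 2 3]
    by (simp add: curl_def grad_def vec_eq_iff forall_3)
  finally show ?thesis .
qed

section \<open>Lowest-order finite element spaces\<close>

lemma affine_field_const: "affine_field (\<lambda>x. c)"
  unfolding affine_field_def by (intro exI[of _ c] exI[of _ "\<lambda>x. 0"]) (simp add: linear_iff)

lemma affine_field_linear: "linear A \<Longrightarrow> affine_field A"
  unfolding affine_field_def by (intro exI[of _ 0] exI[of _ A]) simp

lemma affine_field_add:
  assumes "affine_field f" "affine_field g"
  shows "affine_field (\<lambda>x. f x + g x)"
proof -
  obtain a A b B where "linear A" "f = (\<lambda>x. a + A x)" "linear B" "g = (\<lambda>x. b + B x)"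
    using assms by (auto simp: affine_field_def)
  then show ?thesis
    unfolding affine_field_def
    by (intro exI[of _ "a + b"] exI[of _ "\<lambda>x. A x + B x"]) (auto intro: linear_compose_add simp: algebra_simps)
qed

lemma affine_field_scale:
  assumes "affine_field f"
  shows "affine_field (\<lambda>x. c *\<^sub>R f x)"
proof -
  obtain a A where "linear A" "f = (\<lambda>x. a + A x)"
    using assms by (auto simp: affine_field_def)
  then show ?thesis
    unfolding affine_field_def
    by (intro exI[of _ "c *\<^sub>R a"] exI[of _ "\<lambda>x. c *\<^sub>R A x"])
      (auto intro: linear_compose_scale_right simp: algebra_simps)
qed

lemma affine_field_sum: "(\<And>i. i \<in> I \<Longrightarrow> affine_field (f i)) \<Longrightarrow> affine_field (\<lambda>x. \<Sum>i\<in>I. f i x)"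
  by (induction I rule: infinite_finite_induct) (simp_all add: affine_field_const affine_field_add)

lemma poly_le_1_affine:
  assumes "q \<in> poly_le 1"
  shows "affine_field q"
proof -
  obtain c where q: "q = (\<lambda>x. \<Sum>\<alpha> | (\<Sum>i\<in>UNIV. \<alpha> i) \<le> 1. c (\<alpha> :: 3 \<Rightarrow> nat) * (\<Prod>i\<in>UNIV. (x $ i) ^ \<alpha> i))"
    using assms unfolding poly_le_def by blast
  have "affine_field (\<lambda>x :: R3. \<Prod>i\<in>UNIV. (x $ i) ^ \<alpha> i)" if "(\<Sum>i\<in>UNIV. \<alpha> i) \<le> 1" for \<alpha> :: "3 \<Rightarrow> nat"
  proof -
    have prod3: "(\<Prod>i\<in>UNIV. f i) = f 1 * f 2 * f 3" for f :: "3 \<Rightarrow> real"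
      unfolding UNIV_3 by (simp add: mult.assoc)
    have lin: "affine_field (\<lambda>x :: R3. x $ i)" for i by (rule affine_field_linear) (simp add: linear_iff)
    have "\<alpha> 1 + \<alpha> 2 + \<alpha> 3 \<le> 1" using that by (simp add: sum_3)
    \<comment> \<open>A multi-index of total degree at most 1 is zero or a unit vector.\<close>
    then have "\<alpha> 1 = 0 \<and> \<alpha> 2 = 0 \<and> \<alpha> 3 = 0 \<or> \<alpha> 1 = 1 \<and> \<alpha> 2 = 0 \<and> \<alpha> 3 = 0
      \<or> \<alpha> 1 = 0 \<and> \<alpha> 2 = 1 \<and> \<alpha> 3 = 0 \<or> \<alpha> 1 = 0 \<and> \<alpha> 2 = 0 \<and> \<alpha> 3 = 1"
      by arith
    then show ?thesis
      by (elim disjE conjE) (simp_all add: prod3 affine_field_const lin)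
  qed
  then have "affine_field (\<lambda>x :: R3. c \<alpha> *\<^sub>R (\<Prod>i\<in>UNIV. (x $ i) ^ \<alpha> i))"
    if "\<alpha> \<in> {\<alpha>. (\<Sum>i\<in>UNIV. \<alpha> i) \<le> 1}" for \<alpha> :: "3 \<Rightarrow> nat"
    using that by (intro affine_field_scale) blast
  then show ?thesis unfolding q real_scaleR_def by (rule affine_field_sum)
qed

lemma poly_le_0_const:
  assumes "q \<in> poly_le 0"
  obtains c where "q = (\<lambda>x. c)"
proof -
  obtain c where q: "q = (\<lambda>x. \<Sum>\<alpha> | (\<Sum>i\<in>UNIV. \<alpha> i) \<le> 0. c (\<alpha> :: 3 \<Rightarrow> nat) * (\<Prod>i\<in>UNIV. (x $ i) ^ \<alpha> i))"
    using assms unfolding poly_le_def by blast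
  have "{\<alpha> :: 3 \<Rightarrow> nat. (\<Sum>i\<in>UNIV. \<alpha> i) \<le> 0} = {\<lambda>i. 0}" by (auto simp: fun_eq_iff)
  then have "q = (\<lambda>x. c (\<lambda>i. 0))" unfolding q by simp
  then show thesis by (rule that)
qed

lemma poly_vec_le_0_const:
  assumes "q \<in> poly_vec_le 0"
  obtains c where "q = (\<lambda>x. c)"
proof -
  have "\<exists>c. (\<lambda>x. q x $ i) = (\<lambda>x. c)" for i
  proof -
    have "(\<lambda>x. q x $ i) \<in> poly_le 0" using assms by (simp add: poly_vec_le_def)
    then show ?thesis by (rule poly_le_0_const) blast
  qed
  then obtain c where "\<And>i. (\<lambda>x. q x $ i) = (\<lambda>x. c i)" by metis
  then have "q = (\<lambda>x. \<chi> i. c i)" by (simp add: vec_eq_iff fun_eq_iff)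
  then show thesis by (rule that)
qed

text \<open>For degree 0 the field b is constant, so its cross product with x is linear in
  x.\<close>

lemma nedelec_0_affine:
  assumes "q \<in> nedelec 0"
  shows "affine_field q"
proof -
  obtain a b where ab: "q = (\<lambda>x. a x + cross3 x (b x))" "a \<in> poly_vec_le 0" "b \<in> poly_vec_le 0"
    using assms by (auto simp: nedelec_def)
  obtain c where c: "a = (\<lambda>x. c)" using ab(2) by (rule poly_vec_le_0_const)
  obtain d where d: "b = (\<lambda>x. d)" using ab(3) by (rule poly_vec_le_0_const)
  have "linear (\<lambda>x. cross3 x d)" by (simp add: linear_iff cross_add_left cross_mult_left)
  then show ?thesis
    unfolding ab(1) c d by (intro affine_field_add affine_field_const affine_field_linear)
qed

lemma raviart_thomas_0_affine:
  assumes "q \<in> raviart_thomas 0"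
  shows "affine_field q"
proof -
  obtain a b where ab: "q = (\<lambda>x. a x + b x *\<^sub>R x)" "a \<in> poly_vec_le 0" "b \<in> poly_le 0"
    using assms by (auto simp: raviart_thomas_def)
  obtain c where c: "a = (\<lambda>x. c)" using ab(2) by (rule poly_vec_le_0_const)
  obtain d where d: "b = (\<lambda>x. d)" using ab(3) by (rule poly_le_0_const)
  show ?thesis
    unfolding ab(1) c d
    by (intro affine_field_add affine_field_const affine_field_scale affine_field_linear) (simp add: linear_iff)
qed

lemma ae_linear_operator_mem:
  "ae_linear_operator \<Omega> V W P \<Longrightarrow> W \<subseteq> V \<Longrightarrow> u \<in> V \<Longrightarrow> P u \<in> V"
  unfolding ae_linear_operator_def by blast

lemma ae_linear_operator_piecewise:
  assumes "ae_linear_operator \<Omega> V (piecewise \<T> Q V') P" "\<And>q. q \<in> Q \<Longrightarrow> R q" "u \<in> V" "\<tau> \<in> \<T>"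
  shows "\<exists>q. R q \<and> ae_eq \<tau> (P u) q"
proof -
  have "P u \<in> piecewise \<T> Q V'" using assms(1,3) by (simp add: ae_linear_operator_def)
  with assms(2,4) show ?thesis unfolding piecewise_def by blast
qed

theorem theorem5p3:
  fixes K :: "real \<Rightarrow> nat \<Rightarrow> real"
  shows "\<exists>C :: real \<Rightarrow> nat \<Rightarrow> real.
    \<forall>(p :: nat) (\<Omega> :: (real ^ 3) set) (\<T> :: (real ^ 3) set set)
     (W0 :: (real ^ 3 \<Rightarrow> real) set)
     (W1 :: (real ^ 3 \<Rightarrow> real ^ 3) set)
     (W2 :: (real ^ 3 \<Rightarrow> real ^ 3) set)
     P0 P1 P2 Q0 Q1 Q2.
       lipschitz_domain \<Omega> \<and>
       polyhedral \<Omega> \<and>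
       mesh \<Omega> \<T> \<and>
       ae_subspace \<Omega> W0 \<and> W0 \<subseteq> FE0 \<Omega> \<T> p \<and>
       ae_subspace \<Omega> W1 \<and> W1 \<subseteq> FE1 \<Omega> \<T> p \<and>
       ae_subspace \<Omega> W2 \<and> W2 \<subseteq> FE2 \<Omega> \<T> p \<and>
       is_direct_sum (tr0 \<Omega> ` FE0 \<Omega> \<T> p) (tr0 \<Omega> ` FE0 \<Omega> \<T> 0) (tr0 \<Omega> ` W0) \<and>
       is_direct_sum (tr1 \<Omega> ` FE1 \<Omega> \<T> p) (tr1 \<Omega> ` FE1 \<Omega> \<T> 0) (tr1 \<Omega> ` W1) \<and>
       is_direct_sum (tr2 \<Omega> ` FE2 \<Omega> \<T> p) (tr2 \<Omega> ` FE2 \<Omega> \<T> 0) (tr2 \<Omega> ` W2) \<and>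
       (p = 0 \<longrightarrow>
          W0 = {u \<in> H1 \<Omega>. ae_eq \<Omega> u (\<lambda>x. 0)} \<and>
          W1 = {u \<in> Hcurl \<Omega>. ae_eq \<Omega> u (\<lambda>x. 0)} \<and>
          W2 = {u \<in> Hdiv \<Omega>. ae_eq \<Omega> u (\<lambda>x. 0)}) \<and>
       ae_linear_operator \<Omega> (H1 \<Omega>) (FE0 \<Omega> \<T> 0) P0 \<and>
       ae_linear_operator \<Omega> (Hcurl \<Omega>) (FE1 \<Omega> \<T> 0) P1 \<and>
       ae_linear_operator \<Omega> (Hdiv \<Omega>) (FE2 \<Omega> \<T> 0) P2 \<and>
       ae_linear_operator \<Omega> (H1 \<Omega>) W0 Q0 \<and>
       ae_linear_operator \<Omega> (Hcurl \<Omega>) W1 Q1 \<and>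
       ae_linear_operator \<Omega> (Hdiv \<Omega>) W2 Q2 \<and>
       preserves_trace (tr0 \<Omega>) (trace_in (tr0 \<Omega>) (H1 \<Omega>) (FE0 \<Omega> \<T> 0)) P0 \<and>
       preserves_trace (tr1 \<Omega>) (trace_in (tr1 \<Omega>) (Hcurl \<Omega>) (FE1 \<Omega> \<T> 0)) P1 \<and>
       preserves_trace (tr2 \<Omega>) (trace_in (tr2 \<Omega>) (Hdiv \<Omega>) (FE2 \<Omega> \<T> 0)) P2 \<and>
       preserves_trace (tr0 \<Omega>) (trace_in (tr0 \<Omega>) (H1 \<Omega>) W0) Q0 \<and>
       preserves_trace (tr1 \<Omega>) (trace_in (tr1 \<Omega>) (Hcurl \<Omega>) W1) Q1 \<and>
       preserves_trace (tr2 \<Omega>) (trace_in (tr2 \<Omega>) (Hdiv \<Omega>) W2) Q2 \<and>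
       kills_trace (tr0 \<Omega>) (trace_in (tr0 \<Omega>) (H1 \<Omega>) W0) P0 \<and>
       kills_trace (tr1 \<Omega>) (trace_in (tr1 \<Omega>) (Hcurl \<Omega>) W1) P1 \<and>
       kills_trace (tr2 \<Omega>) (trace_in (tr2 \<Omega>) (Hdiv \<Omega>) W2) P2 \<and>
       commutes_on_trace (tr1 \<Omega>) (wgrad \<Omega>) (H1 \<Omega>) P0 P1 \<and>
       commutes_on_trace (tr2 \<Omega>) (wcurl \<Omega>) (Hcurl \<Omega>) P1 P2 \<and>
       commutes_on_trace (tr1 \<Omega>) (wgrad \<Omega>) (H1 \<Omega>) Q0 Q1 \<and>
       commutes_on_trace (tr2 \<Omega>) (wcurl \<Omega>) (Hcurl \<Omega>) Q1 Q2 \<and>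
       vanishes_inside \<Omega> \<T> 0 (H1 \<Omega>) P0 \<and>
       vanishes_inside \<Omega> \<T> 1 (Hcurl \<Omega>) P1 \<and>
       vanishes_inside \<Omega> \<T> 2 (Hdiv \<Omega>) P2 \<and>
       vanishes_inside \<Omega> \<T> 0 (H1 \<Omega>) Q0 \<and>
       vanishes_inside \<Omega> \<T> 1 (Hcurl \<Omega>) Q1 \<and>
       vanishes_inside \<Omega> \<T> 2 (Hdiv \<Omega>) Q2 \<and>
       locally_bounded es1 (K (shape_reg \<T>) p) \<Omega> \<T> 0 (wgrad \<Omega>) (H1 \<Omega>) P0 \<and>
       locally_bounded es1 (K (shape_reg \<T>) p) \<Omega> \<T> 1 (wcurl \<Omega>) (Hcurl \<Omega>) P1 \<and>
       locally_bounded es1 (K (shape_reg \<T>) p) \<Omega> \<T> 2 (wdiv \<Omega>) (Hdiv \<Omega>) P2 \<and>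
       locally_bounded es1 (K (shape_reg \<T>) p) \<Omega> \<T> 0 (wgrad \<Omega>) (H1 \<Omega>) Q0 \<and>
       locally_bounded es1 (K (shape_reg \<T>) p) \<Omega> \<T> 1 (wcurl \<Omega>) (Hcurl \<Omega>) Q1 \<and>
       locally_bounded es1 (K (shape_reg \<T>) p) \<Omega> \<T> 2 (wdiv \<Omega>) (Hdiv \<Omega>) Q2
     \<longrightarrow>
       preserves_trace (tr0 \<Omega>) (trace_in (tr0 \<Omega>) (H1 \<Omega>) (FE0 \<Omega> \<T> p)) (combine P0 Q0) \<and>
       preserves_trace (tr1 \<Omega>) (trace_in (tr1 \<Omega>) (Hcurl \<Omega>) (FE1 \<Omega> \<T> p)) (combine P1 Q1) \<and>
       preserves_trace (tr2 \<Omega>) (trace_in (tr2 \<Omega>) (Hdiv \<Omega>) (FE2 \<Omega> \<T> p)) (combine P2 Q2) \<and>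
       commutes_on_trace (tr1 \<Omega>) (wgrad \<Omega>) (H1 \<Omega>) (combine P0 Q0) (combine P1 Q1) \<and>
       commutes_on_trace (tr2 \<Omega>) (wcurl \<Omega>) (Hcurl \<Omega>) (combine P1 Q1) (combine P2 Q2) \<and>
       vanishes_inside \<Omega> \<T> 0 (H1 \<Omega>) (combine P0 Q0) \<and>
       vanishes_inside \<Omega> \<T> 1 (Hcurl \<Omega>) (combine P1 Q1) \<and>
       vanishes_inside \<Omega> \<T> 2 (Hdiv \<Omega>) (combine P2 Q2) \<and>
       locally_bounded es2 (C (shape_reg \<T>) p) \<Omega> \<T> 0 (wgrad \<Omega>) (H1 \<Omega>) (combine P0 Q0) \<and>
       locally_bounded es2 (C (shape_reg \<T>) p) \<Omega> \<T> 1 (wcurl \<Omega>) (Hcurl \<Omega>) (combine P1 Q1) \<and>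
       locally_bounded es2 (C (shape_reg \<T>) p) \<Omega> \<T> 2 (wdiv \<Omega>) (Hdiv \<Omega>) (combine P2 Q2)"
proof (intro exI[of _ "\<lambda>\<rho> p. bound_const \<rho> \<bar>K \<rho> p\<bar>"] allI impI, elim conjE, goal_cases)
  case prems: (1 p \<Omega> \<T> W0 W1 W2 P0 P1 P2 Q0 Q1 Q2)
  \<comment> \<open>The witness for C depends on the degree p through K alone, since every geometric
    constant is a function of the shape regularity.\<close>
  note lip = prems(1) and poly = prems(2) and mesh = prems(3)
  have \<Omega>: "open \<Omega>" "bounded \<Omega>" using lip by (simp_all add: lipschitz_domain_def)
  interpret Gr: mesh_derivative "\<lambda>i (v :: R3). v $ i" "\<lambda>i (r :: real). r *\<^sub>R axis i (1 :: real)" "-1" \<Omega> \<T>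
    by unfold_locales (use \<Omega> lip mesh poly in auto)
  interpret Cu: mesh_derivative "\<lambda>i. cross3 (axis i 1)" "\<lambda>i u. cross3 u (axis i 1)" 1 \<Omega> \<T>
    by unfold_locales (use \<Omega> lip mesh poly in auto)
  interpret Di: mesh_derivative "\<lambda>i (r :: real). r *\<^sub>R axis i (1 :: real)" "\<lambda>i (v :: R3). v $ i" "-1" \<Omega> \<T>
    by unfold_locales (use \<Omega> lip mesh poly in auto)
  interpret GrCu: weak_complex "\<lambda>i (v :: R3). v $ i" "\<lambda>i (r :: real). r *\<^sub>R axis i (1 :: real)" "-1" \<Omega>
    "\<lambda>i. cross3 (axis i 1)" "\<lambda>i u. cross3 u (axis i 1)" 1
    by unfold_locales (rule gr_D_cu_D)
  interpret CuDi: weak_complex "\<lambda>i. cross3 (axis i 1)" "\<lambda>i u. cross3 u (axis i 1)" 1 \<Omega>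
    "\<lambda>i (r :: real). r *\<^sub>R axis i (1 :: real)" "\<lambda>i (v :: R3). v $ i" "-1"
    by unfold_locales (rule cu_D_di_D)
  have FE: "FE0 \<Omega> \<T> q \<subseteq> H1 \<Omega>" "FE1 \<Omega> \<T> q \<subseteq> Hcurl \<Omega>" "FE2 \<Omega> \<T> q \<subseteq> Hdiv \<Omega>" for q
    by (auto simp: FE0_def FE1_def FE2_def piecewise_def)
  have W: "W0 \<subseteq> H1 \<Omega>" "W1 \<subseteq> Hcurl \<Omega>" "W2 \<subseteq> Hdiv \<Omega>"
    using prems(5,7,9) FE by blast+
  \<comment> \<open>Zero is required in the spaces of the levels that d maps to, where the
    commutator of trace zero is absorbed.\<close>
  have zero: "(\<lambda>x. 0) \<in> W1" "(\<lambda>x. 0) \<in> W2" using prems(6,8) by (simp_all add: ae_subspace_def)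
  note PV = ae_linear_operator_mem[OF prems(14) FE(1)] ae_linear_operator_mem[OF prems(15) FE(2)]
    ae_linear_operator_mem[OF prems(16) FE(3)]
  note QV = ae_linear_operator_mem[OF prems(17) W(1)] ae_linear_operator_mem[OF prems(18) W(2)]
    ae_linear_operator_mem[OF prems(19) W(3)]
  \<comment> \<open>The lowest order of the range of \<open>P\<close> enters here. \<open>Q\<close>
    acts last, and its output is not differentiated in the local bound.\<close>
  note affine = ae_linear_operator_piecewise[OF prems(14)[unfolded FE0_def add_0], of affine_field]
    ae_linear_operator_piecewise[OF prems(15)[unfolded FE1_def], of affine_field]
    ae_linear_operator_piecewise[OF prems(16)[unfolded FE2_def], of affine_field]
  show ?case
    by (intro conjI
        Gr.preserves_trace_combine[unfolded gr_eqs, OF FE(1)[of 0] W(1)]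
        Cu.preserves_trace_combine[unfolded cu_eqs, OF FE(2)[of 0] W(2)]
        Di.preserves_trace_combine[unfolded di_eqs, OF FE(3)[of 0] W(3)]
        GrCu.commutes_on_trace_combine[unfolded gr_eqs cu_eqs, OF FE(1)[of 0] W(1) FE(2)[of 0] W(2) zero(1)]
        CuDi.commutes_on_trace_combine[unfolded cu_eqs di_eqs, OF FE(2)[of 0] W(2) FE(3)[of 0] W(3) zero(2)]
        Gr.vanishes_inside_combine[unfolded gr_eqs, OF PV(1)]
        Cu.vanishes_inside_combine[unfolded cu_eqs, OF PV(2)]
        Di.vanishes_inside_combine[unfolded di_eqs, OF PV(3)]
        Gr.locally_bounded_combine[unfolded gr_eqs, OF PV(1) QV(1) affine(1)[OF poly_le_1_affine]]
        Cu.locally_bounded_combine[unfolded cu_eqs, OF PV(2) QV(2) affine(2)[OF nedelec_0_affine]]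
        Di.locally_bounded_combine[unfolded di_eqs, OF PV(3) QV(3) affine(3)[OF raviart_thomas_0_affine]]
        prems)
qed

end
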